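(* The center of the ring $\mathrm{Diff}_{\mathbf h}(n)$ is formed by polynomials in the elements $c_1,\dots,c_n$; that is, the center equals the $\mathfrak k$-subalgebra generated by $c_1,\dots,c_n$.
   Context: $n\ge 1$ is an integer; $\mathfrak{k}$ is a commutative integral domain of characteristic zero (the ground ring). $\mathrm{U}(\mathbf h)=\mathfrak{k}[\tilde h_1,\dots,\tilde h_n]$ is the polynomial ring; $\tilde h_{ij}:=\tilde h_i-\tilde h_j$; $\bar{\mathrm U}(\mathbf h)$ is the localization of $\mathrm{U}(\mathbf h)$ at the multiplicative set generated by all $\tilde h_{ij}+k$, $i\ne j$, $k\in\mathbb{Z}$. The ring $\mathrm{Diff}_{\mathbf h}(n)$ of $\mathbf h$-deformed differential operators of type A is the $\mathfrak k$-algebra generated by $\bar{\mathrm U}(\mathbf h)$ and elements $x^j,\bar\partial_j$, $j=1,\dots,n$, with defining relations (for all indices, besides those of $\bar{\mathrm U}(\mathbf h)$; relations for $\tilde h_i$ extend to all of $\bar{\mathrm U}(\mathbf h)$): $$\tilde h_i x^j=x^j(\tilde h_i+\delta_i^j),\qquad \tilde h_i\bar\partial_j=\bar\partial_j(\tilde h_i-\delta_i^j),$$ $$x^ix^j=\frac{\tilde h_{ij}+1}{\tilde h_{ij}}x^jx^i\ (i<j),\qquad \bar\partial_i\bar\partial_j=\frac{\tilde h_{ij}-1}{\tilde h_{ij}}\bar\partial_j\bar\partial_i\ (i<j),$$ $$x^i\bar\partial_j=\bar\partial_jx^i\ (i<j),\qquad x^i\bar\partial_j=\frac{\tilde h_{ij}(\tilde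 h_{ij}-2)}{(\tilde h_{ij}-1)^2}\bar\partial_jx^i\ (i>j),\qquad x^i\bar\partial_i=\sum_{j=1}^n\frac{1}{1-\tilde h_{ij}}\bar\partial_jx^j-1.$$ It is free as a one-sided $\bar{\mathrm U}(\mathbf h)$-module and has no zero divisors. Put $\Gamma_j:=\bar\partial_jx^j$. Let $e_k=\sum_{i_1<\dots<i_k}\tilde h_{i_1}\cdots\tilde h_{i_k}$ be the elementary symmetric functions in $\tilde h_1,\dots,\tilde h_n$, and $$c_k:=\sum_{j=1}^n\frac{\partial e_k}{\partial\tilde h_j}\Gamma_j-e_k,\qquad k=1,\dots,n.$$ *)

theory Defs
  imports
    "HOL-Library.Poly_Mapping"
    "HOL-Computational_Algebra.Fraction_Field"
    "HOL-Algebra.QuotRing"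
    "HOL-Algebra.Generated_Rings"
begin

section \<open>The coefficient ring\<close>

text \<open>
  Polynomials in variables indexed by the natural numbers: a monomial is a finitely supported
  exponent function, a polynomial a finitely supported function on monomials. The ring attached to
  a given \<open>n\<close> only uses the variables with index in \<open>{1..n}\<close>.
\<close>

type_synonym 'k hpoly = "(nat \<Rightarrow>\<^sub>0 nat) \<Rightarrow>\<^sub>0 'k"
type_synonym 'k hfrac = "'k hpoly fract"

definition pvar :: "nat \<Rightarrow> 'k::idom hpoly" where
  "pvar i = Poly_Mapping.single (Poly_Mapping.single i 1) 1"

definition pconst :: "'k::idom \<Rightarrow> 'k hpoly" where
  "pconst a = Poly_Mapping.single 0 a"

definition pderivative :: "nat \<Rightarrow> 'k::idom hpoly \<Rightarrow> 'k hpoly" where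
  "pderivative j p = (\<Sum>m \<in> Poly_Mapping.keys p.
     Poly_Mapping.single (m - Poly_Mapping.single j 1)
       (of_nat (Poly_Mapping.lookup m j) * Poly_Mapping.lookup p m))"

definition esym :: "nat \<Rightarrow> nat \<Rightarrow> 'k::idom hpoly" where
  "esym n k = (\<Sum>S | S \<subseteq> {1..n} \<and> card S = k. \<Prod>i\<in>S. pvar i)"

definition U_h :: "nat \<Rightarrow> 'k::idom hpoly set" where
  "U_h n = {p. \<forall>m \<in> Poly_Mapping.keys p. Poly_Mapping.keys m \<subseteq> {1..n}}"

inductive_set denoms :: "nat \<Rightarrow> 'k::idom hpoly set" for n :: nat where
  one: "1 \<in> denoms n"
| mult: "\<lbrakk>q \<in> denoms n; i \<in> {1..n}; j \<in> {1..n}; i \<noteq> j\<rbrakk>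
    \<Longrightarrow> q * (pvar i - pvar j + of_int k) \<in> denoms n"

text \<open>
  No denominator vanishes (lemma \<open>denoms_nonzero\<close> below), so the localization is a subring of the
  field of fractions.
\<close>

definition Ubar_h :: "nat \<Rightarrow> 'k::idom hfrac set" where
  "Ubar_h n = {Fraction_Field.Fract p q | p q. p \<in> U_h n \<and> q \<in> denoms n}"

definition hh :: "nat \<Rightarrow> 'k::idom hfrac" where
  "hh i = Fraction_Field.Fract (pvar i) 1"

definition hdiff :: "nat \<Rightarrow> nat \<Rightarrow> 'k::idom hfrac" where
  "hdiff i j = hh i - hh j"

section \<open>Free associative algebras\<close>

datatype 'g word = Word (letters: "'g list")

instantiation word :: (type) monoid_add
begin

definition zero_word :: "'a word" where
  "0 = Word []"

definition plus_word :: "'a word \<Rightarrow> 'a word \<Rightarrow> 'a word" where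
  "u + v = Word (letters u @ letters v)"

instance
  by standard (simp_all add: zero_word_def plus_word_def)

end

text \<open>
  The convolution product on finitely supported functions on words is the product of the free
  associative algebra; \<open>free_algebra G\<close> is the subalgebra on the generators in \<open>G\<close>.
\<close>

definition free_algebra :: "'g set \<Rightarrow> ('g word \<Rightarrow>\<^sub>0 'k::comm_ring_1) ring" where
  "free_algebra G =
     \<lparr>carrier = {p. \<forall>w \<in> Poly_Mapping.keys p. set (letters w) \<subseteq> G},
      mult = (*), one = 1, zero = 0, add = (+)\<rparr>"

definition gen :: "'g \<Rightarrow> 'g word \<Rightarrow>\<^sub>0 'k::comm_ring_1" where
  "gen g = Poly_Mapping.single (Word [g]) 1"

definition scal :: "'k::comm_ring_1 \<Rightarrow> 'g word \<Rightarrow>\<^sub>0 'k" where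
  "scal a = Poly_Mapping.single 0 a"

section \<open>The ring of h-deformed differential operators\<close>

datatype 'u dgen = Coeff 'u | XGen nat | DGen nat

type_synonym 'k dalg = "'k hfrac dgen word \<Rightarrow>\<^sub>0 'k"

definition dgens :: "nat \<Rightarrow> 'k::idom hfrac dgen set" where
  "dgens n = Coeff ` Ubar_h n \<union> XGen ` {1..n} \<union> DGen ` {1..n}"

abbreviation cf :: "'k::idom hfrac \<Rightarrow> 'k dalg" where
  "cf u \<equiv> gen (Coeff u)"

abbreviation X :: "nat \<Rightarrow> 'k::idom dalg" where
  "X j \<equiv> gen (XGen j)"

abbreviation D :: "nat \<Rightarrow> 'k::idom dalg" where
  "D j \<equiv> gen (DGen j)"

text \<open>
  The first three rules say that \<open>cf\<close> becomes a homomorphism of algebras over the ground ring from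
  \<open>Ubar_h n\<close> to the quotient. The commutation rules of a general coefficient with \<open>X j\<close> and
  \<open>D j\<close> follow from those of \<open>hh i\<close>, because the denominators are invertible.
\<close>

inductive_set relators :: "nat \<Rightarrow> 'k::idom dalg set" for n :: nat where
  cf_add: "\<lbrakk>u \<in> Ubar_h n; v \<in> Ubar_h n\<rbrakk> \<Longrightarrow> cf (u + v) - (cf u + cf v) \<in> relators n"
| cf_mult: "\<lbrakk>u \<in> Ubar_h n; v \<in> Ubar_h n\<rbrakk> \<Longrightarrow> cf (u * v) - cf u * cf v \<in> relators n"
| cf_const: "cf (Fraction_Field.Fract (pconst a) 1) - scal a \<in> relators n"
| h_X: "\<lbrakk>i \<in> {1..n}; j \<in> {1..n}\<rbrakk>
    \<Longrightarrow> cf (hh i) * X j - X j * cf (hh i + (if i = j then 1 else 0)) \<in> relators n"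
| h_D: "\<lbrakk>i \<in> {1..n}; j \<in> {1..n}\<rbrakk>
    \<Longrightarrow> cf (hh i) * D j - D j * cf (hh i - (if i = j then 1 else 0)) \<in> relators n"
| X_X: "\<lbrakk>i \<in> {1..n}; j \<in> {1..n}; i < j\<rbrakk>
    \<Longrightarrow> X i * X j - cf ((hdiff i j + 1) / hdiff i j) * X j * X i \<in> relators n"
| D_D: "\<lbrakk>i \<in> {1..n}; j \<in> {1..n}; i < j\<rbrakk>
    \<Longrightarrow> D i * D j - cf ((hdiff i j - 1) / hdiff i j) * D j * D i \<in> relators n"
| X_D_less: "\<lbrakk>i \<in> {1..n}; j \<in> {1..n}; i < j\<rbrakk>
    \<Longrightarrow> X i * D j - D j * X i \<in> relators n"
| X_D_greater: "\<lbrakk>i \<in> {1..n}; j \<in> {1..n}; i > j\<rbrakk>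
    \<Longrightarrow> X i * D j - cf (hdiff i j * (hdiff i j - 2) / (hdiff i j - 1)\<^sup>2) * D j * X i \<in> relators n"
| X_D_same: "i \<in> {1..n}
    \<Longrightarrow> X i * D i - ((\<Sum>j=1..n. cf (1 / (1 - hdiff i j)) * D j * X j) - 1) \<in> relators n"

definition Diff_ideal :: "nat \<Rightarrow> 'k::idom dalg set" where
  "Diff_ideal n = Idl\<^bsub>free_algebra (dgens n)\<^esub> (relators n)"

definition Diff_h :: "nat \<Rightarrow> ('k::idom dalg set) ring" where
  "Diff_h n = free_algebra (dgens n) Quot Diff_ideal n"

definition Diff_class :: "nat \<Rightarrow> 'k::idom dalg \<Rightarrow> 'k dalg set" where
  "Diff_class n p = Diff_ideal n +>\<^bsub>free_algebra (dgens n)\<^esub> p"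

definition c_elem :: "nat \<Rightarrow> nat \<Rightarrow> 'k::idom dalg set" where
  "c_elem n k = Diff_class n
     ((\<Sum>j=1..n. cf (Fraction_Field.Fract (pderivative j (esym n k)) 1) * (D j * X j)) - cf (Fraction_Field.Fract (esym n k) 1))"

definition ring_center :: "('a, 'b) ring_scheme \<Rightarrow> 'a set" where
  "ring_center R = {z \<in> carrier R. \<forall>a \<in> carrier R. z \<otimes>\<^bsub>R\<^esub> a = a \<otimes>\<^bsub>R\<^esub> z}"

text \<open>The subalgebra over the ground ring generated by \<open>S\<close> is the subring generated by \<open>S\<close> and the
  scalars.\<close>

definition Diff_subalgebra :: "nat \<Rightarrow> 'k::idom dalg set set \<Rightarrow> 'k dalg set set" where
  "Diff_subalgebra n S = generate_ring (Diff_h n) (range (\<lambda>a. Diff_class n (scal a)) \<union> S)"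

section \<open>Well-formedness\<close>

lemma keys_mult_subset:
  fixes p q :: "'a::monoid_add \<Rightarrow>\<^sub>0 'k::semiring_0"
  assumes "w \<in> Poly_Mapping.keys (p * q)"
  shows "\<exists>u\<in>Poly_Mapping.keys p. \<exists>v\<in>Poly_Mapping.keys q. w = u + v"
  using assms Poly_Mapping.keys_mult[of p q] by blast

lemma free_algebra_ring: "ring (free_algebra G :: ('g word \<Rightarrow>\<^sub>0 'k::comm_ring_1) ring)"
proof (rule ringI)
  let ?R = "free_algebra G :: ('g word \<Rightarrow>\<^sub>0 'k) ring"
  show "abelian_group ?R"
  proof (rule abelian_groupI)
    fix p q assume "p \<in> carrier ?R" "q \<in> carrier ?R"
    then show "p \<oplus>\<^bsub>?R\<^esub> q \<in> carrier ?R"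
      using Poly_Mapping.keys_add[of p q] by (auto simp: free_algebra_def)
  next
    fix p assume "p \<in> carrier ?R"
    then show "\<exists>q\<in>carrier ?R. q \<oplus>\<^bsub>?R\<^esub> p = \<zero>\<^bsub>?R\<^esub>"
      by (intro bexI[of _ "- p"]) (auto simp: free_algebra_def)
  qed (auto simp: free_algebra_def algebra_simps)
  show "Group.monoid ?R"
  proof (rule monoidI)
    fix p q assume pq: "p \<in> carrier ?R" "q \<in> carrier ?R"
    show "p \<otimes>\<^bsub>?R\<^esub> q \<in> carrier ?R"
      using pq keys_mult_subset[of _ p q] by (fastforce simp: free_algebra_def plus_word_def)
  qed (auto simp: free_algebra_def algebra_simps zero_word_def)
qed (auto simp: free_algebra_def algebra_simps)

lemma U_h_const: "pconst a \<in> (U_h n :: 'k::idom hpoly set)"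
  by (simp add: U_h_def pconst_def)

lemma U_h_of_int: "of_int k \<in> (U_h n :: 'k::idom hpoly set)"
  by (simp add: U_h_def single_of_int[symmetric] del: single_of_int)

lemma U_h_one: "1 \<in> (U_h n :: 'k::idom hpoly set)"
  by (simp add: U_h_def)

lemma U_h_pvar: "i \<in> {1..n} \<Longrightarrow> pvar i \<in> (U_h n :: 'k::idom hpoly set)"
  by (simp add: U_h_def pvar_def)

lemma U_h_add: "p \<in> U_h n \<Longrightarrow> q \<in> U_h n \<Longrightarrow> p + q \<in> (U_h n :: 'k::idom hpoly set)"
  unfolding U_h_def using Poly_Mapping.keys_add[of p q] by blast

lemma U_h_diff: "p \<in> U_h n \<Longrightarrow> q \<in> U_h n \<Longrightarrow> p - q \<in> (U_h n :: 'k::idom hpoly set)"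
  unfolding U_h_def using Poly_Mapping.keys_diff[of p q] by blast

lemma U_h_mult:
  assumes "p \<in> U_h n" "q \<in> U_h n"
  shows "p * q \<in> (U_h n :: 'k::idom hpoly set)"
  unfolding U_h_def
proof clarify
  fix m i assume m: "m \<in> Poly_Mapping.keys (p * q)" and i: "i \<in> Poly_Mapping.keys m"
  obtain u v where "u \<in> Poly_Mapping.keys p" "v \<in> Poly_Mapping.keys q" "m = u + v"
    using keys_mult_subset[OF m] by blast
  then show "i \<in> {1..n}"
    using assms i Poly_Mapping.keys_add[of u v] unfolding U_h_def by blast
qed

lemma denoms_mult: "p \<in> denoms n \<Longrightarrow> q \<in> denoms n \<Longrightarrow> q * p \<in> (denoms n :: 'k::idom hpoly set)"
  by (induction p rule: denoms.induct)
    (auto simp: mult.assoc[symmetric] simp del: atLeastAtMost_iff intro: denoms.mult)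

lemma denoms_U_h: "q \<in> denoms n \<Longrightarrow> q \<in> (U_h n :: 'k::idom hpoly set)"
  by (induction rule: denoms.induct)
    (intro U_h_one U_h_mult U_h_add U_h_diff U_h_pvar U_h_of_int; assumption)+

lemma pvar_diff_nonzero:
  assumes "i \<noteq> j"
  shows "pvar i - pvar j + of_int k \<noteq> (0 :: 'k::idom hpoly)"
proof
  let ?m = "Poly_Mapping.single i (1::nat)"
  assume "pvar i - pvar j + of_int k = (0 :: 'k hpoly)"
  then have "Poly_Mapping.lookup (pvar i - pvar j + of_int k :: 'k hpoly) ?m = 0"
    by simp
  moreover have "?m \<noteq> 0"
    by (metis keys_single keys_zero insert_not_empty one_neq_zero)
  then have "Poly_Mapping.lookup (of_int k :: 'k hpoly) ?m = 0"
    by (simp add: single_of_int[symmetric] lookup_single when_def del: single_of_int)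
  moreover have "Poly_Mapping.single j (1::nat) \<noteq> ?m"
    using assms by (metis keys_single one_neq_zero singleton_inject)
  ultimately show False
    by (simp add: lookup_add lookup_minus pvar_def lookup_single when_def)
qed

lemma denoms_nonzero: "q \<in> denoms n \<Longrightarrow> q \<noteq> (0 :: 'k::idom hpoly)"
  by (induction rule: denoms.induct) (simp_all add: pvar_diff_nonzero)

lemma Ubar_fract: "p \<in> U_h n \<Longrightarrow> q \<in> denoms n \<Longrightarrow> Fraction_Field.Fract p q \<in> (Ubar_h n :: 'k::idom hfrac set)"
  unfolding Ubar_h_def by blast

lemma Ubar_poly: "p \<in> U_h n \<Longrightarrow> Fraction_Field.Fract p 1 \<in> (Ubar_h n :: 'k::idom hfrac set)"
  by (intro Ubar_fract denoms.one)

lemma Ubar_cases: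
  assumes "u \<in> (Ubar_h n :: 'k::idom hfrac set)"
  obtains p q where "u = Fraction_Field.Fract p q" "p \<in> U_h n" "q \<in> denoms n" "q \<noteq> 0"
  using assms denoms_nonzero unfolding Ubar_h_def by blast

lemma Ubar_add: "u \<in> Ubar_h n \<Longrightarrow> v \<in> Ubar_h n \<Longrightarrow> u + v \<in> (Ubar_h n :: 'k::idom hfrac set)"
  by (elim Ubar_cases) (auto intro!: Ubar_fract U_h_add U_h_mult denoms_mult intro: denoms_U_h)

lemma Ubar_diff: "u \<in> Ubar_h n \<Longrightarrow> v \<in> Ubar_h n \<Longrightarrow> u - v \<in> (Ubar_h n :: 'k::idom hfrac set)"
  by (elim Ubar_cases) (auto intro!: Ubar_fract U_h_diff U_h_mult denoms_mult intro: denoms_U_h)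

lemma Ubar_mult: "u \<in> Ubar_h n \<Longrightarrow> v \<in> Ubar_h n \<Longrightarrow> u * v \<in> (Ubar_h n :: 'k::idom hfrac set)"
  by (elim Ubar_cases) (auto intro!: Ubar_fract U_h_mult denoms_mult)

lemma Ubar_of_int: "of_int k \<in> (Ubar_h n :: 'k::idom hfrac set)"
proof -
  have "(of_int k :: 'k hfrac) = Fraction_Field.Fract (of_int k) 1"
    by (cases k) (simp_all add: of_nat_fract One_fract_def)
  then show ?thesis
    by (simp add: Ubar_poly U_h_of_int)
qed

lemma Ubar_zero: "0 \<in> (Ubar_h n :: 'k::idom hfrac set)"
  using Ubar_of_int[of 0] by simp

lemma Ubar_one: "1 \<in> (Ubar_h n :: 'k::idom hfrac set)"
  using Ubar_of_int[of 1] by simp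

lemma Ubar_hh: "i \<in> {1..n} \<Longrightarrow> hh i \<in> (Ubar_h n :: 'k::idom hfrac set)"
  unfolding hh_def by (intro Ubar_poly U_h_pvar)

lemma Ubar_hdiff:
  "i \<in> {1..n} \<Longrightarrow> j \<in> {1..n} \<Longrightarrow> hdiff i j \<in> (Ubar_h n :: 'k::idom hfrac set)"
  unfolding hdiff_def by (intro Ubar_diff Ubar_hh)

lemma hdiff_shift:
  "hdiff i j + of_int k = (Fraction_Field.Fract (pvar i - pvar j + of_int k) 1 :: 'k::idom hfrac)"
proof -
  have "(of_int k :: 'k hfrac) = Fraction_Field.Fract (of_int k) 1"
    by (cases k) (simp_all add: of_nat_fract One_fract_def)
  then show ?thesis
    by (simp add: hdiff_def hh_def)
qed

lemma Ubar_inverse_shift: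
  assumes "i \<in> {1..n}" "j \<in> {1..n}" "i \<noteq> j"
  shows "inverse (hdiff i j + of_int k) \<in> (Ubar_h n :: 'k::idom hfrac set)"
  using Ubar_fract[OF U_h_one denoms.mult[OF denoms.one assms, of k]]
  by (simp add: hdiff_shift)

abbreviation (input) free_carrier :: "nat \<Rightarrow> 'k::idom dalg set" where
  "free_carrier n \<equiv> carrier (free_algebra (dgens n))"

lemma free_diff:
  "p \<in> carrier (free_algebra G) \<Longrightarrow> q \<in> carrier (free_algebra G)
    \<Longrightarrow> p - q \<in> carrier (free_algebra G :: ('g word \<Rightarrow>\<^sub>0 'k::comm_ring_1) ring)"
  using Poly_Mapping.keys_diff[of p q] by (auto simp: free_algebra_def)

lemma free_add:
  "p \<in> carrier (free_algebra G) \<Longrightarrow> q \<in> carrier (free_algebra G)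
    \<Longrightarrow> p + q \<in> carrier (free_algebra G :: ('g word \<Rightarrow>\<^sub>0 'k::comm_ring_1) ring)"
  using Poly_Mapping.keys_add[of p q] by (auto simp: free_algebra_def)

lemma free_mult:
  "p \<in> carrier (free_algebra G) \<Longrightarrow> q \<in> carrier (free_algebra G)
    \<Longrightarrow> p * q \<in> carrier (free_algebra G :: ('g word \<Rightarrow>\<^sub>0 'k::comm_ring_1) ring)"
  using ring.ring_simprules(5)[OF free_algebra_ring, of p G q] by (simp add: free_algebra_def)

lemma free_sum:
  "(\<And>i. i \<in> I \<Longrightarrow> f i \<in> carrier (free_algebra G))
    \<Longrightarrow> sum f I \<in> carrier (free_algebra G :: ('g word \<Rightarrow>\<^sub>0 'k::comm_ring_1) ring)"
proof (induction I rule: infinite_finite_induct)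
  case (insert i I)
  then show ?case by (simp add: free_add)
qed (simp_all add: free_algebra_def)

lemma free_scal: "scal a \<in> carrier (free_algebra G :: ('g word \<Rightarrow>\<^sub>0 'k::comm_ring_1) ring)"
  by (simp add: free_algebra_def scal_def zero_word_def)

lemma free_one: "1 \<in> carrier (free_algebra G :: ('g word \<Rightarrow>\<^sub>0 'k::comm_ring_1) ring)"
  by (simp add: free_algebra_def zero_word_def)

lemma free_gen: "g \<in> G \<Longrightarrow> gen g \<in> carrier (free_algebra G :: ('g word \<Rightarrow>\<^sub>0 'k::comm_ring_1) ring)"
  by (simp add: free_algebra_def gen_def)

lemma free_cf: "u \<in> Ubar_h n \<Longrightarrow> cf u \<in> (free_carrier n :: 'k::idom dalg set)"
  by (rule free_gen) (simp add: dgens_def)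

lemma free_X: "j \<in> {1..n} \<Longrightarrow> X j \<in> (free_carrier n :: 'k::idom dalg set)"
  by (rule free_gen) (simp add: dgens_def)

lemma free_D: "j \<in> {1..n} \<Longrightarrow> D j \<in> (free_carrier n :: 'k::idom dalg set)"
  by (rule free_gen) (simp add: dgens_def)

lemma relators_carrier: "relators n \<subseteq> (free_carrier n :: 'k::idom dalg set)"
proof
  note intros = free_diff free_add free_mult free_sum free_scal free_one free_cf free_X free_D
    Ubar_add Ubar_mult Ubar_diff Ubar_hh Ubar_hdiff Ubar_one
  fix r :: "'k dalg" assume "r \<in> relators n"
  then show "r \<in> free_carrier n"
  proof cases
    case (cf_const a)
    then show ?thesis
      by (auto intro!: free_diff free_cf free_scal Ubar_poly U_h_const)
  next
    case (X_X i j)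
    moreover have "inverse (hdiff i j) \<in> (Ubar_h n :: 'k hfrac set)"
      using Ubar_inverse_shift[of i n j 0] X_X by simp
    ultimately show ?thesis
      unfolding divide_inverse by (simp only:) (intro intros; assumption)
  next
    case (D_D i j)
    moreover have "inverse (hdiff i j) \<in> (Ubar_h n :: 'k hfrac set)"
      using Ubar_inverse_shift[of i n j 0] D_D by simp
    ultimately show ?thesis
      unfolding divide_inverse by (simp only:) (intro intros; assumption)
  next
    case (X_D_greater i j)
    moreover have "inverse (hdiff i j - 1) \<in> (Ubar_h n :: 'k hfrac set)"
      using Ubar_inverse_shift[of i n j "-1"] X_D_greater by simp
    moreover have "(2 :: 'k hfrac) \<in> Ubar_h n"
      using Ubar_of_int[of 2] by simp
    ultimately show ?thesis
      unfolding divide_inverse power_inverse[symmetric] power2_eq_square inverse_mult_distrib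
      by (simp only:) (intro intros; assumption)
  next
    case (X_D_same i)
    have "inverse (1 - hdiff i j) \<in> (Ubar_h n :: 'k hfrac set)" if "j \<in> {1..n}" for j
    proof (cases "i = j")
      case True
      then show ?thesis by (simp add: hdiff_def Ubar_one)
    next
      case False
      have "1 - hdiff i j = (hdiff j i + of_int 1 :: 'k hfrac)"
        by (simp add: hdiff_def)
      then show ?thesis
        using Ubar_inverse_shift[of j n i 1] False that X_D_same(2) by metis
    qed
    then show ?thesis
      using X_D_same unfolding divide_inverse
      by (simp only:) (intro intros; (assumption | simp))
  next
    case (h_X i j)
    moreover have "(if i = j then 1 else 0) \<in> (Ubar_h n :: 'k hfrac set)"
      by (simp add: Ubar_zero Ubar_one)
    ultimately show ?thesis
      by (simp only:) (intro intros; assumption)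
  next
    case (h_D i j)
    moreover have "(if i = j then 1 else 0) \<in> (Ubar_h n :: 'k hfrac set)"
      by (simp add: Ubar_zero Ubar_one)
    ultimately show ?thesis
      by (simp only:) (intro intros; assumption)
  qed (simp only:, intro intros; assumption)+
qed

lemma Diff_ring: "ring (Diff_h n :: ('k::idom dalg set) ring)"
  unfolding Diff_h_def Diff_ideal_def
  by (intro ideal.quotient_is_ring ring.genideal_ideal free_algebra_ring relators_carrier)

end

theory Submission
  imports Defs "HOL-Computational_Algebra.Polynomial"
begin

text \<open>
  Write \<open>U\<close> for the localized polynomial ring, \<open>\<Gamma>\<^sub>j = d\<^sub>j x\<^sub>j\<close>, and collect the elements \<open>c\<^sub>k\<close> in
  \<open>\<chi>(s) = (\<Sum>k. c\<^sub>k s^(n-k)) - s^n\<close>. By Vieta's formula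
  \<open>\<chi>(s) = (\<Sum>j. (\<Prod>i\<noteq>j. s + h\<^sub>i) \<Gamma>\<^sub>j) - (\<Prod>i. s + h\<^sub>i)\<close>, so \<open>\<chi>\<close> is a Lagrange
  interpolation polynomial: \<open>\<chi>(-h\<^sub>j) = (\<Prod>i\<noteq>j. h\<^sub>i - h\<^sub>j) \<Gamma>\<^sub>j\<close>. Two things follow. Each \<open>\<Gamma>\<^sub>j\<close>
  lies in \<open>U[c\<^sub>1,\<dots>,c\<^sub>n]\<close> (\<open>gam_UC\<close>), and a prescription of scalars for the \<open>c\<^sub>k\<close> determines
  scalars for the \<open>\<Gamma>\<^sub>j\<close> (\<open>lagrange_coefficients\<close>).

  The \<open>c\<^sub>k\<close> are central by a direct computation: moving \<open>x\<^sub>i\<close> or \<open>d\<^sub>i\<close> past a combination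
  \<open>(\<Sum>j. u\<^sub>j \<Gamma>\<^sub>j) + v\<close> gives a combination of the same form (\<open>twisted_gamma_form\<close>), and for the
  coefficients of \<open>c\<^sub>k\<close> the two combinations agree by a three-term identity of elementary symmetric
  functions (\<open>twisted_c\<close>).

  For the converse one needs a normal form and a faithful representation. Let \<open>m\<^sub>w\<close>, \<open>w\<close> in the
  lattice of integer vectors, be the product of the \<open>x\<^sub>j\<close> to the power \<open>w\<^sub>j\<close> or \<open>d\<^sub>j\<close> to the power
  \<open>- w\<^sub>j\<close>, according to the sign of \<open>w\<^sub>j\<close>. Generators with distinct indices commute up to factors from \<open>U\<close>, and
  \<open>d\<^sub>i x\<^sub>i\<close> and \<open>x\<^sub>i d\<^sub>i\<close> lie in \<open>U[c]\<close>, so the elements \<open>c^\<gamma> m\<^sub>w\<close> span the ring over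
  \<open>U\<close> (\<open>carrier_span\<close>). Conversely the ring acts on functions on the lattice with values in
  \<open>K[c\<^sub>1,\<dots>,c\<^sub>n]\<close>, \<open>K\<close> being a field of rational functions that contains \<open>U\<close>: \<open>u\<close> in \<open>U\<close> acts at the point \<open>l\<close>
  as \<open>u\<close> with \<open>h\<^sub>i\<close> replaced by \<open>h\<^sub>i + l\<^sub>i\<close>, \<open>x\<^sub>j\<close> and \<open>d\<^sub>j\<close> translate by one unit and multiply by
  suitable factors, chosen so that \<open>c\<^sub>k\<close> acts as multiplication by the variable \<open>c\<^sub>k\<close>. That this
  is an action amounts to the Lagrange formula again, at the point \<open>s = 1 - h\<^sub>i\<close>
  (\<open>x_d_same_coefficient\<close>, \<open>act_relator\<close>). Here \<open>m\<^sub>w\<close> moves the delta function at \<open>0\<close> to a nonzero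
  multiple of the delta function at \<open>w\<close>, so the coefficients of a combination of the \<open>c^\<gamma> m\<^sub>w\<close>
  can be read off from its action on that single function (\<open>rho_combination_point\<close>).

  Now let \<open>z = \<Sum> u\<^sub>w\<^sub>\<gamma> c^\<gamma> m\<^sub>w\<close> be central. Commutation with the \<open>h\<^sub>i\<close> leaves only \<open>w = 0\<close>
  (\<open>central_support\<close>), and commutation with all \<open>m\<^sub>w\<close> makes every remaining coefficient invariant
  under all integer shifts of the \<open>h\<^sub>i\<close> (\<open>central_coefficients\<close>). A shift-invariant element of
  \<open>U\<close> is a constant (\<open>shift_invariant_const\<close>), because in characteristic zero a polynomial is
  determined by its values at integer points. Hence \<open>z\<close> is a polynomial in the \<open>c\<^sub>k\<close> over the ground
  ring.
\<close>

abbreviation lookup :: "('a \<Rightarrow>\<^sub>0 'b) \<Rightarrow> 'a \<Rightarrow> 'b::zero" where "lookup \<equiv> Poly_Mapping.lookup"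
abbreviation keys :: "('a \<Rightarrow>\<^sub>0 'b::zero) \<Rightarrow> 'a set" where "keys \<equiv> Poly_Mapping.keys"
abbreviation single :: "'a \<Rightarrow> 'b::zero \<Rightarrow> 'a \<Rightarrow>\<^sub>0 'b" where "single \<equiv> Poly_Mapping.single"

section \<open>Polynomials, evaluations and shifts\<close>

text \<open>
  Evaluations, specializations, shifts and embeddings of constants are all unital homomorphisms
  between commutative rings given by types; their interplay with sums, products and numerals is
  the same for all of them.
\<close>

locale unital_hom =
  fixes h :: "'a::comm_ring_1 \<Rightarrow> 'b::comm_ring_1"
  assumes hom_one [simp]: "h 1 = 1"
    and hom_add [simp]: "h (a + b) = h a + h b"
    and hom_mult [simp]: "h (a * b) = h a * h b"
begin

lemma hom_zero [simp]: "h 0 = 0"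
  using hom_add[of 0 0] by simp

lemma hom_minus [simp]: "h (- a) = - h a"
  using hom_add[of a "- a"] by (simp add: eq_neg_iff_add_eq_0 add.commute)

lemma hom_diff [simp]: "h (a - b) = h a - h b"
  using hom_add[of a "- b"] by simp

lemma hom_power [simp]: "h (a ^ k) = h a ^ k"
  by (induction k) simp_all

lemma hom_of_nat [simp]: "h (of_nat k) = of_nat k"
  by (induction k) simp_all

lemma hom_of_int [simp]: "h (of_int k) = of_int k"
  by (cases k) simp_all

lemma hom_numeral [simp]: "h (numeral k) = numeral k"
  using hom_of_nat[of "numeral k"] by simp

lemma hom_sum [simp]: "h (sum f I) = (\<Sum>i\<in>I. h (f i))"
  by (induction I rule: infinite_finite_induct) simp_all

lemma hom_prod [simp]: "h (prod f I) = (\<Prod>i\<in>I. h (f i))"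
  by (induction I rule: infinite_finite_induct) simp_all

end

text \<open>
  Induction over the terms of \<open>p\<close>. Besides the bare sum, the step knows that the new term is not
  yet in \<open>q\<close> and that \<open>q\<close> is a part of \<open>p\<close>, so hypotheses on the support of \<open>p\<close> carry over.
\<close>

lemma term_induct [case_names zero add]:
  fixes p :: "'a \<Rightarrow>\<^sub>0 'b::comm_monoid_add"
  assumes "P 0"
    and "\<And>k q. k \<in> keys p \<Longrightarrow> k \<notin> keys q \<Longrightarrow> keys q \<subseteq> keys p
      \<Longrightarrow> (\<And>j. j \<in> keys q \<Longrightarrow> lookup q j = lookup p j)
      \<Longrightarrow> P q \<Longrightarrow> P (single k (lookup p k) + q)"
  shows "P p"
proof -
  have *: "P (\<Sum>k\<in>S. single k (lookup p k))" if "finite S" "S \<subseteq> keys p" for S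
    using that
  proof (induction S)
    case (insert k S)
    let ?q = "\<Sum>k\<in>S. single k (lookup p k)"
    have lk: "lookup ?q j = (if j \<in> S then lookup p j else 0)" for j
      using insert(1) by (simp add: lookup_sum lookup_single when_def)
    have "keys ?q = S"
      using insert.prems by (auto simp: in_keys_iff lk split: if_splits)
    then show ?case using insert assms(2)[of k ?q] by (auto simp: lk)
  qed (use assms(1) in simp)
  have "p = (\<Sum>k\<in>keys p. single k (lookup p k))"
    by (rule poly_mapping_eqI) (simp add: lookup_sum lookup_single when_def in_keys_iff)
  with *[of "keys p"] show ?thesis by simp
qed

definition monomial_eval :: "(nat \<Rightarrow> 'b::comm_ring_1) \<Rightarrow> (nat \<Rightarrow>\<^sub>0 nat) \<Rightarrow> 'b" where
  "monomial_eval v m = (\<Prod>i\<in>keys m. v i ^ lookup m i)"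

text \<open>
  Evaluation at \<open>v\<close> over a change of coefficients \<open>c\<close>; with \<open>c\<close> an embedding of constants it is
  substitution.
\<close>

definition peval :: "('a::comm_ring_1 \<Rightarrow> 'b::comm_ring_1) \<Rightarrow> (nat \<Rightarrow> 'b) \<Rightarrow> ((nat \<Rightarrow>\<^sub>0 nat) \<Rightarrow>\<^sub>0 'a) \<Rightarrow> 'b" where
  "peval c v p = (\<Sum>m\<in>keys p. c (lookup p m) * monomial_eval v m)"

lemma monomial_eval_superset:
  "finite S \<Longrightarrow> keys m \<subseteq> S \<Longrightarrow> monomial_eval v m = (\<Prod>i\<in>S. v i ^ lookup m i)"
  unfolding monomial_eval_def by (rule prod.mono_neutral_left) (auto simp: in_keys_iff)

lemma monomial_eval_add: "monomial_eval v (m + m') = monomial_eval v m * monomial_eval v m'"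
proof -
  let ?S = "keys m \<union> keys m'"
  have "keys (m + m') \<subseteq> ?S" by (rule Poly_Mapping.keys_add)
  then show ?thesis
    by (simp add: monomial_eval_superset[of ?S] lookup_add power_add prod.distrib)
qed

lemma monomial_eval_zero [simp]: "monomial_eval v 0 = 1"
  by (simp add: monomial_eval_def)

lemma monomial_eval_single [simp]: "monomial_eval v (single i k) = v i ^ k"
  by (simp add: monomial_eval_def)

context unital_hom
begin

lemma peval_superset:
  "finite S \<Longrightarrow> keys p \<subseteq> S
    \<Longrightarrow> peval h v p = (\<Sum>m\<in>S. h (lookup p m) * monomial_eval v m)"
  unfolding peval_def by (rule sum.mono_neutral_left) (auto simp: in_keys_iff)

lemma peval_single: "peval h v (single m a) = h a * monomial_eval v m"
  by (simp add: peval_def)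

lemma peval_add: "peval h v (p + q) = peval h v p + peval h v q"
proof -
  let ?S = "keys p \<union> keys q"
  have "keys (p + q) \<subseteq> ?S" by (rule Poly_Mapping.keys_add)
  then show ?thesis
    by (simp add: peval_superset[of ?S] lookup_add algebra_simps sum.distrib)
qed

lemma peval_mult_single:
  "peval h v (single m a * q) = h a * monomial_eval v m * peval h v q"
proof (induction q rule: term_induct)
  case (add k q)
  then show ?case
    by (simp add: distrib_left peval_add mult_single peval_single monomial_eval_add)
qed (simp add: peval_def)

lemma peval_mult: "peval h v (p * q) = peval h v p * peval h v q"
proof (induction p rule: term_induct)
  case (add k q)
  then show ?case
    by (simp add: distrib_right peval_add peval_mult_single peval_single)
qed (simp add: peval_def)

lemma unital_hom_peval: "unital_hom (peval h v)"
  by standard (simp_all add: peval_add peval_mult peval_single flip: single_one)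

end

lemma peval_pconst [simp]: "unital_hom h \<Longrightarrow> peval h v (pconst a) = h a"
  by (simp add: pconst_def unital_hom.peval_single)

lemma peval_pvar [simp]: "unital_hom h \<Longrightarrow> peval h v (pvar i) = v i"
  by (simp add: pvar_def unital_hom.peval_single unital_hom.hom_one)

lemma unital_hom_pconst: "unital_hom (pconst :: 'a::idom \<Rightarrow> 'a hpoly)"
  by standard (simp_all add: pconst_def single_add mult_single)

lemma pconst_eq_0_iff [simp]: "pconst a = 0 \<longleftrightarrow> a = 0"
  by (metis pconst_def lookup_single_eq lookup_zero single_zero)

lemma unital_hom_comp: "unital_hom f \<Longrightarrow> unital_hom g \<Longrightarrow> unital_hom (\<lambda>x. f (g x))"
  by (simp add: unital_hom_def)

definition poly_over :: "nat set \<Rightarrow> 'k::idom hpoly set" where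
  "poly_over I = {p. \<forall>m \<in> keys p. keys m \<subseteq> I}"

lemma U_h_poly_over: "U_h n = poly_over {1..n}"
  by (simp add: U_h_def poly_over_def)

text \<open>
  The polynomials in the variables from \<open>I\<close> form the algebra generated by these variables;
  homomorphisms out of it are therefore determined by generators (\<open>hom_eqI\<close> below).
\<close>

lemma poly_over_induct [consumes 1, case_names const var add mult]:
  fixes p :: "'k::idom hpoly"
  assumes p: "p \<in> poly_over I"
    and const: "\<And>a. P (pconst a)" and var: "\<And>i. i \<in> I \<Longrightarrow> P (pvar i)"
    and add: "\<And>p q. P p \<Longrightarrow> P q \<Longrightarrow> P (p + q)" and mult: "\<And>p q. P p \<Longrightarrow> P q \<Longrightarrow> P (p * q)"
  shows "P p"
proof -
  have pow: "P (single (single i k) 1)" if "i \<in> I" for i k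
  proof (induction k)
    case 0
    then show ?case using const[of 1] by (simp add: pconst_def)
  next
    case (Suc k)
    have "single (single i (Suc k)) (1::'k)
        = pvar i * single (single i k) 1"
      by (simp add: pvar_def mult_single flip: single_add)
    then show ?case using mult var Suc that by metis
  qed
  have mon: "P (single m 1)" if "keys m \<subseteq> I" for m
  proof (induction m rule: term_induct)
    case zero
    then show ?case using const[of 1] by (simp add: pconst_def)
  next
    case (add i q)
    have "single (single i (lookup m i) + q) (1::'k)
        = single (single i (lookup m i)) 1 * single q 1"
      by (simp add: mult_single)
    then show ?case using mult pow add that by (metis subsetD)
  qed
  show ?thesis
  proof (induction p rule: term_induct)
    case zero
    then show ?case using const[of 0] by (simp add: pconst_def)
  next
    case (add m q)
    have "single m (lookup p m)
        = pconst (lookup p m) * single m 1"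
      by (simp add: pconst_def mult_single)
    moreover have "keys m \<subseteq> I"
      using p add by (auto simp: poly_over_def)
    ultimately show ?case using assms(4) mon const mult add by metis
  qed
qed

lemma poly_over_UNIV [simp]: "p \<in> poly_over UNIV"
  by (simp add: poly_over_def)

lemma poly_over_pconst: "pconst a \<in> poly_over I"
  by (simp add: poly_over_def pconst_def)

lemma poly_over_pvar: "i \<in> I \<Longrightarrow> pvar i \<in> poly_over I"
  by (simp add: poly_over_def pvar_def)

lemma poly_over_add: "p \<in> poly_over I \<Longrightarrow> q \<in> poly_over I \<Longrightarrow> p + q \<in> poly_over I"
  unfolding poly_over_def using Poly_Mapping.keys_add[of p q] by blast

lemma poly_over_mult: "p \<in> poly_over I \<Longrightarrow> q \<in> poly_over I \<Longrightarrow> p * q \<in> poly_over I"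
  unfolding poly_over_def
  using Poly_Mapping.keys_mult[of p q] Poly_Mapping.keys_add by (fastforce dest!: subsetD)

lemma poly_over_sum: "(\<And>i. i \<in> J \<Longrightarrow> f i \<in> poly_over I) \<Longrightarrow> sum f J \<in> poly_over I"
  by (induction J rule: infinite_finite_induct)
    (use poly_over_pconst[of 0 I] in \<open>auto simp: pconst_def intro: poly_over_add\<close>)

lemma poly_over_prod: "(\<And>i. i \<in> J \<Longrightarrow> f i \<in> poly_over I) \<Longrightarrow> prod f J \<in> poly_over I"
  by (induction J rule: infinite_finite_induct)
    (use poly_over_pconst[of 1 I] in \<open>auto simp: pconst_def intro: poly_over_mult\<close>)

lemma hom_eqI:
  assumes "unital_hom f" "unital_hom g" "p \<in> poly_over I"
    and "\<And>a. f (pconst a) = g (pconst a)" "\<And>i. i \<in> I \<Longrightarrow> f (pvar i) = g (pvar i)"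
  shows "f p = g p"
  using assms(3)
  by (induction rule: poly_over_induct)
    (simp_all add: assms(4,5) unital_hom.hom_add[OF assms(1)] unital_hom.hom_add[OF assms(2)]
       unital_hom.hom_mult[OF assms(1)] unital_hom.hom_mult[OF assms(2)])

definition int_eval :: "(nat \<Rightarrow> int) \<Rightarrow> 'k::idom hpoly \<Rightarrow> 'k" where
  "int_eval \<mu> = peval (\<lambda>a. a) (\<lambda>i. of_int (\<mu> i))"

lemma unital_hom_id: "unital_hom (\<lambda>a. a)"
  by standard simp_all

lemma unital_hom_int_eval: "unital_hom (int_eval \<mu>)"
  unfolding int_eval_def by (intro unital_hom.unital_hom_peval unital_hom_id)

lemma int_eval_pconst [simp]: "int_eval \<mu> (pconst a) = a"
  by (simp add: int_eval_def unital_hom_id)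

lemma int_eval_pvar [simp]: "int_eval \<mu> (pvar i) = of_int (\<mu> i)"
  by (simp add: int_eval_def unital_hom_id)

lemma unital_hom_pCons: "unital_hom h \<Longrightarrow> unital_hom (\<lambda>a. [:h a:])"
  by (simp add: unital_hom_def one_pCons)

lemma unital_hom_poly: "unital_hom (\<lambda>p. poly p x)"
  by standard simp_all

text \<open>
  Integer points are Zariski dense in characteristic zero. One variable \<open>j\<close> is split off, a nonzero
  coefficient of the resulting univariate polynomial stays nonzero at some integer point by
  induction, and a nonzero univariate polynomial has only finitely many roots among the integers.
\<close>

lemma exists_int_eval_nonzero_aux:
  fixes p :: "'k::{idom, ring_char_0} hpoly"
  assumes "finite I" "p \<in> poly_over I" "p \<noteq> 0"
  shows "\<exists>\<mu>. int_eval \<mu> p \<noteq> 0"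
  using assms
proof (induction I arbitrary: p)
  case empty
  have "\<exists>a. p = pconst a"
    using empty(1)
    by (induction rule: poly_over_induct)
      (auto simp flip: unital_hom.hom_add[OF unital_hom_pconst] unital_hom.hom_mult[OF unital_hom_pconst])
  then show ?case using empty(2) unital_hom.hom_zero[OF unital_hom_pconst] by force
next
  case (insert j I)
  \<comment> \<open>\<open>\<Psi>\<close> regards a polynomial as univariate in the \<open>j\<close>-th variable; \<open>\<Phi>\<close> below moreover evaluates the coefficients at \<open>\<mu>\<close>.\<close>
  define \<Psi> where "\<Psi> = peval (\<lambda>a. [:pconst a:]) (\<lambda>i. if i = j then [:0, 1:] else [:pvar i :: 'k hpoly:])"
  have \<Psi>: "unital_hom \<Psi>"
    unfolding \<Psi>_def by (intro unital_hom.unital_hom_peval unital_hom_pCons unital_hom_pconst)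
  interpret \<Psi>: unital_hom \<Psi> by (rule \<Psi>)
  have \<Psi>_pconst: "\<Psi> (pconst a) = [:pconst a:]" for a
    unfolding \<Psi>_def by (simp add: unital_hom_pCons unital_hom_pconst)
  have \<Psi>_pvar: "\<Psi> (pvar i) = (if i = j then [:0, 1:] else [:pvar i:])" for i
    unfolding \<Psi>_def by (simp add: unital_hom_pCons unital_hom_pconst)
  have "poly (\<Psi> p) (pvar j) = p"
    by (rule hom_eqI[of "\<lambda>p. poly (\<Psi> p) (pvar j)" "\<lambda>p. p" _ UNIV])
      (simp_all add: unital_hom_comp[OF unital_hom_poly \<Psi>] unital_hom_id \<Psi>_pconst \<Psi>_pvar)
  then have "\<Psi> p \<noteq> 0" using insert.prems by auto
  then obtain d where d: "coeff (\<Psi> p) d \<noteq> 0"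
    using leading_coeff_neq_0 by blast
  have "coeff (\<Psi> p) d \<in> poly_over I" for d
    using insert.prems(1)
  proof (induction arbitrary: d rule: poly_over_induct)
    case (const a)
    then show ?case using poly_over_pconst[of 0 I]
      by (auto simp: \<Psi>_pconst coeff_pCons poly_over_pconst unital_hom.hom_zero[OF unital_hom_pconst] split: nat.splits)
  next
    case (var i)
    then show ?case using poly_over_pconst[of 0 I] poly_over_pconst[of 1 I]
      by (auto simp: \<Psi>_pvar coeff_pCons poly_over_pvar unital_hom.hom_zero[OF unital_hom_pconst]
          unital_hom.hom_one[OF unital_hom_pconst] split: nat.splits)
  qed (auto simp: coeff_mult intro!: poly_over_add poly_over_sum poly_over_mult)
  with insert.IH d obtain \<mu> where \<mu>: "int_eval \<mu> (coeff (\<Psi> p) d) \<noteq> 0" by blast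
  interpret \<mu>: unital_hom "int_eval \<mu> :: 'k hpoly \<Rightarrow> 'k" by (rule unital_hom_int_eval)
  define \<Phi> where "\<Phi> = peval (\<lambda>a. [:a:]) (\<lambda>i. if i = j then [:0, 1:] else [:of_int (\<mu> i) :: 'k:])"
  have \<Phi>: "unital_hom \<Phi>"
    unfolding \<Phi>_def by (intro unital_hom.unital_hom_peval unital_hom_pCons unital_hom_id)
  interpret \<Phi>: unital_hom \<Phi> by (rule \<Phi>)
  have \<Phi>_pconst: "\<Phi> (pconst a) = [:a:]" for a
    unfolding \<Phi>_def by (simp add: unital_hom_pCons unital_hom_id)
  have \<Phi>_pvar: "\<Phi> (pvar i) = (if i = j then [:0, 1:] else [:of_int (\<mu> i):])" for i
    unfolding \<Phi>_def by (simp add: unital_hom_pCons unital_hom_id)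
  have "coeff (\<Phi> p) e = int_eval \<mu> (coeff (\<Psi> p) e)" for e
    using insert.prems(1)
    by (induction arbitrary: e rule: poly_over_induct)
      (auto simp: \<Phi>_pconst \<Psi>_pconst \<Phi>_pvar \<Psi>_pvar coeff_pCons coeff_mult split: nat.splits)
  with \<mu> have "\<Phi> p \<noteq> 0" by (metis coeff_0)
  then have "finite {x. poly (\<Phi> p) x = 0}" by (rule poly_roots_finite)
  moreover have "infinite (range (of_int :: int \<Rightarrow> 'k))"
  proof -
    have "inj (of_int :: int \<Rightarrow> 'k)" by (simp add: inj_on_def)
    then show ?thesis using finite_imageD infinite_UNIV_int by blast
  qed
  ultimately obtain t :: int where t: "poly (\<Phi> p) (of_int t) \<noteq> 0"
    by (metis (mono_tags, lifting) finite_subset image_subsetI mem_Collect_eq)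
  have "int_eval (\<mu>(j := t)) p = poly (\<Phi> p) (of_int t)"
    by (rule hom_eqI[of "int_eval (\<mu>(j := t))" "\<lambda>p. poly (\<Phi> p) (of_int t)" _ UNIV])
      (simp_all add: unital_hom_comp[OF unital_hom_poly \<Phi>] unital_hom_int_eval \<Phi>_pconst \<Phi>_pvar)
  with t show ?case by metis
qed

lemma exists_int_eval_nonzero:
  fixes p :: "'k::{idom, ring_char_0} hpoly"
  assumes "p \<noteq> 0"
  shows "\<exists>\<mu>. int_eval \<mu> p \<noteq> 0"
  by (rule exists_int_eval_nonzero_aux[of "\<Union> (keys ` keys p)"])
    (use assms in \<open>auto simp: poly_over_def\<close>)

lemma lead_coeff_monom_diff:
  assumes "(a::'k::idom) = 1 \<or> a = -1" "degree r < i"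
  shows "lead_coeff (monom a i + r) \<in> {1, -1}"
proof -
  have "degree r < degree (monom a i)" using assms by (auto simp: degree_monom_eq)
  then have "lead_coeff (r + monom a i) = lead_coeff (monom a i)" by (rule lead_coeff_add_le)
  then show ?thesis using assms by (auto simp: add.commute degree_monom_eq)
qed

text \<open>
  Sending the \<open>i\<close>-th variable to \<open>t^i\<close> separates the variables by degree, so every factor
  \<open>h\<^sub>i - h\<^sub>j + k\<close> becomes monic up to sign. Over a ground ring that is not a field, this is what
  keeps the denominators primitive.
\<close>

lemma denoms_monic_specialization:
  fixes q :: "'k::idom hpoly"
  assumes "q \<in> denoms n"
  shows "lead_coeff (peval (\<lambda>a. [:a:]) (\<lambda>i. monom 1 i) q) \<in> {1, -1}"
  using assms
proof induction
  case one
  interpret unital_hom "peval (\<lambda>a::'k. [:a:]) (\<lambda>i. monom 1 i)"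
    by (intro unital_hom.unital_hom_peval unital_hom_pCons unital_hom_id)
  show ?case by simp
next
  case (mult q i j k)
  let ?h = "peval (\<lambda>a::'k. [:a:]) (\<lambda>i. monom 1 i)"
  interpret unital_hom ?h
    by (intro unital_hom.unital_hom_peval unital_hom_pCons unital_hom_id)
  have h: "?h (pvar i - pvar j + of_int k) = monom 1 i - monom 1 j + of_int k"
    by (simp add: unital_hom_pCons unital_hom_id)
  have "lead_coeff (monom 1 i - monom 1 j + of_int k :: 'k poly) \<in> {1, -1}"
  proof (cases "j < i")
    case True
    have "degree (- monom 1 j + of_int k :: 'k poly) < i"
      using True by (intro degree_add_less) (auto simp: degree_monom_eq)
    from lead_coeff_monom_diff[OF _ this, of 1] show ?thesis by (simp add: algebra_simps)
  next
    case False
    have "degree (monom 1 i + of_int k :: 'k poly) < j"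
      using False mult by (intro degree_add_less) (auto simp: degree_monom_eq)
    from lead_coeff_monom_diff[OF _ this, of "-1"] show ?thesis
      by (simp add: algebra_simps minus_monom[symmetric] del: minus_monom)
  qed
  moreover have "lead_coeff (?h (q * (pvar i - pvar j + of_int k)))
      = lead_coeff (?h q) * lead_coeff (monom 1 i - monom 1 j + of_int k)"
    by (simp only: hom_mult h lead_coeff_mult)
  moreover have "x * y \<in> {1, -1}" if "x \<in> {1, -1}" "y \<in> {1, -1}" for x y :: 'k
    using that by auto
  ultimately show ?case using mult.IH by metis
qed

abbreviation const :: "'k::idom \<Rightarrow> 'k hfrac" where
  "const a \<equiv> Fraction_Field.Fract (pconst a) 1"

text \<open>
  If a fraction \<open>p / q\<close> with an admissible denominator equals \<open>r / s\<close> with \<open>r\<close>, \<open>s\<close> in the ground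
  ring, then \<open>s\<close> divides \<open>r\<close>: compare the coefficients at the leading degree of the monic specialization of \<open>q\<close>.
\<close>

lemma Fract_const_if_proportional:
  fixes p q :: "'k::idom hpoly"
  assumes q: "q \<in> denoms n" and s: "s \<noteq> 0" and eq: "pconst r * q = pconst s * p"
  shows "\<exists>a. Fraction_Field.Fract p q = const a"
proof -
  let ?h = "peval (\<lambda>a::'k. [:a:]) (\<lambda>i. monom 1 i)"
  interpret unital_hom ?h
    by (intro unital_hom.unital_hom_peval unital_hom_pCons unital_hom_id)
  define d where "d = degree (?h q)"
  have "?h (pconst r * q) = ?h (pconst s * p)" using eq by simp
  then have "smult r (?h q) = smult s (?h p)"
    by (simp add: unital_hom_pCons unital_hom_id)
  then have lc: "r * lead_coeff (?h q) = s * coeff (?h p) d"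
    unfolding d_def by (metis coeff_smult)
  \<comment> \<open>The leading coefficient of the specialized denominator is \<open>\<plusminus>1\<close>, hence can be divided out.\<close>
  have "\<exists>a. r = s * a"
  proof -
    consider "lead_coeff (?h q) = 1" | "lead_coeff (?h q) = -1"
      using denoms_monic_specialization[OF q] by blast
    then show ?thesis
    proof cases
      case 1
      then show ?thesis using lc by (intro exI[of _ "coeff (?h p) d"]) simp
    next
      case 2
      then show ?thesis using lc by (intro exI[of _ "- coeff (?h p) d"]) (simp, metis minus_minus)
    qed
  qed
  then obtain a where a: "r = s * a" ..
  have "pconst s * (pconst a * q) = pconst s * p"
    using eq by (simp add: a unital_hom.hom_mult[OF unital_hom_pconst] mult.assoc)
  moreover have "pconst s \<noteq> 0" using s by simp
  ultimately have "p = pconst a * q" by simp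
  then show ?thesis using denoms_nonzero[OF q] by (intro exI[of _ a]) (simp add: eq_fract)
qed

text \<open>
  The automorphism of the polynomial ring that replaces \<open>h\<^sub>i\<close> by \<open>h\<^sub>i + l\<^sub>i\<close>; \<open>fshift\<close> below is its
  extension to fractions.
\<close>

definition pshift :: "(nat \<Rightarrow> int) \<Rightarrow> 'k::idom hpoly \<Rightarrow> 'k hpoly" where
  "pshift l = peval pconst (\<lambda>i. pvar i + of_int (l i))"

lemma unital_hom_pshift: "unital_hom (pshift l)"
  unfolding pshift_def by (intro unital_hom.unital_hom_peval unital_hom_pconst)

interpretation pshift: unital_hom "pshift l :: 'k::idom hpoly \<Rightarrow> 'k hpoly"
  by (rule unital_hom_pshift)

lemma pshift_pconst [simp]: "pshift l (pconst a) = pconst a"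
  by (simp add: pshift_def unital_hom_pconst)

lemma pshift_pvar [simp]: "pshift l (pvar i) = pvar i + of_int (l i)"
  by (simp add: pshift_def unital_hom_pconst)

lemma pshift_pshift: "pshift l (pshift l' p) = pshift (\<lambda>i. l i + l' i) p"
  by (rule hom_eqI[of "\<lambda>p. pshift l (pshift l' p)" _ _ UNIV])
    (simp_all add: unital_hom_comp[OF unital_hom_pshift unital_hom_pshift] unital_hom_pshift)

lemma pshift_0: "pshift (\<lambda>_. 0) p = p"
  by (rule hom_eqI[of _ "\<lambda>p. p" _ UNIV]) (simp_all add: unital_hom_pshift unital_hom_id)

lemma pshift_eq_0_iff [simp]: "pshift l p = 0 \<longleftrightarrow> p = 0"
  using pshift_pshift[of "\<lambda>i. - l i" l p] by (auto simp: pshift_0)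

lemma pshift_U_h: "p \<in> U_h n \<Longrightarrow> pshift l p \<in> U_h n"
  unfolding U_h_poly_over
  by (induction rule: poly_over_induct)
    (auto intro: poly_over_pconst poly_over_add poly_over_mult poly_over_pvar
       U_h_of_int[unfolded U_h_poly_over] simp del: One_nat_def atLeastAtMost_iff)

lemma pshift_denoms: "q \<in> denoms n \<Longrightarrow> pshift l q \<in> denoms n"
proof (induction rule: denoms.induct)
  case (mult q i j k)
  have "pshift l (q * (pvar i - pvar j + of_int k))
      = pshift l q * (pvar i - pvar j + of_int (k + l i - l j))"
    by (simp add: algebra_simps)
  then show ?case using mult by (metis denoms.mult)
qed (simp add: denoms.one)

lift_definition fshift :: "(nat \<Rightarrow> int) \<Rightarrow> 'k::idom hfrac \<Rightarrow> 'k hfrac"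
  is "\<lambda>l x. (pshift l (fst x), pshift l (snd x))"
  by (auto simp flip: pshift.hom_mult)

lemma fshift_Fract: "fshift l (Fraction_Field.Fract p q) = Fraction_Field.Fract (pshift l p) (pshift l q)"
  by transfer auto

interpretation fshift: unital_hom "fshift l :: 'k::idom hfrac \<Rightarrow> 'k hfrac"
proof
  show "fshift l 1 = 1" for l :: "nat \<Rightarrow> int"
    by (simp add: One_fract_def fshift_Fract)
  fix l :: "nat \<Rightarrow> int" and a b :: "'k hfrac"
  show "fshift l (a + b) = fshift l a + fshift l b" "fshift l (a * b) = fshift l a * fshift l b"
    by (cases a; cases b; simp add: fshift_Fract)+
qed

lemma fshift_inverse [simp]: "fshift l (inverse u) = inverse (fshift l u)"
  by (cases u) (simp add: fshift_Fract)

lemma fshift_divide [simp]: "fshift l (u / v) = fshift l u / fshift l v"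
  by (simp add: divide_inverse)

lemma fshift_eq_0_iff [simp]: "fshift l u = 0 \<longleftrightarrow> u = 0"
  by (cases u) (simp add: fshift_Fract Zero_fract_def eq_fract)

lemma fshift_fshift: "fshift l (fshift l' u) = fshift (\<lambda>i. l i + l' i) u"
  by (cases u) (simp add: fshift_Fract pshift_pshift)

lemma fshift_0: "fshift (\<lambda>_. 0) u = u"
  by (cases u) (simp add: fshift_Fract pshift_0)

lemma fshift_const [simp]: "fshift l (const a) = const a"
  by (simp add: fshift_Fract)

lemma unital_hom_Fract: "unital_hom (\<lambda>p::'k::idom hpoly. Fraction_Field.Fract p 1)"
  by standard (simp_all add: One_fract_def)

lemma unital_hom_const: "unital_hom (const :: 'k::idom \<Rightarrow> 'k hfrac)"
  by (rule unital_hom_comp[OF unital_hom_Fract unital_hom_pconst])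

lemma fshift_hh [simp]: "fshift l (hh i) = hh i + of_int (l i)"
  by (simp add: hh_def fshift_Fract unital_hom.hom_add[OF unital_hom_Fract]
      unital_hom.hom_of_int[OF unital_hom_Fract] del: add_fract)

lemma fshift_Ubar: "u \<in> Ubar_h n \<Longrightarrow> fshift l u \<in> Ubar_h n"
  by (elim Ubar_cases) (simp add: fshift_Fract Ubar_fract pshift_U_h pshift_denoms)

lemma int_eval_pshift: "int_eval \<mu> (pshift l p) = int_eval (\<lambda>i. \<mu> i + l i) p"
proof -
  interpret unital_hom "int_eval \<mu> :: 'a hpoly \<Rightarrow> 'a" by (rule unital_hom_int_eval)
  show ?thesis
  by (rule hom_eqI[of "\<lambda>p. int_eval \<mu> (pshift l p)" _ _ UNIV])
    (simp_all add: unital_hom_comp[OF unital_hom_int_eval unital_hom_pshift] unital_hom_int_eval)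
qed

lemma int_eval_cong:
  assumes "p \<in> U_h n" "\<And>i. i \<in> {1..n} \<Longrightarrow> \<mu> i = \<nu> i"
  shows "int_eval \<mu> p = int_eval \<nu> p"
  using assms(1) unfolding U_h_poly_over
  by (rule hom_eqI[OF unital_hom_int_eval unital_hom_int_eval]) (simp_all add: assms(2))

text \<open>
  Let \<open>u = p / q\<close> and let \<open>b\<close> be an integer point with \<open>q(b) \<noteq> 0\<close>. Invariance under the shift
  by \<open>b - \<mu>\<close> gives \<open>p(b) q(\<mu>) = p(\<mu>) q(b)\<close> for every integer point \<open>\<mu>\<close>, hence
  \<open>p(b) q = q(b) p\<close>, since integer points are dense. So \<open>u\<close> is constant as an element of the
  field of fractions, and then it lies in the ground ring by \<open>Fract_const_if_proportional\<close>.
\<close>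

lemma shift_invariant_const:
  fixes u :: "'k::{idom, ring_char_0} hfrac"
  assumes u: "u \<in> Ubar_h n"
    and inv: "\<And>l. (\<And>i. i \<notin> {1..n} \<Longrightarrow> l i = 0) \<Longrightarrow> fshift l u = u"
  shows "\<exists>a. u = const a"
proof -
  obtain p q where pq: "u = Fraction_Field.Fract p q" "p \<in> U_h n" "q \<in> denoms n" "q \<noteq> 0"
    using u by (rule Ubar_cases)
  have qU: "q \<in> U_h n" using pq(3) by (rule denoms_U_h)
  obtain b where b: "int_eval b q \<noteq> 0"
    using exists_int_eval_nonzero[OF pq(4)] by blast
  have pt: "int_eval b p * int_eval \<mu> q = int_eval \<mu> p * int_eval b q" for \<mu>
  proof -
    \<comment> \<open>For polynomials in the variables \<open>1..n\<close>, shifting by \<open>l\<close> and evaluating at \<open>\<mu>\<close> is evaluating at \<open>b\<close>.\<close>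
    define l where "l = (\<lambda>i. if i \<in> {1..n} then b i - \<mu> i else 0)"
    have "fshift l u = u" by (rule inv) (auto simp: l_def)
    then have "pshift l p * q = p * pshift l q"
      using pq by (simp add: fshift_Fract eq_fract)
    then have "int_eval \<mu> (pshift l p * q) = int_eval \<mu> (p * pshift l q)" by simp
    moreover have "int_eval \<mu> (pshift l r) = int_eval b r" if "r \<in> U_h n" for r :: "'k hpoly"
      unfolding int_eval_pshift using that by (rule int_eval_cong) (simp add: l_def)
    ultimately show ?thesis
      by (simp add: unital_hom.hom_mult[OF unital_hom_int_eval] pq qU)
  qed
  have "pconst (int_eval b p) * q - pconst (int_eval b q) * p = 0"
    by (rule ccontr, drule exists_int_eval_nonzero)
      (simp add: unital_hom.hom_diff[OF unital_hom_int_eval] unital_hom.hom_mult[OF unital_hom_int_eval] pt)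
  then show ?thesis
    using Fract_const_if_proportional[OF pq(3) b, of "int_eval b p" p] pq(1) by simp
qed

section \<open>Elementary symmetric functions and Lagrange interpolation\<close>

text \<open>
  The elementary symmetric function of the family \<open>a\<close> restricted to \<open>S\<close>, as a function of the
  degree \<open>k\<close>. The index set varies because the derivative of \<open>e\<^sub>k\<close> in the direction \<open>j\<close> omits the
  index \<open>j\<close>.
\<close>

definition esymf :: "(nat \<Rightarrow> 'a::comm_ring_1) \<Rightarrow> nat set \<Rightarrow> nat \<Rightarrow> 'a" where
  "esymf a S k = (\<Sum>T | T \<subseteq> S \<and> card T = k. \<Prod>i\<in>T. a i)"

lemma esym_esymf: "esym n k = esymf pvar {1..n} k"
  by (simp add: esym_def esymf_def)

lemma hom_esymf: "unital_hom h \<Longrightarrow> h (esymf a S k) = esymf (\<lambda>i. h (a i)) S k"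
  by (simp add: esymf_def unital_hom.hom_sum unital_hom.hom_prod)

lemma esymf_cong: "(\<And>i. i \<in> S \<Longrightarrow> a i = b i) \<Longrightarrow> esymf a S k = esymf b S k"
  unfolding esymf_def by (intro sum.cong prod.cong) auto

lemma esymf_0: "finite S \<Longrightarrow> esymf a S 0 = 1"
proof -
  assume "finite S"
  then have "{T. T \<subseteq> S \<and> card T = 0} = {{}}" by (auto dest: finite_subset)
  then show ?thesis by (simp add: esymf_def)
qed

lemma esymf_insert:
  assumes "finite S" "j \<notin> S"
  shows "esymf a (insert j S) (Suc k) = esymf a S (Suc k) + a j * esymf a S k"
proof -
  let ?A = "{T. T \<subseteq> S \<and> card T = Suc k}" and ?B = "{T. T \<subseteq> S \<and> card T = k}"
  have fin: "T \<in> ?A \<union> ?B \<Longrightarrow> finite T" for T using assms(1) by (auto dest: finite_subset)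
  have "{T. T \<subseteq> insert j S \<and> card T = Suc k} = ?A \<union> insert j ` ?B" (is "?L = ?R")
  proof
    show "?L \<subseteq> ?R"
    proof
      fix T assume T: "T \<in> ?L"
      show "T \<in> ?R"
      proof (cases "j \<in> T")
        case True
        then have "T - {j} \<in> ?B" "T = insert j (T - {j})" using T assms(1) by auto
        then show ?thesis by blast
      qed (use T in auto)
    qed
    show "?R \<subseteq> ?L"
    proof (rule Un_least)
      show "insert j ` ?B \<subseteq> ?L"
      proof (rule image_subsetI)
        fix U assume "U \<in> ?B"
        then have "finite U" "j \<notin> U" "U \<subseteq> S" "card U = k"
          using assms finite_subset[OF _ assms(1), of U] by blast+
        then show "insert j U \<in> ?L" by (simp add: subset_insertI2)
      qed
    qed blast
  qed
  then have "esymf a (insert j S) (Suc k) = (\<Sum>T\<in>?A \<union> insert j ` ?B. prod a T)"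
    by (simp only: esymf_def)
  also have "\<dots> = (\<Sum>T\<in>?A. prod a T) + (\<Sum>T\<in>insert j ` ?B. prod a T)"
    by (rule sum.union_disjoint) (use assms in auto)
  also have "(\<Sum>T\<in>insert j ` ?B. prod a T) = (\<Sum>T\<in>?B. prod a (insert j T))"
  proof (rule sum.reindex_cong[OF _ refl refl])
    show "inj_on (insert j) ?B"
      using assms(2) by (intro inj_onI) (metis (mono_tags, lifting) insert_ident mem_Collect_eq subsetD)
  qed
  also have "\<dots> = (\<Sum>T\<in>?B. a j * prod a T)"
  proof (rule sum.cong[OF refl])
    fix T assume "T \<in> ?B"
    then have "finite T" "j \<notin> T" using fin[of T] assms(2) by blast+
    then show "prod a (insert j T) = a j * prod a T" by simp
  qed
  finally show ?thesis by (simp only: esymf_def sum_distrib_left)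
qed

text \<open>
  Vieta's formula. The two variants below separate the leading power of \<open>s\<close> and omit one factor;
  both use the same powers \<open>s ^ (n - k)\<close>, so that they can be compared coefficientwise.
\<close>

lemma prod_add_esymf:
  assumes "finite S"
  shows "(\<Prod>i\<in>S. s + a i) = (\<Sum>k\<le>card S. esymf a S k * s ^ (card S - k))"
proof -
  have "(\<Prod>i\<in>S. a i + s) = (\<Sum>T\<in>Pow S. (\<Prod>i\<in>T. a i) * s ^ (card S - card T))"
    using assms by (subst prod_add) (auto intro!: sum.cong simp: card_Diff_subset finite_subset)
  also have "\<dots> = (\<Sum>k\<le>card S. \<Sum>T | T \<in> Pow S \<and> card T = k. (\<Prod>i\<in>T. a i) * s ^ (card S - card T))"
    using assms by (intro sum.group[symmetric]) (auto intro: card_mono)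
  also have "\<dots> = (\<Sum>k\<le>card S. esymf a S k * s ^ (card S - k))"
    by (auto simp: esymf_def sum_distrib_right intro!: sum.cong)
  finally show ?thesis by (simp add: add.commute)
qed

lemma prod_add_esymf_monic:
  assumes "finite S" "card S = n"
  shows "(\<Prod>i\<in>S. s + a i) = s ^ n + (\<Sum>k=1..n. esymf a S k * s ^ (n - k))"
proof -
  have "{..n} = insert 0 {1..n}" by auto
  then show ?thesis using assms by (simp add: prod_add_esymf esymf_0)
qed

lemma prod_add_esymf_remove:
  assumes "finite S" "card S = n" "j \<in> S"
  shows "(\<Prod>i\<in>S - {j}. s + a i) = (\<Sum>k=1..n. esymf a (S - {j}) (k - 1) * s ^ (n - k))"
proof -
  have "n \<ge> 1" using assms by (auto simp: Suc_le_eq card_gt_0_iff)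
  then have "{1..n} = Suc ` {..n - 1}"
    by (auto simp: image_iff Bex_def) presburger
  then show ?thesis using assms \<open>n \<ge> 1\<close>
    by (simp add: prod_add_esymf sum.reindex)
qed

lemma pderivative_superset:
  "finite S \<Longrightarrow> keys p \<subseteq> S \<Longrightarrow> pderivative j p =
    (\<Sum>m\<in>S. single (m - single j 1)
       (of_nat (lookup m j) * lookup p m))"
  unfolding pderivative_def by (rule sum.mono_neutral_left) (auto simp: in_keys_iff)

lemma pderivative_add: "pderivative j (p + q) = pderivative j p + pderivative j q"
proof -
  let ?S = "keys p \<union> keys q"
  have "keys (p + q) \<subseteq> ?S" by (rule Poly_Mapping.keys_add)
  then show ?thesis
    by (simp add: pderivative_superset[of ?S] lookup_add distrib_left single_add sum.distrib)
qed

lemma pderivative_single: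
  "pderivative j (single m a)
    = single (m - single j 1) (of_nat (lookup m j) * a)"
  by (simp add: pderivative_def)

lemma pderivative_free:
  assumes "p \<in> poly_over (- {j})"
  shows "pderivative j p = 0"
proof -
  have "lookup m j = 0" if "m \<in> keys p" for m
    using assms that unfolding poly_over_def by (auto simp: in_keys_iff)
  then show ?thesis by (simp add: pderivative_def)
qed

lemma pderivative_pvar_mult:
  assumes "p \<in> poly_over (- {j})"
  shows "pderivative j (pvar j * p) = p"
proof (induction p rule: term_induct)
  case zero
  then show ?case by (simp add: pderivative_def)
next
  case (add m q)
  have "lookup m j = 0"
    using assms add unfolding poly_over_def by (auto simp: in_keys_iff)
  then show ?case using add
    by (simp add: distrib_left pderivative_add pvar_def mult_single pderivative_single lookup_add)
qed

lemma poly_over_esymf: "S \<subseteq> I \<Longrightarrow> esymf pvar S k \<in> poly_over I"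
  unfolding esymf_def by (intro poly_over_sum poly_over_prod poly_over_pvar) auto

lemma pderivative_esym:
  assumes "k \<in> {1..n}" "j \<in> {1..n}"
  shows "pderivative j (esym n k) = (esymf pvar ({1..n} - {j}) (k - 1) :: 'k::idom hpoly)"
proof -
  let ?S = "{1..n} - {j}"
  have S: "{1..n} = insert j ?S" using assms by auto
  obtain l where k: "k = Suc l" using assms by (cases k) auto
  have free: "esymf pvar ?S i \<in> (poly_over (- {j}) :: 'k hpoly set)" for i
    by (rule poly_over_esymf) auto
  have "esym n k = (esymf pvar ?S k + pvar j * esymf pvar ?S l :: 'k hpoly)"
    unfolding esym_esymf k by (subst S, rule esymf_insert) auto
  then show ?thesis
    using free by (simp add: pderivative_add pderivative_free pderivative_pvar_mult k)
qed

text \<open>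
  The value at \<open>s\<close> of the polynomial \<open>\<chi>\<close> with leading term \<open>- s ^ n\<close> and lower coefficients \<open>c\<close>.
\<close>

definition monic_value :: "nat \<Rightarrow> (nat \<Rightarrow> 'a) \<Rightarrow> 'a \<Rightarrow> 'a::comm_ring_1" where
  "monic_value n c s = (\<Sum>k=1..n. c k * s ^ (n - k)) - s ^ n"

lemma sum_prod_add_remove:
  fixes A G :: "nat \<Rightarrow> 'a::comm_ring_1"
  assumes N: "finite N" "card N = n"
  shows "(\<Sum>j\<in>N. (\<Prod>i\<in>N - {j}. s + A i) * G j)
      = (\<Sum>k=1..n. (\<Sum>j\<in>N. esymf A (N - {j}) (k - 1) * G j) * s ^ (n - k))"
proof -
  have "(\<Sum>j\<in>N. (\<Prod>i\<in>N - {j}. s + A i) * G j)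
      = (\<Sum>j\<in>N. \<Sum>k=1..n. esymf A (N - {j}) (k - 1) * s ^ (n - k) * G j)"
    using N by (intro sum.cong) (simp_all add: prod_add_esymf_remove sum_distrib_right)
  also have "\<dots> = (\<Sum>k=1..n. \<Sum>j\<in>N. esymf A (N - {j}) (k - 1) * s ^ (n - k) * G j)"
    by (rule sum.swap)
  also have "\<dots> = (\<Sum>k=1..n. (\<Sum>j\<in>N. esymf A (N - {j}) (k - 1) * G j) * s ^ (n - k))"
    by (intro sum.cong refl) (simp add: sum_distrib_right sum_distrib_left mult_ac)
  finally show ?thesis .
qed

text \<open>
  If \<open>G j\<close> is the residue \<open>\<chi>(- A j) / \<Prod>(A i - A j)\<close>, written without division, then the
  polynomials \<open>\<chi>(s)\<close> and \<open>(\<Sum>j. (\<Prod>i\<noteq>j. s + A i) G j) - (\<Prod>i. s + A i)\<close> have the same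
  leading term and agree at the \<open>n\<close> points \<open>- A j\<close>, so they are equal. The statement compares
  their coefficients; the next lemma compares their values.
\<close>

lemma lagrange_coefficients:
  fixes A G c :: "nat \<Rightarrow> 'a::idom"
  assumes N: "finite N" "card N = n" and inj: "inj_on A N"
    and G: "\<And>j. j \<in> N \<Longrightarrow> G j * (\<Prod>i\<in>N - {j}. A i - A j) = monic_value n c (- A j)"
    and k: "k \<in> {1..n}"
  shows "(\<Sum>j\<in>N. esymf A (N - {j}) (k - 1) * G j) - esymf A N k = c k"
proof -
  \<comment> \<open>The difference of the two polynomials; its degree is less than \<open>n\<close>, as the leading terms cancel.\<close>
  define p where "p = (\<Sum>k=1..n. monom ((\<Sum>j\<in>N. esymf A (N - {j}) (k - 1) * G j) - esymf A N k - c k) (n - k))"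
  have ev: "poly p s = (\<Sum>j\<in>N. (\<Prod>i\<in>N - {j}. s + A i) * G j) - (\<Prod>i\<in>N. s + A i) - monic_value n c s" for s
  proof -
    have "(\<Sum>j\<in>N. (\<Prod>i\<in>N - {j}. s + A i) * G j)
        = (\<Sum>k=1..n. (\<Sum>j\<in>N. esymf A (N - {j}) (k - 1) * G j) * s ^ (n - k))"
      using N by (rule sum_prod_add_remove)
    then show ?thesis
      unfolding p_def prod_add_esymf_monic[OF N] monic_value_def
      by (simp add: poly_sum poly_monom left_diff_distrib sum_subtractf)
  qed
  have root: "poly p (- A j) = 0" if j: "j \<in> N" for j
  proof -
    have "(\<Prod>i\<in>N - {l}. - A j + A i) * G l = 0" if l: "l \<in> N" "l \<noteq> j" for l
      using j l N(1) by auto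
    then have "(\<Sum>l\<in>N. (\<Prod>i\<in>N - {l}. - A j + A i) * G l) = (\<Prod>i\<in>N - {j}. - A j + A i) * G j"
      using N(1) j by (subst sum.remove[of N j]) (simp_all del: prod_zero_iff mult_eq_0_iff add: sum.neutral)
    moreover have "(\<Prod>i\<in>N. - A j + A i) = 0" using j N(1) by auto
    ultimately show ?thesis using G[OF j] by (simp add: ev algebra_simps)
  qed
  have "p = 0"
  proof (rule ccontr)
    assume "p \<noteq> 0"
    have "n \<ge> 1" using k by simp
    have "degree p < n"
      unfolding p_def
      by (rule degree_sum_less) (use \<open>n \<ge> 1\<close> in \<open>auto intro!: le_less_trans[OF degree_monom_le]\<close>)
    moreover have "card ((\<lambda>j. - A j) ` N) \<le> card {x. poly p x = 0}"
      by (rule card_mono) (use root \<open>p \<noteq> 0\<close> poly_roots_finite in auto)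
    moreover have "card ((\<lambda>j. - A j) ` N) = n"
      using inj N(2) by (subst card_image) (auto simp: inj_on_def)
    moreover have "card {x. poly p x = 0} \<le> degree p" using \<open>p \<noteq> 0\<close> by (rule card_poly_roots_bound)
    ultimately show False by simp
  qed
  then have "coeff p (n - k) = 0" by simp
  moreover have "coeff p (n - k) = (\<Sum>j\<in>N. esymf A (N - {j}) (k - 1) * G j) - esymf A N k - c k"
  proof -
    define f where "f l = (\<Sum>j\<in>N. esymf A (N - {j}) (l - 1) * G j) - esymf A N l - c l" for l
    have "coeff p (n - k) = (\<Sum>l\<in>{1..n}. if l = k then f l else 0)"
      unfolding p_def coeff_sum f_def using k by (intro sum.cong refl) auto
    then show ?thesis using k by (simp add: f_def)
  qed
  ultimately show ?thesis by simp
qed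

lemma lagrange_interpolation:
  fixes A G c :: "nat \<Rightarrow> 'a::idom"
  assumes N: "finite N" "card N = n" and inj: "inj_on A N"
    and G: "\<And>j. j \<in> N \<Longrightarrow> G j * (\<Prod>i\<in>N - {j}. A i - A j) = monic_value n c (- A j)"
  shows "(\<Sum>j\<in>N. (\<Prod>i\<in>N - {j}. s + A i) * G j) - (\<Prod>i\<in>N. s + A i) = monic_value n c s"
proof -
  have "(\<Sum>j\<in>N. (\<Prod>i\<in>N - {j}. s + A i) * G j)
      = (\<Sum>k=1..n. (\<Sum>j\<in>N. esymf A (N - {j}) (k - 1) * G j) * s ^ (n - k))"
    using N by (rule sum_prod_add_remove)
  moreover have "(\<Sum>k=1..n. c k * s ^ (n - k)) =
      (\<Sum>k=1..n. ((\<Sum>j\<in>N. esymf A (N - {j}) (k - 1) * G j) - esymf A N k) * s ^ (n - k))"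
    by (rule sum.cong[OF refl]) (simp only: lagrange_coefficients[OF N inj G])
  ultimately show ?thesis
    unfolding prod_add_esymf_monic[OF N] monic_value_def
    by (simp add: left_diff_distrib sum_subtractf)
qed

section \<open>Consequences of the defining relations\<close>

definition unit_shift :: "nat \<Rightarrow> int \<Rightarrow> nat \<Rightarrow> int" where
  "unit_shift i k = (\<lambda>l. if l = i then k else 0)"

lemma unit_shift_same [simp]: "unit_shift i t i = t"
  by (simp add: unit_shift_def)

lemma unit_shift_other [simp]: "j \<noteq> i \<Longrightarrow> unit_shift i t j = 0"
  by (simp add: unit_shift_def)

lemma fshift_unit_shift_inverse [simp]:
  "fshift (unit_shift i (-1)) (fshift (unit_shift i 1) u) = u" "fshift (unit_shift i 1) (fshift (unit_shift i (-1)) u) = u"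
proof -
  have "(\<lambda>l. unit_shift i (-1) l + unit_shift i 1 l) = (\<lambda>_. 0)" "(\<lambda>l. unit_shift i 1 l + unit_shift i (-1) l) = (\<lambda>_. 0)"
    by (auto simp: unit_shift_def)
  then show "fshift (unit_shift i (-1)) (fshift (unit_shift i 1) u) = u" "fshift (unit_shift i 1) (fshift (unit_shift i (-1)) u) = u"
    unfolding fshift_fshift by (simp_all add: fshift_0)
qed

lemma hdiff_shift_nonzero: "i \<noteq> j \<Longrightarrow> hdiff i j + of_int k \<noteq> (0::'k::idom hfrac)"
  by (simp add: hdiff_shift Zero_fract_def eq_fract pvar_diff_nonzero)

lemma hdiff_nonzero [simp]:
  assumes "i \<noteq> j"
  shows "hdiff i j \<noteq> (0::'k::idom hfrac)" "hdiff i j + 1 \<noteq> (0::'k hfrac)" "hdiff i j - 1 \<noteq> (0::'k hfrac)"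
    "hdiff i j - 2 \<noteq> (0::'k hfrac)" "hdiff i j + 2 \<noteq> (0::'k hfrac)" "1 - hdiff i j \<noteq> (0::'k hfrac)"
    "hdiff i j \<noteq> (1::'k hfrac)" "hdiff i j \<noteq> (2::'k hfrac)" "hdiff i j \<noteq> (-1::'k hfrac)"
  using hdiff_shift_nonzero[OF assms, of 0] hdiff_shift_nonzero[OF assms, of 1]
    hdiff_shift_nonzero[OF assms, of "-1"] hdiff_shift_nonzero[OF assms, of "-2"]
    hdiff_shift_nonzero[OF assms, of 2] by (auto simp: eq_neg_iff_add_eq_0)

lemma hdiff_swap: "hdiff j i = - (hdiff i j :: 'k::idom hfrac)"
  by (simp add: hdiff_def)

lemma fshift_hdiff [simp]: "fshift l (hdiff i j) = hdiff i j + of_int (l i - l j)"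
  by (simp add: hdiff_def)

text \<open>
  The defining relations, as they hold in any ring that receives the generators. The index set and
  the coefficient ring are parameters tied down by equations, which makes them opaque symbols for
  the simplifier. The relations between coefficients and \<open>x\<close>, \<open>d\<close> are required for constants and
  for the \<open>h\<^sub>i\<close> only.
\<close>

locale diff_relations = ring R for R :: "('r, 'm) ring_scheme" (structure) +
  fixes n :: nat and N :: "nat set" and U :: "'k::idom hfrac set"
    and kf :: "'k hfrac \<Rightarrow> 'r" and x d :: "nat \<Rightarrow> 'r"
  assumes N_eq: "N = {1..n}" and U_eq: "U = Ubar_h n"
    and kf_closed [simp]: "u \<in> U \<Longrightarrow> kf u \<in> carrier R"
    and x_closed [simp]: "j \<in> N \<Longrightarrow> x j \<in> carrier R"
    and d_closed [simp]: "j \<in> N \<Longrightarrow> d j \<in> carrier R"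
    and kf_add: "u \<in> U \<Longrightarrow> v \<in> U \<Longrightarrow> kf (u + v) = kf u \<oplus> kf v"
    and kf_mult: "u \<in> U \<Longrightarrow> v \<in> U \<Longrightarrow> kf (u * v) = kf u \<otimes> kf v"
    and kf_one: "kf 1 = \<one>"
    and const_x: "j \<in> N \<Longrightarrow> kf (const a) \<otimes> x j = x j \<otimes> kf (const a)"
    and const_d: "j \<in> N \<Longrightarrow> kf (const a) \<otimes> d j = d j \<otimes> kf (const a)"
    and h_x: "i \<in> N \<Longrightarrow> j \<in> N \<Longrightarrow> kf (hh i) \<otimes> x j = x j \<otimes> kf (hh i + (if i = j then 1 else 0))"
    and h_d: "i \<in> N \<Longrightarrow> j \<in> N \<Longrightarrow> kf (hh i) \<otimes> d j = d j \<otimes> kf (hh i - (if i = j then 1 else 0))"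
    and x_x: "i \<in> N \<Longrightarrow> j \<in> N \<Longrightarrow> i < j
      \<Longrightarrow> x i \<otimes> x j = kf ((hdiff i j + 1) / hdiff i j) \<otimes> x j \<otimes> x i"
    and d_d: "i \<in> N \<Longrightarrow> j \<in> N \<Longrightarrow> i < j
      \<Longrightarrow> d i \<otimes> d j = kf ((hdiff i j - 1) / hdiff i j) \<otimes> d j \<otimes> d i"
    and x_d_less: "i \<in> N \<Longrightarrow> j \<in> N \<Longrightarrow> i < j \<Longrightarrow> x i \<otimes> d j = d j \<otimes> x i"
    and x_d_greater: "i \<in> N \<Longrightarrow> j \<in> N \<Longrightarrow> i > j
      \<Longrightarrow> x i \<otimes> d j = kf (hdiff i j * (hdiff i j - 2) / (hdiff i j - 1)\<^sup>2) \<otimes> d j \<otimes> x i"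
    and x_d_same: "i \<in> N
      \<Longrightarrow> x i \<otimes> d i = (\<Oplus>j\<in>N. kf (1 / (1 - hdiff i j)) \<otimes> d j \<otimes> x j) \<ominus> \<one>"
begin

lemma finite_N [simp]: "finite N"
  by (simp add: N_eq)

lemma U_const [simp]: "const a \<in> U"
  unfolding U_eq by (intro Ubar_poly U_h_const)

lemma U_one [simp]: "1 \<in> U"
  unfolding U_eq by (rule Ubar_one)

lemma U_zero [simp]: "0 \<in> U"
  unfolding U_eq by (rule Ubar_zero)

lemma U_add [simp]: "u \<in> U \<Longrightarrow> v \<in> U \<Longrightarrow> u + v \<in> U"
  unfolding U_eq by (rule Ubar_add)

lemma U_diff [simp]: "u \<in> U \<Longrightarrow> v \<in> U \<Longrightarrow> u - v \<in> U"
  unfolding U_eq by (rule Ubar_diff)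

lemma U_uminus [simp]: "u \<in> U \<Longrightarrow> - u \<in> U"
  using U_diff[of 0 u] by simp

lemma U_mult [simp]: "u \<in> U \<Longrightarrow> v \<in> U \<Longrightarrow> u * v \<in> U"
  unfolding U_eq by (rule Ubar_mult)

lemma U_power [simp]: "u \<in> U \<Longrightarrow> u ^ k \<in> U"
  by (induction k) simp_all

lemma U_sum [simp]: "(\<And>i. i \<in> I \<Longrightarrow> f i \<in> U) \<Longrightarrow> sum f I \<in> U"
  by (induction I rule: infinite_finite_induct) simp_all

lemma U_prod [simp]: "(\<And>i. i \<in> I \<Longrightarrow> f i \<in> U) \<Longrightarrow> prod f I \<in> U"
  by (induction I rule: infinite_finite_induct) simp_all

lemma U_hh [simp]: "i \<in> N \<Longrightarrow> hh i \<in> U"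
  unfolding U_eq N_eq by (rule Ubar_hh)

lemma U_fshift [simp]: "u \<in> U \<Longrightarrow> fshift l u \<in> U"
  unfolding U_eq by (rule fshift_Ubar)

lemma U_hdiff [simp]: "i \<in> N \<Longrightarrow> j \<in> N \<Longrightarrow> hdiff i j \<in> U"
  by (simp add: hdiff_def)

lemma U_two [simp]: "2 \<in> U"
  using U_add[OF U_one U_one] by simp

lemma U_divide:
  assumes "u \<in> U" "i \<in> N" "j \<in> N" "i \<noteq> j"
  shows "u / hdiff i j \<in> U" "u / (hdiff i j + 1) \<in> U" "u / (hdiff i j - 1) \<in> U"
    "u / (hdiff i j - 2) \<in> U" "u / (hdiff i j + 2) \<in> U" "u / (1 - hdiff i j) \<in> U"
proof -
  have *: "u / (hdiff i j + of_int k) \<in> U" for k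
    unfolding divide_inverse
    using assms Ubar_inverse_shift[of i n j k] by (intro U_mult) (simp_all add: U_eq N_eq)
  show "u / hdiff i j \<in> U" "u / (hdiff i j + 1) \<in> U" "u / (hdiff i j - 1) \<in> U"
    "u / (hdiff i j - 2) \<in> U" "u / (hdiff i j + 2) \<in> U"
    using *[of 0] *[of 1] *[of "-1"] *[of "-2"] *[of 2] by simp_all
  then have "- (u / (hdiff i j - 1)) \<in> U" by simp
  then show "u / (1 - hdiff i j) \<in> U" by (simp add: minus_divide_right)
qed

lemma U_esymf [simp]: "S \<subseteq> N \<Longrightarrow> esymf hh S k \<in> U"
  unfolding esymf_def by (intro U_sum U_prod U_hh) auto

lemma kf_commute: "u \<in> U \<Longrightarrow> v \<in> U \<Longrightarrow> kf u \<otimes> kf v = kf v \<otimes> kf u"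
  by (metis kf_mult mult.commute)

lemma kf_zero: "kf 0 = \<zero>"
  using kf_add[of 0 0] add.l_cancel_one'[of "kf 0" "kf 0"] by simp

lemma kf_uminus: "u \<in> U \<Longrightarrow> kf (- u) = \<ominus> kf u"
  using minus_equality[of "kf (- u)" "kf u"] kf_add[of "- u" u] by (simp add: kf_zero)

lemma kf_mult_assoc: "u \<in> U \<Longrightarrow> v \<in> U \<Longrightarrow> a \<in> carrier R \<Longrightarrow> kf u \<otimes> (kf v \<otimes> a) = kf (u * v) \<otimes> a"
  by (simp add: kf_mult m_assoc)

text \<open>
  Commutation up to the shift \<open>l\<close> passes from constants and variables to polynomials by induction,
  and then to denominators, because these are invertible in \<open>U\<close>.
\<close>

lemma kf_swap:
  assumes g: "g \<in> carrier R" and const: "\<And>a. kf (const a) \<otimes> g = g \<otimes> kf (const a)"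
    and h: "\<And>i. i \<in> N \<Longrightarrow> kf (hh i) \<otimes> g = g \<otimes> kf (fshift l (hh i))"
    and u: "u \<in> U"
  shows "kf u \<otimes> g = g \<otimes> kf (fshift l u)"
proof -
  define F where "F p = (Fraction_Field.Fract p 1 :: 'k hfrac)" for p
  interpret F: unital_hom F unfolding F_def by (rule unital_hom_Fract)
  have poly: "F p \<in> U \<and> kf (F p) \<otimes> g = g \<otimes> kf (fshift l (F p))" if "p \<in> poly_over N" for p
    using that
  proof (induction rule: poly_over_induct)
    case (const a)
    then show ?case unfolding F_def using assms(2)[of a] by simp
  next
    case (var i)
    then show ?case unfolding F_def hh_def[symmetric] using h[of i] by (simp del: fshift_hh)
  next
    case (add p q)
    then show ?case using g by (simp add: kf_add l_distr r_distr)
  next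
    case (mult p q)
    have "kf (F p) \<otimes> kf (F q) \<otimes> g = kf (F p) \<otimes> g \<otimes> kf (fshift l (F q))"
      using conjunct1[OF mult(1)] conjunct1[OF mult(2)] g by (simp add: m_assoc mult(2))
    also have "\<dots> = g \<otimes> (kf (fshift l (F p)) \<otimes> kf (fshift l (F q)))"
      using conjunct1[OF mult(1)] conjunct1[OF mult(2)] g by (simp add: m_assoc mult(1))
    finally show ?case using conjunct1[OF mult(1)] conjunct1[OF mult(2)] by (simp add: kf_mult)
  qed
  obtain p q where pq: "u = Fraction_Field.Fract p q" "p \<in> U_h n" "q \<in> denoms n" "q \<noteq> 0"
    using u unfolding U_eq by (rule Ubar_cases)
  \<comment> \<open>From \<open>kf (F q)\<close> to its inverse: insert \<open>F q * r = 1\<close> on the right of \<open>g\<close> and cancel on the left.\<close>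
  define r where "r = inverse (F q)"
  have rU: "r \<in> U"
    unfolding r_def U_eq F_def using pq by (simp add: Ubar_fract U_h_one)
  have q: "F q \<in> U" "kf (F q) \<otimes> g = g \<otimes> kf (fshift l (F q))"
    and p: "F p \<in> U" "kf (F p) \<otimes> g = g \<otimes> kf (fshift l (F p))"
    using poly pq denoms_U_h[OF pq(3)] by (simp_all add: U_h_poly_over N_eq)
  have "F q \<noteq> 0" unfolding F_def using pq(4) by (simp add: Zero_fract_def eq_fract)
  then have qr: "F q * r = 1" unfolding r_def by simp
  then have "fshift l (F q * r) = 1" by simp
  then have qr': "fshift l (F q) * fshift l r = 1" by (simp only: fshift.hom_mult)
  have "kf r \<otimes> g = kf r \<otimes> (g \<otimes> (kf (fshift l (F q)) \<otimes> kf (fshift l r)))"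
    using g rU q(1) qr' by (simp add: kf_mult[symmetric] kf_one)
  also have "\<dots> = kf r \<otimes> (kf (F q) \<otimes> g) \<otimes> kf (fshift l r)"
    unfolding q(2) using g rU q(1) by (simp add: m_assoc)
  also have "\<dots> = (kf (r * F q) \<otimes> g) \<otimes> kf (fshift l r)"
    using g rU q(1) by (simp add: m_assoc kf_mult)
  also have "\<dots> = g \<otimes> kf (fshift l r)"
    using g rU q qr by (simp add: mult.commute[of r] kf_one)
  finally have r: "kf r \<otimes> g = g \<otimes> kf (fshift l r)" .
  have ur: "u = F p * r" unfolding r_def F_def using pq by simp
  have "kf u \<otimes> g = kf (F p) \<otimes> (kf r \<otimes> g)"
    unfolding ur using g rU p(1) by (simp add: kf_mult m_assoc)
  also have "\<dots> = (kf (F p) \<otimes> g) \<otimes> kf (fshift l r)"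
    unfolding r using g rU p(1) by (simp add: m_assoc)
  also have "\<dots> = g \<otimes> kf (fshift l u)"
    unfolding p(2) ur using g rU p(1) by (simp add: kf_mult m_assoc)
  finally show ?thesis .
qed

lemma kf_x: "i \<in> N \<Longrightarrow> u \<in> U \<Longrightarrow> kf u \<otimes> x i = x i \<otimes> kf (fshift (unit_shift i 1) u)"
  by (rule kf_swap) (auto simp: const_x h_x unit_shift_def)

lemma kf_d: "i \<in> N \<Longrightarrow> u \<in> U \<Longrightarrow> kf u \<otimes> d i = d i \<otimes> kf (fshift (unit_shift i (-1)) u)"
  by (rule kf_swap) (auto simp: const_d h_d unit_shift_def)

lemma x_kf: "i \<in> N \<Longrightarrow> u \<in> U \<Longrightarrow> x i \<otimes> kf u = kf (fshift (unit_shift i (-1)) u) \<otimes> x i"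
  by (simp add: kf_x)

lemma d_kf: "i \<in> N \<Longrightarrow> u \<in> U \<Longrightarrow> d i \<otimes> kf u = kf (fshift (unit_shift i 1) u) \<otimes> d i"
  by (simp add: kf_d)

definition gam :: "nat \<Rightarrow> 'r" where
  "gam j = d j \<otimes> x j"

lemma gam_closed [simp]: "j \<in> N \<Longrightarrow> gam j \<in> carrier R"
  by (simp add: gam_def)

lemma kf_gam: "j \<in> N \<Longrightarrow> u \<in> U \<Longrightarrow> kf u \<otimes> gam j = gam j \<otimes> kf u"
  unfolding gam_def by (simp add: m_assoc[symmetric] kf_d) (simp add: m_assoc kf_x)

text \<open>
  For \<open>i > j\<close> the factor is the inverse of the one in the defining relation for the pair \<open>j < i\<close>.
  The same holds for \<open>d_swap\<close>.
\<close>

lemma x_swap: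
  assumes "i \<in> N" "j \<in> N" "i \<noteq> j"
  shows "x i \<otimes> x j = kf (if i < j then (hdiff i j + 1) / hdiff i j else hdiff i j / (hdiff i j - 1)) \<otimes> (x j \<otimes> x i)"
proof (cases "i < j")
  case True
  then show ?thesis using assms x_x by (simp add: m_assoc U_divide)
next
  case False
  define a b :: "'k hfrac" where "a = hdiff i j / (hdiff i j - 1)" and "b = (hdiff j i + 1) / hdiff j i"
  have U: "a \<in> U" "b \<in> U" and ab: "a * b = 1"
    using assms by (simp_all add: a_def b_def U_divide) (simp add: hdiff_swap[of j i] field_simps)
  have "kf a \<otimes> (x j \<otimes> x i) = kf a \<otimes> (kf b \<otimes> (x i \<otimes> x j))"
    using False assms U x_x[of j i] by (simp add: m_assoc b_def[symmetric])
  also have "\<dots> = x i \<otimes> x j"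
    using assms U by (simp add: kf_mult_assoc ab kf_one)
  finally show ?thesis using False by (simp add: a_def)
qed

lemma d_swap:
  assumes "i \<in> N" "j \<in> N" "i \<noteq> j"
  shows "d i \<otimes> d j = kf (if i < j then (hdiff i j - 1) / hdiff i j else hdiff i j / (hdiff i j + 1)) \<otimes> (d j \<otimes> d i)"
proof (cases "i < j")
  case True
  then show ?thesis using assms d_d by (simp add: m_assoc U_divide)
next
  case False
  define a b :: "'k hfrac" where "a = hdiff i j / (hdiff i j + 1)" and "b = (hdiff j i - 1) / hdiff j i"
  have U: "a \<in> U" "b \<in> U" and ab: "a * b = 1"
    using assms by (simp_all add: a_def b_def U_divide) (simp add: hdiff_swap[of j i] field_simps)
  have "kf a \<otimes> (d j \<otimes> d i) = kf a \<otimes> (kf b \<otimes> (d i \<otimes> d j))"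
    using False assms U d_d[of j i] by (simp add: m_assoc b_def[symmetric])
  also have "\<dots> = d i \<otimes> d j"
    using assms U by (simp add: kf_mult_assoc ab kf_one)
  finally show ?thesis using False by (simp add: a_def)
qed

definition xd_factor :: "nat \<Rightarrow> nat \<Rightarrow> 'k hfrac" where
  "xd_factor i j = (if i < j then 1 else hdiff i j * (hdiff i j - 2) / (hdiff i j - 1)\<^sup>2)"

lemma xd_factor_U [simp]:
  assumes "i \<in> N" "j \<in> N" "i \<noteq> j"
  shows "xd_factor i j \<in> U" "1 / xd_factor i j \<in> U"
proof -
  have "(hdiff i j / (hdiff i j - 1)) * ((hdiff i j - 2) / (hdiff i j - 1)) \<in> U"
    "((hdiff i j - 1) / hdiff i j) * ((hdiff i j - 1) / (hdiff i j - 2)) \<in> U"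
    using assms by (intro U_mult U_divide; simp)+
  then show "xd_factor i j \<in> U" "1 / xd_factor i j \<in> U"
    by (simp_all add: xd_factor_def power2_eq_square)
qed

lemma xd_factor_nonzero: "i \<noteq> j \<Longrightarrow> xd_factor i j \<noteq> 0"
  by (simp add: xd_factor_def)

lemma x_d_swap:
  assumes "i \<in> N" "j \<in> N" "i \<noteq> j"
  shows "x i \<otimes> d j = kf (xd_factor i j) \<otimes> (d j \<otimes> x i)"
  using assms xd_factor_U[OF assms] x_d_less[of i j] x_d_greater[of i j]
  by (cases "i < j") (simp_all add: xd_factor_def kf_one m_assoc)

lemma d_x_swap:
  assumes "i \<in> N" "j \<in> N" "i \<noteq> j"
  shows "d j \<otimes> x i = kf (1 / xd_factor i j) \<otimes> (x i \<otimes> d j)"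
  using assms by (simp add: x_d_swap kf_mult_assoc xd_factor_nonzero kf_one)

text \<open>
  Moving \<open>x i\<close> past \<open>gam j\<close> picks up one factor from \<open>d j\<close> and one from \<open>x j\<close>. Each depends on the
  order of \<open>i\<close> and \<open>j\<close>, their product does not.
\<close>

lemma x_gam:
  assumes "i \<in> N" "j \<in> N" "i \<noteq> j"
  shows "x i \<otimes> gam j = kf (hdiff i j / (hdiff i j - 1)) \<otimes> gam j \<otimes> x i"
proof -
  define a :: "'k hfrac" where "a = (if i < j then (hdiff i j + 1) / hdiff i j else hdiff i j / (hdiff i j - 1))"
  have aU: "a \<in> U" using assms by (simp add: a_def U_divide)
  have eq: "xd_factor i j * fshift (unit_shift j 1) a = hdiff i j / (hdiff i j - 1)"
    using assms(3) by (auto simp: xd_factor_def a_def unit_shift_def power2_eq_square divide_simps)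
  have "x i \<otimes> gam j = kf (xd_factor i j) \<otimes> (d j \<otimes> (x i \<otimes> x j))"
    unfolding gam_def using assms by (simp add: m_assoc[symmetric] x_d_swap)
  also have "\<dots> = kf (xd_factor i j) \<otimes> ((d j \<otimes> kf a) \<otimes> (x j \<otimes> x i))"
    using assms aU x_swap[OF assms, folded a_def] by (simp add: m_assoc)
  also have "\<dots> = kf (xd_factor i j * fshift (unit_shift j 1) a) \<otimes> (d j \<otimes> (x j \<otimes> x i))"
    using assms aU by (simp add: d_kf m_assoc kf_mult_assoc)
  finally show ?thesis unfolding eq gam_def using assms by (simp add: m_assoc U_divide)
qed

lemma d_gam:
  assumes "i \<in> N" "j \<in> N" "i \<noteq> j"
  shows "d i \<otimes> gam j = kf (hdiff i j / (hdiff i j + 1)) \<otimes> gam j \<otimes> d i"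
proof -
  define a :: "'k hfrac" where "a = (if i < j then (hdiff i j - 1) / hdiff i j else hdiff i j / (hdiff i j + 1))"
  define b where "b = 1 / xd_factor j i"
  have U: "a \<in> U" "b \<in> U" using assms by (simp_all add: a_def b_def U_divide)
  have eq: "a * fshift (unit_shift j 1) b = hdiff i j / (hdiff i j + 1)"
    using assms(3) hdiff_nonzero[of j i, where ?'k = 'k] unfolding xd_factor_def a_def b_def hdiff_swap[of j i]
    by (auto simp: unit_shift_def power2_eq_square divide_simps) (simp_all add: algebra_simps)
  have "d i \<otimes> gam j = kf a \<otimes> (d j \<otimes> (d i \<otimes> x j))"
    unfolding gam_def using assms U d_swap[OF assms, folded a_def] by (simp add: m_assoc[symmetric])
  also have "\<dots> = kf a \<otimes> ((d j \<otimes> kf b) \<otimes> (x j \<otimes> d i))"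
    using assms U d_x_swap[of j i, folded b_def] by (simp add: m_assoc)
  also have "\<dots> = kf (a * fshift (unit_shift j 1) b) \<otimes> (d j \<otimes> (x j \<otimes> d i))"
    using assms U by (simp add: d_kf m_assoc kf_mult_assoc)
  finally show ?thesis unfolding eq gam_def using assms by (simp add: m_assoc U_divide)
qed

end

section \<open>Affine combinations of the elements \<open>d j \<otimes> x j\<close>\<close>

context diff_relations
begin

text \<open>
  Left combinations of the \<open>gam j\<close> and \<open>1\<close> with coefficients in \<open>U\<close>. All elements \<open>c k\<close> and
  \<open>x i \<otimes> d i\<close> are of this form, and the form is preserved when a generator is moved past it.
\<close>

definition gamma_form :: "(nat \<Rightarrow> 'k hfrac) \<Rightarrow> 'k hfrac \<Rightarrow> 'r" where
  "gamma_form u v = (\<Oplus>j\<in>N. kf (u j) \<otimes> gam j) \<oplus> kf v"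

lemma gamma_form_closed [simp]: "(\<And>j. j \<in> N \<Longrightarrow> u j \<in> U) \<Longrightarrow> v \<in> U \<Longrightarrow> gamma_form u v \<in> carrier R"
  by (simp add: gamma_form_def Pi_def)

lemma gamma_form_cong: "(\<And>j. j \<in> N \<Longrightarrow> u j = u' j) \<Longrightarrow> (\<And>j. j \<in> N \<Longrightarrow> u j \<in> U) \<Longrightarrow> v = v' \<Longrightarrow> gamma_form u v = gamma_form u' v'"
proof -
  assume *: "\<And>j. j \<in> N \<Longrightarrow> u j = u' j" "\<And>j. j \<in> N \<Longrightarrow> u j \<in> U" "v = v'"
  have "(\<Oplus>j\<in>N. kf (u j) \<otimes> gam j) = (\<Oplus>j\<in>N. kf (u' j) \<otimes> gam j)"
    by (rule finsum_cong') (use * in auto)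
  then show ?thesis by (simp add: gamma_form_def *)
qed

lemma gamma_form_split:
  assumes "i \<in> N" "\<And>j. j \<in> N \<Longrightarrow> u j \<in> U"
  shows "gamma_form u v = kf (u i) \<otimes> gam i \<oplus> (\<Oplus>j\<in>N - {i}. kf (u j) \<otimes> gam j) \<oplus> kf v"
proof -
  have "(\<Oplus>j\<in>insert i (N - {i}). kf (u j) \<otimes> gam j) = kf (u i) \<otimes> gam i \<oplus> (\<Oplus>j\<in>N - {i}. kf (u j) \<otimes> gam j)"
    by (rule finsum_insert) (use assms in auto)
  then show ?thesis using assms(1) by (simp add: gamma_form_def insert_absorb)
qed

lemma gamma_form_add:
  assumes "\<And>j. j \<in> N \<Longrightarrow> u j \<in> U" "v \<in> U" "\<And>j. j \<in> N \<Longrightarrow> u' j \<in> U" "v' \<in> U"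
  shows "gamma_form u v \<oplus> gamma_form u' v' = gamma_form (\<lambda>j. u j + u' j) (v + v')"
proof -
  have "(\<Oplus>j\<in>N. kf (u j + u' j) \<otimes> gam j) = (\<Oplus>j\<in>N. kf (u j) \<otimes> gam j \<oplus> kf (u' j) \<otimes> gam j)"
    using assms by (intro finsum_cong') (auto simp: kf_add l_distr)
  also have "\<dots> = (\<Oplus>j\<in>N. kf (u j) \<otimes> gam j) \<oplus> (\<Oplus>j\<in>N. kf (u' j) \<otimes> gam j)"
    using assms by (intro finsum_addf) auto
  finally show ?thesis
    unfolding gamma_form_def using assms by (simp add: kf_add a_ac Pi_def)
qed

lemma gamma_form_smult:
  assumes "w \<in> U" "\<And>j. j \<in> N \<Longrightarrow> u j \<in> U" "v \<in> U"
  shows "kf w \<otimes> gamma_form u v = gamma_form (\<lambda>j. w * u j) (w * v)"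
proof -
  have "kf w \<otimes> (\<Oplus>j\<in>N. kf (u j) \<otimes> gam j) = (\<Oplus>j\<in>N. kf w \<otimes> (kf (u j) \<otimes> gam j))"
    using assms by (intro finsum_rdistr) auto
  also have "\<dots> = (\<Oplus>j\<in>N. kf (w * u j) \<otimes> gam j)"
    using assms by (intro finsum_cong') (auto simp: kf_mult_assoc)
  finally show ?thesis
    unfolding gamma_form_def using assms by (simp add: r_distr kf_mult Pi_def)
qed

lemma gamma_form_zero: "gamma_form (\<lambda>_. 0) 0 = \<zero>"
proof -
  have "(\<Oplus>j\<in>N. kf 0 \<otimes> gam j) = (\<Oplus>j\<in>N. \<zero>)"
    by (intro finsum_cong') (auto simp: kf_zero)
  then show ?thesis by (simp add: gamma_form_def kf_zero)
qed

lemma finsum_gamma_form: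
  assumes "finite K" "\<And>k. k \<in> K \<Longrightarrow> w k \<in> U" "\<And>k j. k \<in> K \<Longrightarrow> j \<in> N \<Longrightarrow> u k j \<in> U" "\<And>k. k \<in> K \<Longrightarrow> v k \<in> U"
  shows "(\<Oplus>k\<in>K. kf (w k) \<otimes> gamma_form (u k) (v k)) = gamma_form (\<lambda>j. \<Sum>k\<in>K. w k * u k j) (\<Sum>k\<in>K. w k * v k)"
  using assms
proof (induction K)
  case empty
  then show ?case by (simp add: gamma_form_zero)
next
  case (insert k K)
  have "(\<Oplus>k\<in>insert k K. kf (w k) \<otimes> gamma_form (u k) (v k))
      = kf (w k) \<otimes> gamma_form (u k) (v k) \<oplus> (\<Oplus>k\<in>K. kf (w k) \<otimes> gamma_form (u k) (v k))"
    using insert by (intro finsum_insert) auto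
  also have "\<dots> = gamma_form (\<lambda>j. \<Sum>k\<in>insert k K. w k * u k j) (\<Sum>k\<in>insert k K. w k * v k)"
    using insert by (simp add: gamma_form_smult gamma_form_add)
  finally show ?case .
qed

text \<open>
  A generator \<open>g\<close> of index \<open>i\<close> (\<open>x i\<close> or \<open>d i\<close>) shifts the coefficients, rescales \<open>gam j\<close> for
  \<open>j \<noteq> i\<close>, and turns \<open>gam i\<close> into a combination of all \<open>gam j\<close>. Both generators are treated at
  once through the parameters \<open>\<alpha>\<close>, \<open>\<beta>\<close> and \<open>\<epsilon>\<close>.
\<close>

lemma twisted_gamma_form:
  assumes i: "i \<in> N" and g: "g \<in> carrier R"
    and g_kf: "\<And>u. u \<in> U \<Longrightarrow> g \<otimes> kf u = kf (fshift l u) \<otimes> g"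
    and g_gam: "\<And>j. j \<in> N \<Longrightarrow> j \<noteq> i \<Longrightarrow> g \<otimes> gam j = kf (\<alpha> j) \<otimes> gam j \<otimes> g"
    and g_gam_i: "g \<otimes> gam i = gamma_form (\<lambda>j. if j = i then 1 else \<beta> j) \<epsilon> \<otimes> g"
    and U: "\<And>j. j \<in> N \<Longrightarrow> j \<noteq> i \<Longrightarrow> \<alpha> j \<in> U" "\<And>j. j \<in> N \<Longrightarrow> j \<noteq> i \<Longrightarrow> \<beta> j \<in> U" "\<epsilon> \<in> U"
    and u: "\<And>j. j \<in> N \<Longrightarrow> u j \<in> U" "v \<in> U"
  shows "g \<otimes> gamma_form u v
    = gamma_form (\<lambda>j. if j = i then fshift l (u i) else fshift l (u i) * \<beta> j + fshift l (u j) * \<alpha> j)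
        (fshift l v + fshift l (u i) * \<epsilon>) \<otimes> g"
proof -
  let ?s = "fshift l" and ?b = "\<lambda>j. if j = i then 1 else \<beta> j"
  define a where "a j = (if j = i then 0 else ?s (u j) * \<alpha> j)" for j
  have bU: "?b j \<in> U" if "j \<in> N" for j using U that by auto
  have aU: "a j \<in> U" if "j \<in> N" for j using U u that by (auto simp: a_def)
  have "g \<otimes> (kf (u i) \<otimes> gam i) = kf (?s (u i)) \<otimes> (g \<otimes> gam i)"
    using i g u by (simp add: m_assoc[symmetric] g_kf)
  also have "\<dots> = gamma_form (\<lambda>j. ?s (u i) * ?b j) (?s (u i) * \<epsilon>) \<otimes> g"
    unfolding g_gam_i using i g u bU U(3)
    by (subst m_assoc[symmetric]) (auto simp del: if_split simp: gamma_form_smult)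
  finally have 1: "g \<otimes> (kf (u i) \<otimes> gam i) = gamma_form (\<lambda>j. ?s (u i) * ?b j) (?s (u i) * \<epsilon>) \<otimes> g" .
  have "g \<otimes> (kf (u j) \<otimes> gam j) = (kf (a j) \<otimes> gam j) \<otimes> g" if j: "j \<in> N - {i}" for j
  proof -
    have "g \<otimes> (kf (u j) \<otimes> gam j) = kf (?s (u j)) \<otimes> (g \<otimes> gam j)"
      using j g u by (simp add: m_assoc[symmetric] g_kf)
    also have "\<dots> = kf (?s (u j)) \<otimes> kf (\<alpha> j) \<otimes> gam j \<otimes> g"
      using j g u U by (simp add: m_assoc g_gam)
    finally show ?thesis using j u U by (simp add: kf_mult a_def)
  qed
  then have "g \<otimes> (\<Oplus>j\<in>N - {i}. kf (u j) \<otimes> gam j) = (\<Oplus>j\<in>N - {i}. kf (a j) \<otimes> gam j \<otimes> g)"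
    using g u aU by (subst finsum_rdistr) (auto intro!: finsum_cong')
  also have "\<dots> = (\<Oplus>j\<in>N - {i}. kf (a j) \<otimes> gam j) \<otimes> g"
    using g aU by (intro finsum_ldistr[symmetric]) (auto simp del: if_split)
  finally have 2: "g \<otimes> (\<Oplus>j\<in>N - {i}. kf (u j) \<otimes> gam j) = (\<Oplus>j\<in>N - {i}. kf (a j) \<otimes> gam j) \<otimes> g" .
  have 2: "g \<otimes> (\<Oplus>j\<in>N - {i}. kf (u j) \<otimes> gam j) \<oplus> g \<otimes> kf v = gamma_form a (?s v) \<otimes> g"
  proof -
    have "gamma_form a (?s v) = (\<Oplus>j\<in>N - {i}. kf (a j) \<otimes> gam j) \<oplus> kf (?s v)"
      using i u aU gamma_form_split[OF i, of a "?s v"] by (simp add: a_def[of i] kf_zero Pi_def)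
    then show ?thesis using g u aU 2 by (simp add: g_kf l_distr Pi_def)
  qed
  have "g \<otimes> gamma_form u v = g \<otimes> (kf (u i) \<otimes> gam i) \<oplus> (g \<otimes> (\<Oplus>j\<in>N - {i}. kf (u j) \<otimes> gam j) \<oplus> g \<otimes> kf v)"
    using g u i gamma_form_split[OF i, of u v] by (simp add: r_distr Pi_def a_assoc)
  also have "\<dots> = (gamma_form (\<lambda>j. ?s (u i) * ?b j) (?s (u i) * \<epsilon>) \<oplus> gamma_form a (?s v)) \<otimes> g"
    unfolding 1 2 using g u U aU bU i by (intro l_distr[symmetric] gamma_form_closed) (auto simp del: if_split)
  also have "gamma_form (\<lambda>j. ?s (u i) * ?b j) (?s (u i) * \<epsilon>) \<oplus> gamma_form a (?s v)
      = gamma_form (\<lambda>j. ?s (u i) * ?b j + a j) (?s (u i) * \<epsilon> + ?s v)"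
    using u U aU bU i by (intro gamma_form_add) (auto simp del: if_split)
  also have "\<dots> = gamma_form (\<lambda>j. if j = i then ?s (u i) else ?s (u i) * \<beta> j + ?s (u j) * \<alpha> j) (?s v + ?s (u i) * \<epsilon>)"
    using u U aU bU i by (intro gamma_form_cong) (auto simp: add.commute a_def)
  finally show ?thesis .
qed

text \<open>
  The last defining relation, with the coefficient \<open>1 / (1 - hdiff i i)\<close> of \<open>gam i\<close> written as \<open>1\<close>.
\<close>

lemma x_d_gamma_form:
  assumes i: "i \<in> N"
  shows "x i \<otimes> d i = gamma_form (\<lambda>j. if j = i then 1 else 1 / (1 - hdiff i j)) (-1)"
proof -
  have U: "1 / (1 - hdiff i j) \<in> U" if "j \<in> N" for j
    using that i by (cases "i = j") (simp_all add: U_divide, simp add: hdiff_def)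
  have "(\<Oplus>j\<in>N. kf (1 / (1 - hdiff i j)) \<otimes> d j \<otimes> x j) \<ominus> \<one> = gamma_form (\<lambda>j. 1 / (1 - hdiff i j)) (-1)"
    unfolding gamma_form_def a_minus_def using U
    by (auto intro!: arg_cong2[where f = add] finsum_cong' simp: gam_def m_assoc kf_uminus kf_one)
  also have "\<dots> = gamma_form (\<lambda>j. if j = i then 1 else 1 / (1 - hdiff i j)) (-1)"
    using U by (intro gamma_form_cong) (auto simp: hdiff_def)
  finally show ?thesis using x_d_same[OF i] by simp
qed

lemma x_gam_same:
  assumes i: "i \<in> N"
  shows "x i \<otimes> gam i = gamma_form (\<lambda>j. if j = i then 1 else 1 / (1 - hdiff i j)) (-1) \<otimes> x i"
  unfolding gam_def using i x_d_gamma_form[OF i] by (simp add: m_assoc[symmetric])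

text \<open>
  Multiply the expression of \<open>x i \<otimes> d i\<close> by \<open>d i\<close> from the left. This writes \<open>gam i \<otimes> d i\<close> as
  \<open>d i \<otimes> gam i\<close> plus terms \<open>d i \<otimes> gam j\<close> with \<open>j \<noteq> i\<close>, which are known from \<open>d_gam\<close>; the equation
  is then solved for \<open>d i \<otimes> gam i\<close>.
\<close>

lemma d_gam_same:
  assumes i: "i \<in> N"
  shows "d i \<otimes> gam i = gamma_form (\<lambda>j. if j = i then 1 else 1 / (hdiff i j + 1)) 1 \<otimes> d i"
proof -
  let ?L = "gamma_form (\<lambda>j. if j = i then 1 else 1 / (hdiff i j + 1)) 1"
  let ?S = "\<lambda>f. \<Oplus>j\<in>N - {i}. kf (f j) \<otimes> gam j"
  have U: "1 / (1 - hdiff i j) \<in> U" "1 / (hdiff i j + 1) \<in> U" if "j \<in> N - {i}" for j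
    using that i by (auto intro!: U_divide)
  have U': "(if j = i then 1 else 1 / (1 - hdiff i j)) \<in> U" "(if j = i then 1 else 1 / (hdiff i j + 1)) \<in> U" if "j \<in> N" for j
    using that U[of j] by auto
  have tm: "d i \<otimes> (kf (1 / (1 - hdiff i j)) \<otimes> gam j) = (kf (- (1 / (hdiff i j + 1))) \<otimes> gam j) \<otimes> d i"
    if j: "j \<in> N - {i}" for j
  proof -
    have e: "fshift (unit_shift i 1) (1 / (1 - hdiff i j)) * (hdiff i j / (hdiff i j + 1)) = - (1 / (hdiff i j + 1))"
      using j by (simp add: unit_shift_def)
    have "d i \<otimes> (kf (1 / (1 - hdiff i j)) \<otimes> gam j)
        = kf (fshift (unit_shift i 1) (1 / (1 - hdiff i j))) \<otimes> (d i \<otimes> gam j)"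
      using i j U(1)[OF j] by (simp add: m_assoc[symmetric] d_kf del: fshift_divide)
    also have "\<dots> = kf (fshift (unit_shift i 1) (1 / (1 - hdiff i j)) * (hdiff i j / (hdiff i j + 1))) \<otimes> gam j \<otimes> d i"
      using i j U(1)[OF j] d_gam[of i j] by (simp add: m_assoc kf_mult_assoc U_divide del: fshift_divide)
    finally show ?thesis unfolding e .
  qed
  have S: "?S (\<lambda>j. - (1 / (hdiff i j + 1))) \<in> carrier R" "?S (\<lambda>j. 1 / (1 - hdiff i j)) \<in> carrier R"
    "?S (\<lambda>j. 1 / (hdiff i j + 1)) \<in> carrier R"
    using U by (auto intro!: finsum_closed simp del: minus_divide_left)
  have "d i \<otimes> ?S (\<lambda>j. 1 / (1 - hdiff i j)) = (\<Oplus>j\<in>N - {i}. (kf (- (1 / (hdiff i j + 1))) \<otimes> gam j) \<otimes> d i)"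
    (is "?l = ?r")
  proof -
    have "?l = (\<Oplus>j\<in>N - {i}. d i \<otimes> (kf (1 / (1 - hdiff i j)) \<otimes> gam j))"
      using i U by (intro finsum_rdistr) auto
    also have "\<dots> = ?r"
      by (rule finsum_cong'[OF refl _ tm]) (use i U in auto)
    finally show ?thesis .
  qed
  also have "\<dots> = ?S (\<lambda>j. - (1 / (hdiff i j + 1))) \<otimes> d i"
    using i U by (intro finsum_ldistr[symmetric]) auto
  finally have sum: "d i \<otimes> ?S (\<lambda>j. 1 / (1 - hdiff i j)) = ?S (\<lambda>j. - (1 / (hdiff i j + 1))) \<otimes> d i" .
  have "gam i \<otimes> d i = d i \<otimes> (x i \<otimes> d i)"
    unfolding gam_def using i by (simp add: m_assoc)
  also have "x i \<otimes> d i = gam i \<oplus> ?S (\<lambda>j. 1 / (1 - hdiff i j)) \<oplus> kf (-1)"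
  proof -
    have "?S (\<lambda>j. if j = i then 1 else 1 / (1 - hdiff i j)) = ?S (\<lambda>j. 1 / (1 - hdiff i j))"
      using U by (intro finsum_cong') auto
    then show ?thesis
      unfolding x_d_gamma_form[OF i] using i gamma_form_split[OF i, of "\<lambda>j. if j = i then 1 else 1 / (1 - hdiff i j)", OF U'(1)]
      by (simp add: kf_one)
  qed
  also have "d i \<otimes> \<dots> = d i \<otimes> gam i \<oplus> (?S (\<lambda>j. - (1 / (hdiff i j + 1))) \<oplus> kf (-1)) \<otimes> d i"
    using i S sum by (simp add: r_distr l_distr a_assoc kf_uminus kf_one r_minus l_minus)
  finally have eq: "gam i \<otimes> d i = d i \<otimes> gam i \<oplus> (?S (\<lambda>j. - (1 / (hdiff i j + 1))) \<oplus> kf (-1)) \<otimes> d i" .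
  \<comment> \<open>Adding the negatives of the last terms of \<open>eq\<close> isolates \<open>d i \<otimes> gam i\<close>.\<close>
  have canc: "(?S (\<lambda>j. - (1 / (hdiff i j + 1))) \<oplus> kf (-1)) \<oplus> (?S (\<lambda>j. 1 / (hdiff i j + 1)) \<oplus> kf 1) = \<zero>"
  proof -
    have "?S (\<lambda>j. - (1 / (hdiff i j + 1))) \<oplus> ?S (\<lambda>j. 1 / (hdiff i j + 1))
        = (\<Oplus>j\<in>N - {i}. kf (- (1 / (hdiff i j + 1))) \<otimes> gam j \<oplus> kf (1 / (hdiff i j + 1)) \<otimes> gam j)"
      using U by (intro finsum_addf[symmetric]) auto
    also have "\<dots> = (\<Oplus>j\<in>N - {i}. \<zero>)"
    proof (rule finsum_cong')
      fix j assume j: "j \<in> N - {i}"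
      then show "kf (- (1 / (hdiff i j + 1))) \<otimes> gam j \<oplus> kf (1 / (hdiff i j + 1)) \<otimes> gam j = \<zero>"
        using U(2)[OF j] by (simp add: kf_uminus l_minus l_neg)
    qed auto
    finally show ?thesis
      using S by (simp add: a_ac kf_uminus kf_one r_neg a_assoc[symmetric])
  qed
  have "?L = gam i \<oplus> (?S (\<lambda>j. 1 / (hdiff i j + 1)) \<oplus> kf 1)"
  proof -
    have "?S (\<lambda>j. if j = i then 1 else 1 / (hdiff i j + 1)) = ?S (\<lambda>j. 1 / (hdiff i j + 1))"
      using U by (intro finsum_cong') auto
    then show ?thesis
      using i S gamma_form_split[OF i, of "\<lambda>j. if j = i then 1 else 1 / (hdiff i j + 1)", OF U'(2)]
      by (simp add: kf_one a_assoc)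
  qed
  then have "?L \<otimes> d i = gam i \<otimes> d i \<oplus> (?S (\<lambda>j. 1 / (hdiff i j + 1)) \<oplus> kf 1) \<otimes> d i"
    using i S by (simp add: l_distr)
  also have "\<dots> = d i \<otimes> gam i \<oplus> ((?S (\<lambda>j. - (1 / (hdiff i j + 1))) \<oplus> kf (-1)) \<oplus> (?S (\<lambda>j. 1 / (hdiff i j + 1)) \<oplus> kf 1)) \<otimes> d i"
    unfolding eq using i S by (simp add: l_distr a_assoc)
  also have "\<dots> = d i \<otimes> gam i" unfolding canc using i by simp
  finally show ?thesis by simp
qed

end

section \<open>Centrality of the elements \<open>c k\<close>\<close>

lemma esymf_insert_if:
  assumes "finite S" "i \<notin> S"
  shows "esymf a (insert i S) k = esymf a S k + a i * (if k = 0 then 0 else esymf a S (k - 1))"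
  using assms by (cases k) (simp_all add: esymf_0 esymf_insert)

lemma fshift_esymf: "fshift l (esymf hh S k) = esymf (\<lambda>i. hh i + of_int (l i)) S k"
  by (simp add: hom_esymf[OF fshift.unital_hom_axioms])

lemma fshift_unit_shift_esymf_free:
  assumes "i \<notin> S"
  shows "fshift (unit_shift i t) (esymf hh S k) = (esymf hh S k :: 'k::idom hfrac)"
  unfolding fshift_esymf using assms by (intro esymf_cong) (auto simp: unit_shift_def)

context diff_relations
begin

text \<open>
  The coefficient \<open>e\<^bsub>k-1\<^esub>\<close> in the variables other than \<open>h\<^sub>j\<close> is the partial derivative of \<open>e\<^sub>k\<close>
  (\<open>pderivative_esym\<close>).
\<close>

definition c :: "nat \<Rightarrow> 'r" where
  "c k = gamma_form (\<lambda>j. esymf hh (N - {j}) (k - 1)) (- esymf hh N k)"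

lemma c_closed [simp]: "c k \<in> carrier R"
  by (simp add: c_def)

text \<open>
  The cases \<open>t = 1\<close> and \<open>t = -1\<close> are those of \<open>d i\<close> and \<open>x i\<close>. For \<open>j \<noteq> i\<close> put
  \<open>h = h\<^sub>i - h\<^sub>j\<close> and let \<open>G\<close>, \<open>F\<close> be the elementary symmetric functions of degrees \<open>k - 1\<close> and
  \<open>k - 2\<close> in the variables other than \<open>h\<^sub>i\<close>, \<open>h\<^sub>j\<close>. The coefficients of \<open>gam j\<close> agree because
  \<open>(G + h\<^sub>j F) t + (G + (h\<^sub>i + t) F) h = (G + h\<^sub>i F) (h + t)\<close>.
\<close>

lemma twisted_c:
  assumes i: "i \<in> N" and k: "k \<ge> 1" and t: "t = 1 \<or> t = -1" and g: "g \<in> carrier R"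
    and g_kf: "\<And>u. u \<in> U \<Longrightarrow> g \<otimes> kf u = kf (fshift (unit_shift i t) u) \<otimes> g"
    and g_gam: "\<And>j. j \<in> N \<Longrightarrow> j \<noteq> i \<Longrightarrow> g \<otimes> gam j = kf (hdiff i j / (hdiff i j + of_int t)) \<otimes> gam j \<otimes> g"
    and g_gam_i: "g \<otimes> gam i = gamma_form (\<lambda>j. if j = i then 1 else of_int t / (hdiff i j + of_int t)) (of_int t) \<otimes> g"
  shows "g \<otimes> c k = c k \<otimes> g"
proof -
  let ?s = "fshift (unit_shift i t)" and ?t = "of_int t :: 'k hfrac"
  let ?e = "\<lambda>j. esymf hh (N - {j}) (k - 1) :: 'k hfrac" and ?f = "esymf hh N k :: 'k hfrac"
  let ?u = "\<lambda>j. if j = i then ?s (?e i)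
    else ?s (?e i) * (?t / (hdiff i j + ?t)) + ?s (?e j) * (hdiff i j / (hdiff i j + ?t))"
  have tU: "?t \<in> U" "hdiff i j / (hdiff i j + ?t) \<in> U" "?t / (hdiff i j + ?t) \<in> U" if "j \<in> N" "j \<noteq> i" for j
    using t i that by (auto simp: U_divide)
  have tU': "?t \<in> U" using t by auto
  have "g \<otimes> c k = gamma_form ?u (?s (- ?f) + ?s (?e i) * ?t) \<otimes> g"
    unfolding c_def by (rule twisted_gamma_form[OF i g g_kf g_gam g_gam_i]) (use tU tU' in auto)
  moreover have "gamma_form ?u (?s (- ?f) + ?s (?e i) * ?t) = c k"
    unfolding c_def
  proof (rule gamma_form_cong[symmetric])
    fix j assume j: "j \<in> N"
    show "?e j = ?u j"
    proof (cases "j = i")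
      case False
      define S where "S = N - {i, j}"
      have S: "N - {j} = insert i S" "N - {i} = insert j S" "finite S" "i \<notin> S" "j \<notin> S"
        using i j False by (auto simp: S_def)
      \<comment> \<open>For \<open>k = 1\<close> the degree \<open>k - 2\<close> is negative, so that \<open>F\<close> is \<open>0\<close>; truncated subtraction would give \<open>1\<close>.\<close>
      define G F where "G = (esymf hh S (k - 1) :: 'k hfrac)"
        and "F = (if k - 1 = 0 then 0 else esymf hh S (k - 1 - 1) :: 'k hfrac)"
      have e: "?e j = G + hh i * F" "?e i = G + hh j * F" "?s (?e j) = G + (hh i + ?t) * F" "?s (?e i) = ?e i"
        unfolding S G_def F_def using S(3-5) False
        by (simp_all add: esymf_insert_if fshift_unit_shift_esymf_free)
      define h where "h = (hdiff i j :: 'k hfrac)"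
      have h: "h = hh i - hh j" "h + ?t \<noteq> 0"
        unfolding h_def using False hdiff_shift_nonzero[of i j t] by (simp_all add: hdiff_def)
      have "(a * (u / w) + b * (v / w)) * w = a * u + b * v" if "w \<noteq> 0" for a b u v w :: "'k hfrac"
        using that by (simp add: field_simps)
      then have "(?s (?e i) * (?t / (h + ?t)) + ?s (?e j) * (h / (h + ?t))) * (h + ?t)
          = ?s (?e i) * ?t + ?s (?e j) * h"
        using h(2) by blast
      also have "\<dots> = ?e j * (h + ?t)"
        unfolding e(3,4) unfolding e(1,2) h(1) by (simp add: algebra_simps)
      finally show ?thesis using h(2) False by (simp add: h_def)
    qed (simp add: fshift_unit_shift_esymf_free)
  next
    define S where "S = N - {i}"
    have S: "N = insert i S" "finite S" "i \<notin> S" using i by (auto simp: S_def)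
    have "?e i = esymf hh S (k - 1)" by (simp add: S_def)
    then show "- ?f = ?s (- ?f) + ?s (?e i) * ?t"
      using k S(2,3) unfolding S(1)
      by (simp add: esymf_insert_if fshift_unit_shift_esymf_free algebra_simps)
  qed simp
  ultimately show ?thesis by simp
qed

lemma x_c:
  assumes i: "i \<in> N" and k: "k \<ge> 1"
  shows "x i \<otimes> c k = c k \<otimes> x i"
proof (rule twisted_c[OF i k, of "-1"])
  have "of_int (-1) / (hdiff i j + of_int (-1)) = (1 / (1 - hdiff i j) :: 'k hfrac)" for j
    by (simp add: minus_divide_right)
  then show "x i \<otimes> gam i = gamma_form (\<lambda>j. if j = i then 1 else of_int (-1) / (hdiff i j + of_int (-1))) (of_int (-1)) \<otimes> x i"
    using x_gam_same[OF i] by (simp only: of_int_minus of_int_1)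
qed (use i in \<open>auto simp: x_kf x_gam\<close>)

lemma d_c:
  assumes i: "i \<in> N" and k: "k \<ge> 1"
  shows "d i \<otimes> c k = c k \<otimes> d i"
proof (rule twisted_c[OF i k, of 1])
  show "d i \<otimes> gam i = gamma_form (\<lambda>j. if j = i then 1 else of_int 1 / (hdiff i j + of_int 1)) (of_int 1) \<otimes> d i"
    using d_gam_same[OF i] by (simp only: of_int_1)
qed (use i in \<open>auto simp: d_kf d_gam\<close>)

lemma kf_gamma_form:
  assumes "w \<in> U" "\<And>j. j \<in> N \<Longrightarrow> u j \<in> U" "v \<in> U"
  shows "kf w \<otimes> gamma_form u v = gamma_form u v \<otimes> kf w"
proof -
  have "gamma_form u v \<otimes> kf w = (\<Oplus>j\<in>N. kf (u j) \<otimes> gam j \<otimes> kf w) \<oplus> kf v \<otimes> kf w"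
    using assms by (simp add: gamma_form_def l_distr Pi_def finsum_ldistr)
  also have "(\<Oplus>j\<in>N. kf (u j) \<otimes> gam j \<otimes> kf w) = (\<Oplus>j\<in>N. kf (w * u j) \<otimes> gam j)"
    using assms by (intro finsum_cong')
      (auto simp: m_assoc kf_gam[symmetric] kf_mult_assoc mult.commute[of w])
  also have "(\<Oplus>j\<in>N. kf (w * u j) \<otimes> gam j) \<oplus> kf v \<otimes> kf w = gamma_form (\<lambda>j. w * u j) (w * v)"
    using assms by (simp add: gamma_form_def kf_mult[symmetric] mult.commute)
  finally show ?thesis using assms by (simp add: gamma_form_smult)
qed

lemma kf_c: "u \<in> U \<Longrightarrow> kf u \<otimes> c k = c k \<otimes> kf u"
  by (simp add: c_def kf_gamma_form)

text \<open>
  The subring \<open>U[c\<^sub>1,\<dots>,c\<^sub>n]\<close>. It contains the constant \<open>-1\<close> through \<open>U\<close>, so closure under sums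
  and products is enough.
\<close>

inductive_set UC :: "'r set" where
  UC_kf: "u \<in> U \<Longrightarrow> kf u \<in> UC"
| UC_c: "k \<in> N \<Longrightarrow> c k \<in> UC"
| UC_add: "a \<in> UC \<Longrightarrow> b \<in> UC \<Longrightarrow> a \<oplus> b \<in> UC"
| UC_mult: "a \<in> UC \<Longrightarrow> b \<in> UC \<Longrightarrow> a \<otimes> b \<in> UC"

lemma UC_closed [simp]: "a \<in> UC \<Longrightarrow> a \<in> carrier R"
  by (induction rule: UC.induct) simp_all

lemma UC_finsum: "finite K \<Longrightarrow> (\<And>k. k \<in> K \<Longrightarrow> f k \<in> UC) \<Longrightarrow> finsum R f K \<in> UC"
proof (induction K rule: finite_induct)
  case empty
  then show ?case using UC_kf[of 0] by (simp add: kf_zero)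
next
  case (insert k K)
  then show ?case by (subst finsum_insert) (auto intro: UC_add)
qed

text \<open>
  At \<open>s = - h\<^sub>j\<close> all terms of the interpolation formula for \<open>\<chi>(s)\<close> vanish except the one with
  \<open>gam j\<close>, and its coefficient \<open>\<Prod>i\<noteq>j. h\<^sub>i - h\<^sub>j\<close> is invertible in \<open>U\<close>.
\<close>

lemma gam_UC:
  assumes j: "j \<in> N"
  shows "gam j \<in> UC"
proof -
  define s where "s = - (hh j :: 'k hfrac)"
  define P where "P = (\<Prod>i\<in>N - {j}. hdiff i j :: 'k hfrac)"
  have sU: "s \<in> U" using j by (simp add: s_def)
  have PU: "P \<in> U" "1 / P \<in> U"
  proof -
    have "(\<Prod>i\<in>N - {j}. 1 / hdiff i j :: 'k hfrac) \<in> U"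
      using j by (intro U_prod U_divide) auto
    then show "1 / P \<in> U" by (simp add: P_def prod_dividef)
  qed (use j in \<open>auto simp: P_def intro!: U_prod\<close>)
  have P0: "P \<noteq> 0" by (simp add: P_def)
  have card: "card N = n" by (simp add: N_eq)
  have u: "(\<Sum>k\<in>N. s ^ (n - k) * esymf hh (N - {l}) (k - 1)) = (if l = j then P else 0)" if "l \<in> N" for l
  proof -
    have "(\<Sum>k\<in>N. s ^ (n - k) * esymf hh (N - {l}) (k - 1)) = (\<Prod>i\<in>N - {l}. s + hh i)"
      unfolding prod_add_esymf_remove[OF finite_N card that] unfolding N_eq by (simp add: mult.commute)
    also have "\<dots> = (if l = j then P else 0)"
      using j that by (auto simp: s_def P_def hdiff_def intro!: prod_zero)
    finally show ?thesis .
  qed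
  have v: "(\<Sum>k\<in>N. s ^ (n - k) * - esymf hh N k) = s ^ n"
  proof -
    have "(\<Prod>i\<in>N. s + hh i) = 0" using j by (intro prod_zero) (auto simp: s_def)
    then show ?thesis
      unfolding prod_add_esymf_monic[OF finite_N card]
      by (simp add: N_eq mult.commute sum_negf minus_unique add_eq_0_iff)
  qed
  have "(\<Oplus>k\<in>N. kf (s ^ (n - k)) \<otimes> c k) = gamma_form (\<lambda>l. if l = j then P else 0) (s ^ n)"
  proof -
    have "(\<Oplus>k\<in>N. kf (s ^ (n - k)) \<otimes> c k)
        = gamma_form (\<lambda>l. \<Sum>k\<in>N. s ^ (n - k) * esymf hh (N - {l}) (k - 1)) (\<Sum>k\<in>N. s ^ (n - k) * - esymf hh N k)"
      unfolding c_def using sU by (intro finsum_gamma_form) auto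
    also have "\<dots> = gamma_form (\<lambda>l. if l = j then P else 0) (s ^ n)"
      by (rule gamma_form_cong[OF u _ v]) (use sU in \<open>auto intro!: U_sum U_mult\<close>)
    finally show ?thesis .
  qed
  also have "\<dots> = kf P \<otimes> gam j \<oplus> kf (s ^ n)"
  proof -
    have "(\<Oplus>l\<in>N - {j}. kf (if l = j then P else 0) \<otimes> gam l) = (\<Oplus>l\<in>N - {j}. \<zero>)"
      by (rule finsum_cong') (auto simp: kf_zero)
    then show ?thesis
      using j PU sU gamma_form_split[OF j, of "\<lambda>l. if l = j then P else 0" "s ^ n"] by simp
  qed
  finally have "(\<Oplus>k\<in>N. kf (s ^ (n - k)) \<otimes> c k) \<oplus> kf (- (s ^ n)) = kf P \<otimes> gam j"
    using j PU sU by (simp add: kf_uminus a_assoc r_neg)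
  then have "kf (1 / P) \<otimes> ((\<Oplus>k\<in>N. kf (s ^ (n - k)) \<otimes> c k) \<oplus> kf (- (s ^ n))) = gam j"
    using j PU P0 by (simp add: kf_mult_assoc kf_one)
  moreover have "kf (1 / P) \<otimes> ((\<Oplus>k\<in>N. kf (s ^ (n - k)) \<otimes> c k) \<oplus> kf (- (s ^ n))) \<in> UC"
    using PU sU by (intro UC_mult UC_add UC_finsum UC_kf UC_c) auto
  ultimately show ?thesis by simp
qed

text \<open>
  Elements past which coefficients from \<open>U[c]\<close> can be moved to the left.
\<close>

definition normalizing :: "'r \<Rightarrow> bool" where
  "normalizing g \<longleftrightarrow> g \<in> carrier R \<and> (\<forall>a\<in>UC. \<exists>a'\<in>UC. g \<otimes> a = a' \<otimes> g)"

lemma normalizingD: "normalizing g \<Longrightarrow> a \<in> UC \<Longrightarrow> \<exists>a'\<in>UC. g \<otimes> a = a' \<otimes> g"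
  by (simp add: normalizing_def)

lemma normalizing_closed: "normalizing g \<Longrightarrow> g \<in> carrier R"
  by (simp add: normalizing_def)

lemma normalizing_generator:
  assumes g: "g \<in> carrier R" and "\<And>u. u \<in> U \<Longrightarrow> g \<otimes> kf u = kf (fshift l u) \<otimes> g"
    and "\<And>k. k \<in> N \<Longrightarrow> g \<otimes> c k = c k \<otimes> g"
  shows "normalizing g"
proof -
  have "\<exists>a'\<in>UC. g \<otimes> a = a' \<otimes> g" if "a \<in> UC" for a
    using that
  proof induction
    case (UC_kf u)
    then show ?case using assms(2) by (meson UC.UC_kf U_fshift)
  next
    case (UC_c k)
    then show ?case using assms(3) by (meson UC.UC_c)
  next
    case (UC_add a b)
    then obtain a' b' where ab: "a' \<in> UC" "b' \<in> UC" "g \<otimes> a = a' \<otimes> g" "g \<otimes> b = b' \<otimes> g" by blast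
    then have "g \<otimes> (a \<oplus> b) = (a' \<oplus> b') \<otimes> g"
      using g UC_add by (simp add: r_distr l_distr)
    then show ?case using ab UC.UC_add by blast
  next
    case (UC_mult a b)
    then obtain a' b' where ab: "a' \<in> UC" "b' \<in> UC" "g \<otimes> a = a' \<otimes> g" "g \<otimes> b = b' \<otimes> g" by blast
    have "g \<otimes> (a \<otimes> b) = (g \<otimes> a) \<otimes> b" using g UC_mult by (simp add: m_assoc)
    also have "\<dots> = a' \<otimes> (g \<otimes> b)" unfolding ab(3) using g UC_mult ab by (simp add: m_assoc)
    also have "\<dots> = (a' \<otimes> b') \<otimes> g" unfolding ab(4) using g ab by (simp add: m_assoc)
    finally show ?case using ab UC.UC_mult by blast
  qed
  then show ?thesis using g by (simp add: normalizing_def)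
qed

lemma N_ge_1: "k \<in> N \<Longrightarrow> k \<ge> 1"
  by (simp add: N_eq)

lemma normalizing_x: "i \<in> N \<Longrightarrow> normalizing (x i)"
  by (rule normalizing_generator[of _ "unit_shift i (-1)"]) (auto simp: x_kf x_c[OF _ N_ge_1])

lemma normalizing_d: "i \<in> N \<Longrightarrow> normalizing (d i)"
  by (rule normalizing_generator[of _ "unit_shift i 1"]) (auto simp: d_kf d_c[OF _ N_ge_1])

lemma normalizing_one: "normalizing \<one>"
  unfolding normalizing_def by (auto intro!: bexI)

lemma normalizing_mult:
  assumes "normalizing g" "normalizing h"
  shows "normalizing (g \<otimes> h)"
proof -
  have gh: "g \<in> carrier R" "h \<in> carrier R" using assms normalizing_closed by auto
  have "\<exists>a'\<in>UC. g \<otimes> h \<otimes> a = a' \<otimes> (g \<otimes> h)" if a: "a \<in> UC" for a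
  proof -
    obtain b where b: "b \<in> UC" "h \<otimes> a = b \<otimes> h" using normalizingD[OF assms(2) a] by blast
    obtain e where e: "e \<in> UC" "g \<otimes> b = e \<otimes> g" using normalizingD[OF assms(1) b(1)] by blast
    have "g \<otimes> h \<otimes> a = g \<otimes> (h \<otimes> a)" using gh a by (simp add: m_assoc)
    also have "\<dots> = (g \<otimes> b) \<otimes> h" unfolding b(2) using gh b by (simp add: m_assoc)
    also have "\<dots> = e \<otimes> (g \<otimes> h)" unfolding e(2) using gh e by (simp add: m_assoc)
    finally show ?thesis using e by blast
  qed
  then show ?thesis using gh by (simp add: normalizing_def)
qed

lemma normalizing_pow: "normalizing g \<Longrightarrow> normalizing (g [^] (k::nat))"
  by (induction k) (simp_all add: normalizing_one normalizing_mult)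

text \<open>
  Commutation up to a factor from \<open>U[c]\<close>. Unlike explicit factors, this survives taking powers with
  no bookkeeping, and a spanning statement needs nothing more.
\<close>

definition quasi_commute :: "'r \<Rightarrow> 'r \<Rightarrow> bool" where
  "quasi_commute g h \<longleftrightarrow> (\<exists>a\<in>UC. g \<otimes> h = a \<otimes> (h \<otimes> g))"

lemma quasi_commute_pow:
  assumes g: "g \<in> carrier R" and h: "normalizing h" and gh: "quasi_commute g h"
  shows "quasi_commute g (h [^] (k::nat))"
proof (induction k)
  case 0
  then show ?case using g UC_kf[of 1] unfolding quasi_commute_def by (intro bexI[of _ \<one>]) (auto simp: kf_one)
next
  case (Suc k)
  have hc: "h \<in> carrier R" using h by (rule normalizing_closed)
  obtain a where a: "a \<in> UC" "g \<otimes> h [^] k = a \<otimes> (h [^] k \<otimes> g)"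
    using Suc unfolding quasi_commute_def by blast
  obtain b where b: "b \<in> UC" "g \<otimes> h = b \<otimes> (h \<otimes> g)"
    using gh unfolding quasi_commute_def by blast
  obtain e where e: "e \<in> UC" "h [^] k \<otimes> b = e \<otimes> h [^] k"
    using normalizingD[OF normalizing_pow[OF h] b(1)] by blast
  have "g \<otimes> h [^] Suc k = (g \<otimes> h [^] k) \<otimes> h" using g hc by (simp add: m_assoc)
  also have "\<dots> = a \<otimes> (h [^] k \<otimes> (g \<otimes> h))" unfolding a(2) using g hc a by (simp add: m_assoc)
  also have "\<dots> = a \<otimes> ((h [^] k \<otimes> b) \<otimes> (h \<otimes> g))" unfolding b(2) using g hc b by (simp add: m_assoc)
  also have "\<dots> = (a \<otimes> e) \<otimes> (h [^] Suc k \<otimes> g)"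
    unfolding e(2) using g hc a e by (simp add: m_assoc)
  finally show ?case using a e UC_mult unfolding quasi_commute_def by blast
qed

lemma quasi_commute_generators:
  assumes "i \<in> N" "j \<in> N" "i \<noteq> j" "g \<in> {x i, d i}" "h \<in> {x j, d j}"
  shows "quasi_commute g h"
proof -
  have xx: "quasi_commute (x i) (x j)"
    unfolding quasi_commute_def x_swap[OF assms(1-3)]
    by (rule bexI, rule refl) (use assms in \<open>auto intro!: UC_kf U_divide\<close>)
  have dd: "quasi_commute (d i) (d j)"
    unfolding quasi_commute_def d_swap[OF assms(1-3)]
    by (rule bexI, rule refl) (use assms in \<open>auto intro!: UC_kf U_divide\<close>)
  have xd: "quasi_commute (x i) (d j)"
    unfolding quasi_commute_def x_d_swap[OF assms(1-3)]
    by (rule bexI, rule refl) (use assms in \<open>auto intro!: UC_kf\<close>)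
  have dx: "quasi_commute (d i) (x j)"
    unfolding quasi_commute_def d_x_swap[OF assms(2,1) assms(3)[symmetric]]
    by (rule bexI, rule refl) (use assms in \<open>auto intro!: UC_kf\<close>)
  show ?thesis using assms(4,5) xx dd xd dx by auto
qed

end

section \<open>A spanning set over the coefficient ring\<close>

context diff_relations
begin

lemma UC_one: "\<one> \<in> UC"
  using UC_kf[of 1] by (simp add: kf_one)

lemma UC_pow: "a \<in> UC \<Longrightarrow> a [^] (k::nat) \<in> UC"
  by (induction k) (simp_all add: UC_one UC_mult)

lemma gamma_form_UC:
  assumes "\<And>j. j \<in> N \<Longrightarrow> u j \<in> U" "v \<in> U"
  shows "gamma_form u v \<in> UC"
  unfolding gamma_form_def using assms by (intro UC_add UC_finsum UC_mult UC_kf gam_UC) auto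

text \<open>
  The \<open>c k\<close> commute with \<open>d j\<close> and \<open>x j\<close>, hence with \<open>gam j\<close> and with every combination of the
  \<open>gam j\<close>; the other \<open>c l\<close> are such combinations.
\<close>

lemma c_UC_commute:
  assumes k: "k \<in> N" and a: "a \<in> UC"
  shows "c k \<otimes> a = a \<otimes> c k"
proof -
  have gam: "c k \<otimes> gam j = gam j \<otimes> c k" if j: "j \<in> N" for j
  proof -
    have "gam j \<otimes> c k = d j \<otimes> (x j \<otimes> c k)" using j by (simp add: gam_def m_assoc)
    also have "\<dots> = (d j \<otimes> c k) \<otimes> x j" using j x_c[OF j N_ge_1[OF k]] by (simp add: m_assoc)
    also have "\<dots> = c k \<otimes> gam j" using j d_c[OF j N_ge_1[OF k]] by (simp add: gam_def m_assoc)
    finally show ?thesis by simp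
  qed
  have "c k \<otimes> gamma_form u v = gamma_form u v \<otimes> c k" if u: "\<And>j. j \<in> N \<Longrightarrow> u j \<in> U" "v \<in> U" for u v
  proof -
    have tm: "c k \<otimes> (kf (u j) \<otimes> gam j) = (kf (u j) \<otimes> gam j) \<otimes> c k" if j: "j \<in> N" for j
    proof -
      have "c k \<otimes> (kf (u j) \<otimes> gam j) = (kf (u j) \<otimes> c k) \<otimes> gam j"
        using j u by (simp add: m_assoc[symmetric] kf_c)
      also have "\<dots> = (kf (u j) \<otimes> gam j) \<otimes> c k"
        using j u by (simp add: m_assoc gam)
      finally show ?thesis .
    qed
    have "c k \<otimes> (\<Oplus>j\<in>N. kf (u j) \<otimes> gam j) = (\<Oplus>j\<in>N. c k \<otimes> (kf (u j) \<otimes> gam j))"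
      using u by (intro finsum_rdistr) auto
    also have "\<dots> = (\<Oplus>j\<in>N. (kf (u j) \<otimes> gam j) \<otimes> c k)"
      by (rule finsum_cong'[OF refl _ tm]) (use u in auto)
    also have "\<dots> = (\<Oplus>j\<in>N. kf (u j) \<otimes> gam j) \<otimes> c k"
      using u by (intro finsum_ldistr[symmetric]) auto
    finally show ?thesis
      unfolding gamma_form_def using u by (simp add: r_distr l_distr kf_c Pi_def)
  qed
  then have cc: "c k \<otimes> c l = c l \<otimes> c k" for l unfolding c_def[of l] by simp
  show ?thesis using a
  proof induction
    case (UC_kf u)
    then show ?case by (simp add: kf_c)
  next
    case (UC_c l)
    then show ?case by (rule_tac cc)
  next
    case (UC_add a b)
    then show ?case by (simp add: r_distr l_distr)
  next
    case (UC_mult a b)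
    have "c k \<otimes> (a \<otimes> b) = (c k \<otimes> a) \<otimes> b" using UC_mult.hyps by (simp add: m_assoc)
    also have "\<dots> = a \<otimes> (c k \<otimes> b)" unfolding UC_mult.IH(1) using UC_mult.hyps by (simp add: m_assoc)
    also have "\<dots> = a \<otimes> b \<otimes> c k" unfolding UC_mult.IH(2) using UC_mult.hyps by (simp add: m_assoc)
    finally show ?case .
  qed
qed

text \<open>
  The two families of generators combined into one: \<open>d j\<close> plays the part of an inverse of \<open>x j\<close> up
  to factors from \<open>U[c]\<close>.
\<close>

definition signed_power :: "nat \<Rightarrow> int \<Rightarrow> 'r" where
  "signed_power j k = (if k \<ge> 0 then x j [^] nat k else d j [^] nat (- k))"

lemma signed_power_int: "signed_power j (int m) = x j [^] m"
  by (simp add: signed_power_def)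

lemma signed_power_neg_int: "signed_power j (- int m) = d j [^] m"
  by (cases m) (simp_all add: signed_power_def del: of_nat_Suc)

lemma signed_power_closed [simp]: "j \<in> N \<Longrightarrow> signed_power j k \<in> carrier R"
  by (cases k rule: int_cases2) (simp_all add: signed_power_int signed_power_neg_int)

lemma normalizing_signed_power: "j \<in> N \<Longrightarrow> normalizing (signed_power j k)"
  by (cases k rule: int_cases2)
    (simp_all add: signed_power_int signed_power_neg_int normalizing_pow normalizing_x normalizing_d)

lemma quasi_commute_signed_power:
  assumes "i \<in> N" "j \<in> N" "i \<noteq> j" "g \<in> {x i, d i}"
  shows "quasi_commute g (signed_power j k)"
proof -
  have "g \<in> carrier R" using assms by auto
  then show ?thesis
    using quasi_commute_generators[OF assms] normalizing_x[OF assms(2)] normalizing_d[OF assms(2)]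
    by (cases k rule: int_cases2) (simp_all add: signed_power_int signed_power_neg_int quasi_commute_pow)
qed

text \<open>
  On negative exponents \<open>x i\<close> meets a \<open>d i\<close>, and \<open>x i \<otimes> d i\<close> lies in \<open>U[c]\<close> as a combination of
  the \<open>gam j\<close>.
\<close>

lemma x_signed_power:
  assumes i: "i \<in> N"
  shows "\<exists>a\<in>UC. x i \<otimes> signed_power i k = a \<otimes> signed_power i (k + 1)"
proof -
  have pos: "\<exists>a\<in>UC. x i \<otimes> signed_power i (int m) = a \<otimes> signed_power i (int m + 1)" for m
  proof
    have "signed_power i (int m + 1) = x i \<otimes> signed_power i (int m)"
      using i nat_pow_Suc2[of "x i" m] signed_power_int[of i "Suc m"] by (simp add: signed_power_int add.commute)
    then show "x i \<otimes> signed_power i (int m) = \<one> \<otimes> signed_power i (int m + 1)" using i by simp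
  qed (rule UC_one)
  have neg: "\<exists>a\<in>UC. x i \<otimes> signed_power i (- int (Suc m)) = a \<otimes> signed_power i (- int m)" for m
  proof
    show "x i \<otimes> signed_power i (- int (Suc m)) = (x i \<otimes> d i) \<otimes> signed_power i (- int m)"
      using i nat_pow_Suc2[of "d i" m] by (simp add: signed_power_neg_int m_assoc del: nat_pow_Suc of_nat_Suc)
    show "x i \<otimes> d i \<in> UC"
      unfolding x_d_gamma_form[OF i] using i by (intro gamma_form_UC) (auto intro: U_divide)
  qed
  show ?thesis
  proof (cases "k \<ge> 0")
    case True
    then show ?thesis using pos[of "nat k"] by simp
  next
    case False
    then have "k = - int (Suc (nat (- k) - 1))" "k + 1 = - int (nat (- k) - 1)" by auto
    then show ?thesis using neg[of "nat (- k) - 1"] by metis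
  qed
qed

lemma d_signed_power:
  assumes i: "i \<in> N"
  shows "\<exists>a\<in>UC. d i \<otimes> signed_power i k = a \<otimes> signed_power i (k - 1)"
proof -
  have neg: "\<exists>a\<in>UC. d i \<otimes> signed_power i (- int m) = a \<otimes> signed_power i (- int (Suc m))" for m
  proof
    show "d i \<otimes> signed_power i (- int m) = \<one> \<otimes> signed_power i (- int (Suc m))"
      using i nat_pow_Suc2[of "d i" m] by (simp add: signed_power_neg_int del: nat_pow_Suc of_nat_Suc)
  qed (rule UC_one)
  have pos: "\<exists>a\<in>UC. d i \<otimes> signed_power i (int (Suc m)) = a \<otimes> signed_power i (int m)" for m
  proof
    show "d i \<otimes> signed_power i (int (Suc m)) = gam i \<otimes> signed_power i (int m)"
      using i nat_pow_Suc2[of "x i" m]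
      by (simp add: signed_power_int gam_def m_assoc del: nat_pow_Suc of_nat_Suc)
  qed (rule gam_UC[OF i])
  show ?thesis
  proof (cases "k > 0")
    case True
    then have "k = int (Suc (nat k - 1))" "k - 1 = int (nat k - 1)" by auto
    then show ?thesis using pos[of "nat k - 1"] by metis
  next
    case False
    then have "k = - int (nat (- k))" "k - 1 = - int (Suc (nat (- k)))" by auto
    then show ?thesis using neg[of "nat (- k)"] by metis
  qed
qed

text \<open>
  The ordered product of the signed powers; the list of indices is explicit so that proofs can
  proceed by induction along it.
\<close>

definition weight_monomial :: "(nat \<Rightarrow> int) \<Rightarrow> nat list \<Rightarrow> 'r" where
  "weight_monomial w js = foldr (\<lambda>j b. signed_power j (w j) \<otimes> b) js \<one>"

lemma weight_monomial_Nil [simp]: "weight_monomial w [] = \<one>"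
  and weight_monomial_Cons [simp]: "weight_monomial w (j # js) = signed_power j (w j) \<otimes> weight_monomial w js"
  by (simp_all add: weight_monomial_def)

lemma weight_monomial_closed [simp]: "set js \<subseteq> N \<Longrightarrow> weight_monomial w js \<in> carrier R"
  by (induction js) simp_all

lemma weight_monomial_cong: "(\<And>j. j \<in> set js \<Longrightarrow> w j = w' j) \<Longrightarrow> weight_monomial w js = weight_monomial w' js"
  by (induction js) simp_all

text \<open>
  The generator is moved to the factor with its own index, where it changes the exponent by \<open>e\<close>
  (\<open>1\<close> or \<open>-1\<close>); the coefficients collected on the way are moved back to the left.
\<close>

lemma generator_weight_monomial:
  assumes i: "i \<in> N" and g: "g \<in> {x i, d i}"
    and step: "\<And>k. \<exists>a\<in>UC. g \<otimes> signed_power i k = a \<otimes> signed_power i (k + e)"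
    and js: "distinct js" "set js \<subseteq> N" "i \<in> set js"
  shows "\<exists>a\<in>UC. g \<otimes> weight_monomial w js = a \<otimes> weight_monomial (w(i := w i + e)) js"
  using js
proof (induction js)
  case (Cons j js)
  have gc: "g \<in> carrier R" using g i by auto
  have c: "j \<in> N" "set js \<subseteq> N" using Cons.prems by auto
  show ?case
  proof (cases "j = i")
    case True
    obtain a where a: "a \<in> UC" "g \<otimes> signed_power i (w i) = a \<otimes> signed_power i (w i + e)" using step by blast
    have "g \<otimes> weight_monomial w (j # js) = (g \<otimes> signed_power i (w i)) \<otimes> weight_monomial w js"
      using True gc c by (simp add: m_assoc)
    also have "\<dots> = a \<otimes> (signed_power i (w i + e) \<otimes> weight_monomial w js)"
      unfolding a(2) using a(1) i c by (simp add: m_assoc)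
    also have "weight_monomial w js = weight_monomial (w(i := w i + e)) js"
      using Cons.prems True by (intro weight_monomial_cong) auto
    finally show ?thesis using a(1) unfolding True weight_monomial_Cons fun_upd_same by blast
  next
    case False
    \<comment> \<open>The factor \<open>b\<close> comes from exchanging \<open>g\<close> with the first factor, \<open>a\<close> from the rest of the list; \<open>a\<close> is then moved past the first factor and becomes \<open>a'\<close>.\<close>
    obtain a where a: "a \<in> UC" "g \<otimes> weight_monomial w js = a \<otimes> weight_monomial (w(i := w i + e)) js"
    proof -
      have "distinct js" "i \<in> set js" using Cons.prems False by auto
      then show ?thesis using Cons.IH c(2) that by blast
    qed
    have "quasi_commute g (signed_power j (w j))"
      using quasi_commute_signed_power[OF i c(1) False[symmetric] g] .
    then obtain b where b: "b \<in> UC" "g \<otimes> signed_power j (w j) = b \<otimes> (signed_power j (w j) \<otimes> g)"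
      unfolding quasi_commute_def by blast
    obtain a' where a': "a' \<in> UC" "signed_power j (w j) \<otimes> a = a' \<otimes> signed_power j (w j)"
      using normalizingD[OF normalizing_signed_power[OF c(1)] a(1)] by blast
    let ?m = "weight_monomial (w(i := w i + e)) js"
    have "g \<otimes> weight_monomial w (j # js) = (g \<otimes> signed_power j (w j)) \<otimes> weight_monomial w js"
      using gc c by (simp add: m_assoc)
    also have "\<dots> = b \<otimes> (signed_power j (w j) \<otimes> (g \<otimes> weight_monomial w js))"
      unfolding b(2) using b(1) gc c by (simp add: m_assoc)
    also have "\<dots> = b \<otimes> ((signed_power j (w j) \<otimes> a) \<otimes> ?m)"
      unfolding a(2) using a(1) b(1) c by (simp add: m_assoc)
    also have "\<dots> = (b \<otimes> a') \<otimes> weight_monomial (w(i := w i + e)) (j # js)"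
      unfolding a'(2) using a'(1) b(1) c False by (simp add: m_assoc)
    finally show ?thesis using b(1) a'(1) UC_mult by blast
  qed
qed simp

text \<open>
  The monomial \<open>c^\<gamma>\<close>, as an explicit product over a list of indices.
\<close>

definition cmon :: "(nat \<Rightarrow>\<^sub>0 nat) \<Rightarrow> nat list \<Rightarrow> 'r" where
  "cmon \<gamma> ks = foldr (\<lambda>k b. c k [^] lookup \<gamma> k \<otimes> b) ks \<one>"

lemma cmon_Nil [simp]: "cmon \<gamma> [] = \<one>"
  and cmon_Cons [simp]: "cmon \<gamma> (k # ks) = c k [^] lookup \<gamma> k \<otimes> cmon \<gamma> ks"
  by (simp_all add: cmon_def)

lemma cmon_UC: "set ks \<subseteq> N \<Longrightarrow> cmon \<gamma> ks \<in> UC"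
  by (induction ks) (auto intro!: UC_one UC_mult UC_pow UC_c)

lemma cmon_cong: "(\<And>k. k \<in> set ks \<Longrightarrow> lookup \<gamma> k = lookup \<delta> k) \<Longrightarrow> cmon \<gamma> ks = cmon \<delta> ks"
  by (induction ks) simp_all

lemma c_cmon:
  assumes "distinct ks" "set ks \<subseteq> N" "k \<in> set ks"
  shows "c k \<otimes> cmon \<gamma> ks = cmon (\<gamma> + single k 1) ks"
  using assms
proof (induction ks)
  case (Cons l ks)
  have cA: "cmon \<gamma> ks \<in> UC" using Cons.prems by (intro cmon_UC) auto
  show ?case
  proof (cases "l = k")
    case True
    have "cmon (\<gamma> + single k 1) ks = cmon \<gamma> ks"
      using Cons.prems True by (intro cmon_cong) (auto simp: lookup_add lookup_single when_def)
    then show ?thesis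
      using True cA nat_pow_Suc2[of "c k" "lookup \<gamma> k"]
      by (simp add: lookup_add m_assoc[symmetric] del: nat_pow_Suc)
  next
    case False
    let ?p = "c l [^] lookup \<gamma> l"
    have p: "?p \<in> UC" using Cons.prems by (auto intro!: UC_pow UC_c)
    have "c k \<otimes> cmon \<gamma> (l # ks) = (c k \<otimes> ?p) \<otimes> cmon \<gamma> ks"
      using cA by (simp add: m_assoc)
    also have "c k \<otimes> ?p = ?p \<otimes> c k" using c_UC_commute[OF _ p, of k] Cons.prems by auto
    also have "?p \<otimes> c k \<otimes> cmon \<gamma> ks = ?p \<otimes> (c k \<otimes> cmon \<gamma> ks)"
      using cA by (simp add: m_assoc)
    finally show ?thesis using Cons False by (auto simp: lookup_add lookup_single)
  qed
qed simp

definition vars :: "nat list" where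
  "vars = [1..<Suc n]"

lemma set_vars [simp]: "set vars = N"
  by (auto simp: vars_def N_eq)

lemma distinct_vars [simp]: "distinct vars"
  by (simp add: vars_def)

text \<open>
  A basis element \<open>c^\<gamma> m\<^sub>w\<close> has as index the pair \<open>(w, \<gamma>)\<close>. The weight \<open>w\<close> is a function on all
  natural numbers that vanishes outside \<open>N\<close>, which makes it unique.
\<close>

definition basis_index :: "((nat \<Rightarrow> int) \<times> (nat \<Rightarrow>\<^sub>0 nat)) set" where
  "basis_index = {b. (\<forall>i. i \<notin> N \<longrightarrow> fst b i = 0) \<and> keys (snd b) \<subseteq> N}"

definition basis :: "(nat \<Rightarrow> int) \<times> (nat \<Rightarrow>\<^sub>0 nat) \<Rightarrow> 'r" where
  "basis b = cmon (snd b) vars \<otimes> weight_monomial (fst b) vars"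

lemma basis_closed [simp]: "basis b \<in> carrier R"
  unfolding basis_def using cmon_UC[of vars "snd b"] weight_monomial_closed[of vars "fst b"]
  by simp

definition admissible :: "((nat \<Rightarrow> int) \<times> (nat \<Rightarrow>\<^sub>0 nat) \<Rightarrow>\<^sub>0 'k hfrac) \<Rightarrow> bool" where
  "admissible F \<longleftrightarrow> keys F \<subseteq> basis_index \<and> (\<forall>b. lookup F b \<in> U)"

text \<open>
  The coefficients are kept as a finitely supported function \<open>F\<close>, since the determination of the
  center argues about the support and the coefficients of a given element.
\<close>

definition combination :: "((nat \<Rightarrow> int) \<times> (nat \<Rightarrow>\<^sub>0 nat) \<Rightarrow>\<^sub>0 'k hfrac) \<Rightarrow> 'r" where
  "combination F = (\<Oplus>b\<in>keys F. kf (lookup F b) \<otimes> basis b)"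

lemma combination_superset:
  assumes "admissible F" "finite K" "keys F \<subseteq> K"
  shows "combination F = (\<Oplus>b\<in>K. kf (lookup F b) \<otimes> basis b)"
  unfolding combination_def
proof (rule add.finprod_mono_neutral_cong_left[OF assms(2,3)])
  show "kf (lookup F b) \<otimes> basis b = \<zero>" if "b \<in> K - keys F" for b
    using that by (simp add: in_keys_iff kf_zero)
qed (use assms in \<open>auto simp: admissible_def\<close>)

lemma combination_closed [simp]: "admissible F \<Longrightarrow> combination F \<in> carrier R"
  unfolding combination_def admissible_def by (intro finsum_closed) auto

lemma combination_add:
  assumes "admissible F" "admissible G"
  shows "admissible (F + G)" "combination (F + G) = combination F \<oplus> combination G"
proof -
  let ?K = "keys F \<union> keys G"
  show ok: "admissible (F + G)"
    using assms Poly_Mapping.keys_add[of F G] unfolding admissible_def by (auto simp: lookup_add)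
  have U: "lookup F b \<in> U" "lookup G b \<in> U" for b
    using assms unfolding admissible_def by blast+
  have "combination (F + G) = (\<Oplus>b\<in>?K. kf (lookup (F + G) b) \<otimes> basis b)"
    using Poly_Mapping.keys_add[of F G] by (intro combination_superset[OF ok]) auto
  also have "\<dots> = (\<Oplus>b\<in>?K. kf (lookup F b) \<otimes> basis b \<oplus> kf (lookup G b) \<otimes> basis b)"
    using U by (intro finsum_cong') (auto simp: lookup_add kf_add l_distr)
  also have "\<dots> = combination F \<oplus> combination G"
    using U by (simp add: combination_superset[OF assms(1), of ?K] combination_superset[OF assms(2), of ?K] finsum_addf Pi_def)
  finally show "combination (F + G) = combination F \<oplus> combination G" .
qed

definition span :: "'r set" where
  "span = combination ` {F. admissible F}"

lemma span_closed [simp]: "z \<in> span \<Longrightarrow> z \<in> carrier R"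
  by (auto simp: span_def)

lemma span_add: "z \<in> span \<Longrightarrow> z' \<in> span \<Longrightarrow> z \<oplus> z' \<in> span"
  unfolding span_def using combination_add by (smt (verit) image_iff mem_Collect_eq)

lemma span_basis:
  assumes "u \<in> U" "b \<in> basis_index"
  shows "kf u \<otimes> basis b \<in> span"
proof -
  have ok: "admissible (single b u)"
    using assms by (auto simp: admissible_def lookup_single when_def)
  have "combination (single b u) = kf u \<otimes> basis b"
    using combination_superset[OF ok, of "{b}"] assms by simp
  then show ?thesis using ok unfolding span_def by (metis image_eqI mem_Collect_eq)
qed

lemma span_zero: "\<zero> \<in> span"
  using span_basis[of 0 "(\<lambda>_. 0, 0)"] by (simp add: kf_zero basis_index_def)

lemma span_finsum: "finite K \<Longrightarrow> (\<And>k. k \<in> K \<Longrightarrow> f k \<in> span) \<Longrightarrow> finsum R f K \<in> span"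
proof (induction K rule: finite_induct)
  case (insert k K)
  then show ?case by (subst finsum_insert) (auto intro: span_add)
qed (simp add: span_zero)

lemma span_left_mult:
  assumes t: "t \<in> carrier R" "\<And>u b. u \<in> U \<Longrightarrow> b \<in> basis_index \<Longrightarrow> t \<otimes> (kf u \<otimes> basis b) \<in> span" and z: "z \<in> span"
  shows "t \<otimes> z \<in> span"
proof -
  obtain F where F: "admissible F" "z = combination F" using z by (auto simp: span_def)
  have "t \<otimes> z = (\<Oplus>b\<in>keys F. t \<otimes> (kf (lookup F b) \<otimes> basis b))"
    unfolding F(2) combination_def using t F(1) by (intro finsum_rdistr) (auto simp: admissible_def)
  then show ?thesis
    using F(1) by (auto intro!: span_finsum t(2) simp: admissible_def)
qed

text \<open>
  The factor \<open>c k\<close> is central in \<open>U[c]\<close> and raises an exponent of \<open>c^\<gamma>\<close>. So the span is a module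
  over \<open>U[c]\<close>.
\<close>

lemma UC_span: "a \<in> UC \<Longrightarrow> z \<in> span \<Longrightarrow> a \<otimes> z \<in> span"
proof (induction arbitrary: z rule: UC.induct)
  case (UC_kf v)
  show ?case
    by (rule span_left_mult[OF _ _ UC_kf(2)]) (use UC_kf(1) in \<open>auto simp: kf_mult_assoc intro: span_basis\<close>)
next
  case (UC_c k)
  show ?case
  proof (rule span_left_mult[OF _ _ UC_c(2)])
    fix u b assume u: "u \<in> U" and b: "b \<in> basis_index"
    let ?l = vars
    have cl: "cmon (snd b) ?l \<in> carrier R" "weight_monomial (fst b) ?l \<in> carrier R"
      using cmon_UC[of ?l "snd b"] weight_monomial_closed[of ?l "fst b"] by simp_all
    have "c k \<otimes> (kf u \<otimes> basis b) = kf u \<otimes> ((c k \<otimes> cmon (snd b) ?l) \<otimes> weight_monomial (fst b) ?l)"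
      unfolding basis_def using u cl by (simp add: m_assoc[symmetric] kf_c)
    also have "\<dots> = kf u \<otimes> basis (fst b, snd b + single k 1)"
      unfolding basis_def using UC_c(1) by (subst c_cmon) auto
    also have "\<dots> \<in> span"
      using u b UC_c(1) Poly_Mapping.keys_add[of "snd b" "single k 1"]
      by (intro span_basis) (auto simp: basis_index_def)
    finally show "c k \<otimes> (kf u \<otimes> basis b) \<in> span" .
  qed simp
next
  case (UC_add a b)
  then show ?case by (simp add: l_distr span_add)
next
  case (UC_mult a b)
  then show ?case by (simp add: m_assoc)
qed

text \<open>
  The coefficient \<open>u c^\<gamma>\<close> is moved to the left of \<open>g\<close>, then \<open>g m\<^sub>w\<close> is a multiple of a single
  \<open>m\<^sub>w\<close> with a changed exponent.
\<close>

lemma generator_span: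
  assumes i: "i \<in> N" and g: "g \<in> {x i, d i}" and step: "\<And>k. \<exists>a\<in>UC. g \<otimes> signed_power i k = a \<otimes> signed_power i (k + e)"
    and z: "z \<in> span"
  shows "g \<otimes> z \<in> span"
proof (rule span_left_mult[OF _ _ z])
  show gc: "g \<in> carrier R" using g i by auto
  fix u b assume u: "u \<in> U" and b: "b \<in> basis_index"
  let ?l = vars
  let ?w = "(fst b)(i := fst b i + e)"
  have cA: "cmon (snd b) ?l \<in> UC" by (intro cmon_UC) simp
  have Mc: "weight_monomial w ?l \<in> carrier R" for w using weight_monomial_closed[of ?l w] by simp
  have "kf u \<otimes> cmon (snd b) ?l \<in> UC" using u cA by (intro UC_mult UC_kf)
  moreover have "normalizing g" using g normalizing_x[OF i] normalizing_d[OF i] by auto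
  ultimately obtain a where a: "a \<in> UC" "g \<otimes> (kf u \<otimes> cmon (snd b) ?l) = a \<otimes> g"
    using normalizingD by blast
  obtain a' where a': "a' \<in> UC" "g \<otimes> weight_monomial (fst b) ?l = a' \<otimes> weight_monomial ?w ?l"
    using generator_weight_monomial[OF i g step, of ?l "fst b"] i by auto
  have "basis (?w, 0) = weight_monomial ?w ?l"
  proof -
    have "cmon 0 ks = \<one>" for ks by (induction ks) simp_all
    then show ?thesis unfolding basis_def using Mc by simp
  qed
  moreover have "kf 1 \<otimes> basis (?w, 0) \<in> span"
    using b i by (intro span_basis) (auto simp: basis_index_def)
  ultimately have Ms: "weight_monomial ?w ?l \<in> span" using Mc by (simp add: kf_one)
  have "g \<otimes> (kf u \<otimes> basis b) = (g \<otimes> (kf u \<otimes> cmon (snd b) ?l)) \<otimes> weight_monomial (fst b) ?l"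
    unfolding basis_def using u gc cA Mc by (simp add: m_assoc)
  also have "\<dots> = a \<otimes> (g \<otimes> weight_monomial (fst b) ?l)"
    unfolding a(2) using a(1) gc Mc by (simp add: m_assoc)
  also have "\<dots> \<in> span"
    unfolding a'(2) using a(1) a'(1) Ms by (intro UC_span)
  finally show "g \<otimes> (kf u \<otimes> basis b) \<in> span" .
qed

lemma x_span: "i \<in> N \<Longrightarrow> z \<in> span \<Longrightarrow> x i \<otimes> z \<in> span"
  using generator_span[of i "x i" 1] x_signed_power by blast

lemma d_span: "i \<in> N \<Longrightarrow> z \<in> span \<Longrightarrow> d i \<otimes> z \<in> span"
  using generator_span[of i "d i" "-1"] d_signed_power by simp

lemma basis_0: "basis (\<lambda>_. 0, \<gamma>) = cmon \<gamma> vars"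
proof -
  have "weight_monomial (\<lambda>_. 0) js = \<one>" for js by (induction js) (simp_all add: signed_power_def)
  then show ?thesis
    unfolding basis_def using cmon_UC[of vars \<gamma>] by simp
qed

lemma one_span: "\<one> \<in> span"
proof -
  have "cmon 0 ks = \<one>" for ks by (induction ks) simp_all
  then have "basis (\<lambda>_. 0, 0) = \<one>" unfolding basis_0 by simp
  moreover have "kf 1 \<otimes> basis (\<lambda>_. 0, 0) \<in> span" by (intro span_basis) (auto simp: basis_index_def)
  ultimately show ?thesis by (simp add: kf_one)
qed

end

section \<open>Eigenvalues on the lattice and the center\<close>

lemma monomial_eval_pvar: "monomial_eval pvar \<gamma> = (single \<gamma> 1 :: 'a::idom hpoly)"
proof (induction \<gamma> rule: term_induct)
  case (add k q)
  have pow: "(pvar k :: 'a hpoly) ^ m = single (single k m) 1" for m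
  proof (induction m)
    case 0
    then show ?case by simp
  next
    case (Suc m)
    have "(pvar k :: 'a hpoly) ^ Suc m = single (single k 1 + single k m) 1"
      unfolding power_Suc Suc by (simp add: pvar_def mult_single del: single_one)
    then show ?case by (simp flip: single_add)
  qed
  show ?case unfolding monomial_eval_add monomial_eval_single pow add.IH by (simp add: mult_single)
qed simp

text \<open>
  Functions on the integer lattice with values in polynomials over the field of rational functions in the \<open>h\<^sub>i\<close>; the
  \<open>k\<close>-th variable of these polynomials is the scalar by which \<open>c k\<close> is going to act.
\<close>

type_synonym 'k state = "(nat \<Rightarrow> int) \<Rightarrow> 'k hfrac hpoly"

text \<open>
  The eigenvalue of \<open>h\<^sub>i\<close> at the lattice point \<open>l\<close>.
\<close>

definition shifted_h :: "(nat \<Rightarrow> int) \<Rightarrow> nat \<Rightarrow> 'k::idom hfrac" where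
  "shifted_h l i = hh i + of_int (l i)"

text \<open>
  If \<open>c k\<close> is to act as the \<open>k\<close>-th variable, then \<open>gam j\<close> must act at \<open>l\<close> as the residue
  \<open>\<chi>(- H\<^sub>j) / (\<Prod>i\<noteq>j. H\<^sub>i - H\<^sub>j)\<close> with \<open>H\<^sub>i = h\<^sub>i + l\<^sub>i\<close>. This is distributed over \<open>x j\<close> and
  \<open>d j\<close>: the factors with \<open>i < j\<close> go to \<open>x j\<close>, the rest goes to \<open>d j\<close>. With this choice, for
  \<open>i < j\<close> neither factor in \<open>x i\<close>, \<open>d j\<close> changes under the shift by the other generator, in
  accordance with the relation that \<open>x i\<close> and \<open>d j\<close> commute. The summand \<open>1\<close> in \<open>xcoef\<close> arises
  because \<open>gam j\<close> uses the factor of \<open>x j\<close> at the neighbouring point \<open>l + e\<^sub>j\<close> (\<open>xcoef_up\<close>).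
\<close>

definition xcoef :: "nat \<Rightarrow> (nat \<Rightarrow> int) \<Rightarrow> 'k::idom hfrac hpoly" where
  "xcoef j l = pconst (1 / (\<Prod>i\<in>{1..<j}. shifted_h l i - shifted_h l j + 1))"

definition dcoef :: "nat \<Rightarrow> nat \<Rightarrow> (nat \<Rightarrow> int) \<Rightarrow> 'k::idom hfrac hpoly" where
  "dcoef n j l = monic_value n pvar (pconst (- shifted_h l j)) * pconst (1 / (\<Prod>i\<in>{j<..n}. shifted_h l i - shifted_h l j))"

interpretation pc: unital_hom "pconst :: 'k::idom hfrac \<Rightarrow> 'k hfrac hpoly"
  by (rule unital_hom_pconst)

lemma fshift_esymf_shifted_h: "fshift l (esymf hh S k) = esymf (shifted_h l) S k"
  unfolding fshift_esymf by (rule esymf_cong) (simp add: shifted_h_def)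

lemma shifted_h_difference_nonzero:
  assumes "i \<noteq> j"
  shows "shifted_h l i - shifted_h l j + of_int k \<noteq> (0::'k::idom hfrac)"
  using hdiff_shift_nonzero[OF assms, of "l i - l j + k"] by (simp add: shifted_h_def hdiff_def algebra_simps)

lemma shifted_h_nonzero [simp]:
  assumes "i \<noteq> j"
  shows "shifted_h l i - shifted_h l j \<noteq> (0::'k::idom hfrac)" "shifted_h l i - shifted_h l j + 1 \<noteq> (0::'k hfrac)"
    "shifted_h l i \<noteq> (shifted_h l j::'k hfrac)"
  using shifted_h_difference_nonzero[OF assms, of l 0, where ?'k = 'k]
    shifted_h_difference_nonzero[OF assms, of l 1, where ?'k = 'k] by auto

lemma shifted_h_upd: "shifted_h (l(j := k)) i = (if i = j then hh j + of_int k else shifted_h l i)"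
  by (simp add: shifted_h_def)

lemma xcoef_nonzero [simp]: "xcoef j l \<noteq> 0"
  by (auto simp: xcoef_def)

text \<open>
  Specializing \<open>c\<^sub>n\<close> to \<open>s ^ n + 1\<close> and the other variables to \<open>0\<close> gives the value \<open>1\<close>.
\<close>

lemma monic_value_nonzero:
  assumes "n \<ge> 1"
  shows "monic_value n pvar (pconst s) \<noteq> (0 :: 'k::idom hfrac hpoly)"
proof
  let ?h = "peval (\<lambda>a. a) (\<lambda>k. if k = n then s ^ n + 1 else 0) :: 'k hfrac hpoly \<Rightarrow> 'k hfrac"
  interpret unital_hom ?h by (intro unital_hom.unital_hom_peval unital_hom_id)
  assume "monic_value n pvar (pconst s) = (0 :: 'k hfrac hpoly)"
  then have "?h (monic_value n pvar (pconst s)) = 0" by simp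
  moreover have "(\<Sum>k=1..n. (if k = n then s ^ n + 1 else 0) * s ^ (n - k)) = (\<Sum>k=1..n. if k = n then s ^ n + 1 else 0)"
    by (intro sum.cong) auto
  ultimately show False
    using assms by (simp add: monic_value_def unital_hom_id)
qed

lemma dcoef_nonzero: "j \<in> {1..n} \<Longrightarrow> dcoef n j l \<noteq> 0"
  using monic_value_nonzero[of n "- shifted_h l j"] by (auto simp: dcoef_def)

lemma xcoef_up: "xcoef j (l(j := l j + 1)) = pconst (1 / (\<Prod>i\<in>{1..<j}. shifted_h l i - shifted_h l j))"
  unfolding xcoef_def by (intro arg_cong[where f = pconst] arg_cong2[where f = "(/)"] prod.cong)
    (auto simp: shifted_h_upd shifted_h_def)

text \<open>
  The eigenvalue of \<open>gam j = d j \<otimes> x j\<close> at \<open>l\<close>.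
\<close>

definition gcoef :: "nat \<Rightarrow> nat \<Rightarrow> (nat \<Rightarrow> int) \<Rightarrow> 'k::idom hfrac hpoly" where
  "gcoef n j l = dcoef n j l * xcoef j (l(j := l j + 1))"

lemma prod_remove_split:
  fixes j n :: nat
  assumes "j \<in> {1..n}"
  shows "(\<Prod>i\<in>{1..n} - {j}. f i) = (\<Prod>i\<in>{1..<j}. f i) * (\<Prod>i\<in>{j<..n}. (f i :: 'a::comm_monoid_mult))"
proof -
  have eq: "{1..n} - {j} = {1..<j} \<union> {j<..n}" using assms by auto
  show ?thesis unfolding eq by (rule prod.union_disjoint) auto
qed

lemma gcoef_eq:
  assumes "j \<in> {1..n}"
  shows "gcoef n j l = monic_value n pvar (pconst (- shifted_h l j)) * (pconst (1 / (\<Prod>i\<in>{1..n} - {j}. shifted_h l i - shifted_h l j)) :: 'k::idom hfrac hpoly)"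
proof -
  have "pconst (1 / q) * pconst (1 / p) = (pconst (1 / (p * q)) :: 'k hfrac hpoly)" for p q
    unfolding pc.hom_mult[symmetric] by (simp add: mult.commute)
  then show ?thesis
    unfolding gcoef_def dcoef_def xcoef_up prod_remove_split[OF assms] by (simp only: mult.assoc)
qed

lemma gcoef_residue:
  assumes "j \<in> {1..n}"
  shows "gcoef n j l * (\<Prod>i\<in>{1..n} - {j}. pconst (shifted_h l i) - pconst (shifted_h l j))
    = (monic_value n pvar (- pconst (shifted_h l j)) :: 'k::idom hfrac hpoly)"
proof -
  define P where "P = (\<Prod>i\<in>{1..n} - {j}. shifted_h l i - shifted_h l j :: 'k hfrac)"
  have "P \<noteq> 0" by (auto simp: P_def)
  have "(\<Prod>i\<in>{1..n} - {j}. pconst (shifted_h l i) - pconst (shifted_h l j)) = pconst P"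
    by (simp add: P_def)
  moreover have "pconst (1 / P) * pconst P = (1 :: 'k hfrac hpoly)"
    using \<open>P \<noteq> 0\<close> by (simp flip: pc.hom_mult)
  ultimately show ?thesis
    unfolding gcoef_eq[OF assms] P_def[symmetric] by (simp add: mult.assoc)
qed

lemma inj_pconst_shifted_h: "inj_on (\<lambda>i. pconst (shifted_h l i) :: 'k::idom hfrac hpoly) S"
proof (rule inj_onI)
  fix i j assume "pconst (shifted_h l i) = (pconst (shifted_h l j) :: 'k hfrac hpoly)"
  then have "pconst (shifted_h l i - shifted_h l j) = (0 :: 'k hfrac hpoly)" by simp
  then show "i = j" by (metis shifted_h_nonzero(1) pconst_eq_0_iff)
qed

text \<open>
  The left-hand side is the eigenvalue of \<open>c k\<close> at the lattice point \<open>l\<close>.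
\<close>

lemma gcoef_coefficients:
  assumes "k \<in> {1..n}"
  shows "(\<Sum>j=1..n. pconst (esymf (shifted_h l) ({1..n} - {j}) (k - 1)) * gcoef n j l) - pconst (esymf (shifted_h l) {1..n} k)
    = (pvar k :: 'k::idom hfrac hpoly)"
proof -
  have "(\<Sum>j\<in>{1..n}. esymf (\<lambda>i. pconst (shifted_h l i)) ({1..n} - {j}) (k - 1) * gcoef n j l)
      - esymf (\<lambda>i. pconst (shifted_h l i)) {1..n} k = (pvar k :: 'k hfrac hpoly)"
    by (rule lagrange_coefficients[OF _ _ inj_pconst_shifted_h gcoef_residue assms]) auto
  then show ?thesis by (simp add: hom_esymf[OF unital_hom_pconst])
qed

lemma gcoef_interpolation:
  "(\<Sum>j=1..n. (\<Prod>i\<in>{1..n} - {j}. s + pconst (shifted_h l i)) * gcoef n j l) - (\<Prod>i=1..n. s + pconst (shifted_h l i))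
    = (monic_value n pvar s :: 'k::idom hfrac hpoly)"
  by (rule lagrange_interpolation[OF _ _ inj_pconst_shifted_h gcoef_residue]) auto

lemma of_int_hfrac_eq_0 [simp]: "(of_int k :: 'k::{idom, ring_char_0} hfrac) = 0 \<longleftrightarrow> k = 0"
proof -
  have "(of_int k :: 'k hfrac) = Fraction_Field.Fract (of_int k) 1"
    by (simp add: unital_hom.hom_of_int[OF unital_hom_Fract])
  then show ?thesis by (simp add: Zero_fract_def eq_fract)
qed

definition point :: "(nat \<Rightarrow> int) \<Rightarrow> 'k::idom hfrac hpoly \<Rightarrow> 'k state" where
  "point w \<mu> = (\<lambda>l. if l = w then \<mu> else 0)"

lemma (in ring) centerI:
  "z \<in> carrier R \<Longrightarrow> (\<And>a. a \<in> carrier R \<Longrightarrow> z \<otimes> a = a \<otimes> z) \<Longrightarrow> z \<in> ring_center R"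
  unfolding ring_center_def by blast

lemma (in ring) center_closed: "z \<in> ring_center R \<Longrightarrow> z \<in> carrier R"
  unfolding ring_center_def by blast

lemma (in ring) center_commutes: "z \<in> ring_center R \<Longrightarrow> a \<in> carrier R \<Longrightarrow> z \<otimes> a = a \<otimes> z"
  unfolding ring_center_def by blast

text \<open>
  The relations together with a representation on lattice functions. The last assumption says that
  left multiplication by generators and addition produce the whole ring from \<open>1\<close>.
\<close>

locale diff_model = diff_relations R n N U kf x d
  for R :: "('r, 'm) ring_scheme" (structure) and n N and U :: "'k::{idom, ring_char_0} hfrac set" and kf x d +
  fixes rho :: "'r \<Rightarrow> 'k state \<Rightarrow> 'k state"
  assumes rho_add: "a \<in> carrier R \<Longrightarrow> b \<in> carrier R \<Longrightarrow> rho (a \<oplus> b) f l = rho a f l + rho b f l"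
    and rho_mult: "a \<in> carrier R \<Longrightarrow> b \<in> carrier R \<Longrightarrow> rho (a \<otimes> b) f = rho a (rho b f)"
    and rho_scale: "a \<in> carrier R \<Longrightarrow> rho a (\<lambda>l. \<kappa> * f l) = (\<lambda>l. \<kappa> * rho a f l)"
    and rho_kf: "u \<in> U \<Longrightarrow> rho (kf u) f l = pconst (fshift l u) * f l"
    and rho_x: "j \<in> N \<Longrightarrow> rho (x j) f l = xcoef j l * f (l(j := l j - 1))"
    and rho_d: "j \<in> N \<Longrightarrow> rho (d j) f l = dcoef n j l * f (l(j := l j + 1))"
    and generated: "\<And>S. S \<subseteq> carrier R \<Longrightarrow> \<one> \<in> S \<Longrightarrow> (\<And>a b. a \<in> S \<Longrightarrow> b \<in> S \<Longrightarrow> a \<oplus> b \<in> S)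
      \<Longrightarrow> (\<And>u a. u \<in> U \<Longrightarrow> a \<in> S \<Longrightarrow> kf u \<otimes> a \<in> S) \<Longrightarrow> (\<And>j a. j \<in> N \<Longrightarrow> a \<in> S \<Longrightarrow> x j \<otimes> a \<in> S)
      \<Longrightarrow> (\<And>j a. j \<in> N \<Longrightarrow> a \<in> S \<Longrightarrow> d j \<otimes> a \<in> S) \<Longrightarrow> carrier R \<subseteq> S"
begin

lemma rho_one: "rho \<one> f = f"
  using rho_kf[of 1 f] by (auto simp: kf_one)

lemma rho_zero: "rho \<zero> f l = 0"
  using rho_add[OF zero_closed zero_closed, of f l]
  unfolding l_zero[OF zero_closed] by (simp only: add_cancel_right_right)

lemma rho_finsum:
  "finite K \<Longrightarrow> (\<And>k. k \<in> K \<Longrightarrow> g k \<in> carrier R) \<Longrightarrow> rho (finsum R g K) f l = (\<Sum>k\<in>K. rho (g k) f l)"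
proof (induction K rule: finite_induct)
  case (insert k K)
  then show ?case by (subst finsum_insert) (auto simp: rho_add Pi_def)
qed (simp add: rho_zero)

lemma rho_gam: "j \<in> N \<Longrightarrow> rho (gam j) f l = gcoef n j l * f l"
  by (simp add: gam_def rho_mult rho_x rho_d gcoef_def)

lemma rho_gamma_form:
  assumes "\<And>j. j \<in> N \<Longrightarrow> u j \<in> U" "v \<in> U"
  shows "rho (gamma_form u v) f l = ((\<Sum>j\<in>N. pconst (fshift l (u j)) * gcoef n j l) + pconst (fshift l v)) * f l"
proof -
  have c: "(\<Oplus>j\<in>N. kf (u j) \<otimes> gam j) \<in> carrier R" using assms by (intro finsum_closed) auto
  have "rho (\<Oplus>j\<in>N. kf (u j) \<otimes> gam j) f l = (\<Sum>j\<in>N. rho (kf (u j) \<otimes> gam j) f l)"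
    using assms by (intro rho_finsum) auto
  also have "\<dots> = (\<Sum>j\<in>N. pconst (fshift l (u j)) * gcoef n j l * f l)"
    using assms by (intro sum.cong refl) (simp add: rho_mult rho_kf rho_gam mult.assoc)
  finally show ?thesis
    unfolding gamma_form_def rho_add[OF c kf_closed[OF assms(2)]] rho_kf[OF assms(2)]
    by (simp add: distrib_right sum_distrib_right)
qed

lemma rho_c:
  assumes "k \<in> N"
  shows "rho (c k) f l = pvar k * f l"
proof -
  have "(\<Sum>j\<in>N. pconst (fshift l (esymf hh (N - {j}) (k - 1))) * gcoef n j l) + pconst (fshift l (- esymf hh N k))
      = (pvar k :: 'k hfrac hpoly)"
    using gcoef_coefficients[of k n l, where ?'k = 'k] assms
    by (simp only: N_eq fshift.hom_minus pc.hom_minus fshift_esymf_shifted_h add_uminus_conv_diff)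
  then show ?thesis unfolding c_def by (subst rho_gamma_form) simp_all
qed

text \<open>
  Powers of \<open>x j\<close> (with \<open>e = 1\<close>) and of \<open>d j\<close> (with \<open>e = -1\<close>) at once.
\<close>

lemma rho_pow_point:
  assumes g: "g \<in> carrier R" and \<phi>: "\<And>l. \<phi> l \<noteq> 0"
    and rho: "\<And>f l. rho g f l = \<phi> l * f (l(j := l j - e))" and \<mu>: "\<mu> \<noteq> 0"
  shows "\<exists>\<nu>. \<nu> \<noteq> 0 \<and> rho (g [^] m) (point w \<mu>) = point (w(j := w j + int m * e)) \<nu>"
proof (induction m)
  case 0
  then show ?case using \<mu> by (auto simp: rho_one)
next
  case (Suc m)
  then obtain \<nu> where \<nu>: "\<nu> \<noteq> 0" "rho (g [^] m) (point w \<mu>) = point (w(j := w j + int m * e)) \<nu>" by blast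
  let ?w = "w(j := w j + int m * e)" and ?w' = "w(j := w j + int (Suc m) * e)"
  \<comment> \<open>The only point whose translate by \<open>- e\<close> lies in the support is the translate of the support by \<open>e\<close>.\<close>
  have eq: "l(j := l j - e) = ?w \<longleftrightarrow> l = ?w'" for l
    by (auto simp: fun_eq_iff algebra_simps)
  have "rho g (point ?w \<nu>) l = point ?w' (\<phi> ?w' * \<nu>) l" for l
    unfolding rho point_def eq by simp
  then have "rho g (point ?w \<nu>) = point ?w' (\<phi> ?w' * \<nu>)" ..
  then have "rho (g [^] Suc m) (point w \<mu>) = point ?w' (\<phi> ?w' * \<nu>)"
    using g nat_pow_Suc2[OF g, of m] \<nu>(2) by (simp add: rho_mult del: nat_pow_Suc)
  then show ?case using \<nu>(1) \<phi> by (metis mult_eq_0_iff)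
qed

lemma rho_signed_power_point:
  assumes j: "j \<in> N" and \<mu>: "\<mu> \<noteq> 0"
  shows "\<exists>\<nu>. \<nu> \<noteq> 0 \<and> rho (signed_power j k) (point w \<mu>) = point (w(j := w j + k)) \<nu>"
proof (cases k rule: int_cases2)
  case (nonneg m)
  then show ?thesis
    using rho_pow_point[of "x j" "xcoef j" j 1 \<mu> m w] j \<mu> by (simp add: rho_x signed_power_int)
next
  case (nonpos m)
  have "dcoef n j l \<noteq> (0 :: 'k hfrac hpoly)" for l :: "nat \<Rightarrow> int" using dcoef_nonzero[of j n l] j by (simp add: N_eq)
  then show ?thesis
    using rho_pow_point[of "d j" "dcoef n j" j "-1" \<mu> m w] j \<mu> nonpos by (simp add: rho_d signed_power_neg_int)
qed

text \<open>
  The polynomials over a field have no zero divisors, so the values picked up along the way multiply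
  to a nonzero value. This is the source of faithfulness.
\<close>

lemma rho_weight_monomial_point:
  assumes "distinct js" "set js \<subseteq> N"
  shows "\<exists>\<nu>. \<nu> \<noteq> 0 \<and> rho (weight_monomial w js) (point (\<lambda>_. 0) 1) = point (\<lambda>i. if i \<in> set js then w i else 0) \<nu>"
  using assms
proof (induction js)
  case Nil
  then show ?case by (intro exI[of _ 1]) (simp add: rho_one)
next
  case (Cons j js)
  define v where "v = (\<lambda>i. if i \<in> set js then w i else 0)"
  have j: "j \<in> N" "j \<notin> set js" and js: "distinct js" "set js \<subseteq> N" using Cons.prems by simp_all
  obtain \<nu> where \<nu>: "\<nu> \<noteq> 0" "rho (weight_monomial w js) (point (\<lambda>_. 0) 1) = point v \<nu>"
    using Cons.IH[OF js] unfolding v_def by blast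
  obtain \<nu>' where \<nu>': "\<nu>' \<noteq> 0" "rho (signed_power j (w j)) (point v \<nu>) = point (v(j := v j + w j)) \<nu>'"
    using rho_signed_power_point[OF j(1) \<nu>(1)] by blast
  have eq: "v(j := v j + w j) = (\<lambda>i. if i \<in> set (j # js) then w i else 0)"
  proof
    show "(v(j := v j + w j)) i = (if i \<in> set (j # js) then w i else 0)" for i
      using j(2) by (simp add: v_def)
  qed
  have "rho (weight_monomial w (j # js)) (point (\<lambda>_. 0) 1) = rho (signed_power j (w j)) (point v \<nu>)"
    unfolding \<nu>(2)[symmetric] weight_monomial_Cons by (rule rho_mult) (use j js in simp_all)
  then have "rho (weight_monomial w (j # js)) (point (\<lambda>_. 0) 1) = point (\<lambda>i. if i \<in> set (j # js) then w i else 0) \<nu>'"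
    unfolding \<nu>'(2) eq .
  with \<nu>'(1) show ?case by blast
qed

lemma rho_weight_monomial_vars:
  assumes "\<And>i. i \<notin> N \<Longrightarrow> w i = 0"
  shows "\<exists>\<nu>. \<nu> \<noteq> 0 \<and> rho (weight_monomial w vars) (point (\<lambda>_. 0) 1) = point w \<nu>"
proof -
  have "(\<lambda>i. if i \<in> N then w i else 0) = w" using assms by auto
  then show ?thesis using rho_weight_monomial_point[of vars w] by simp
qed

lemma rho_pow_c: "k \<in> N \<Longrightarrow> rho (c k [^] (m::nat)) f l = pvar k ^ m * f l"
proof (induction m arbitrary: f l)
  case (Suc m)
  have "rho (c k [^] Suc m) f l = rho (c k [^] m) (rho (c k) f) l" by (simp add: rho_mult)
  also have "\<dots> = pvar k ^ m * (pvar k * f l)"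
    unfolding Suc.IH[OF Suc.prems] rho_c[OF Suc.prems] by simp
  finally show ?case by (simp add: mult_ac)
qed (simp add: rho_one)

lemma rho_cmon_list:
  "distinct ks \<Longrightarrow> set ks \<subseteq> N \<Longrightarrow> rho (cmon \<gamma> ks) f l = (\<Prod>k\<in>set ks. pvar k ^ lookup \<gamma> k) * f l"
proof (induction ks arbitrary: l)
  case (Cons k ks)
  have "cmon \<gamma> ks \<in> carrier R" using Cons.prems cmon_UC[of ks \<gamma>] by auto
  then have "rho (cmon \<gamma> (k # ks)) f l = rho (c k [^] lookup \<gamma> k) (rho (cmon \<gamma> ks) f) l"
    by (simp add: rho_mult)
  also have "\<dots> = pvar k ^ lookup \<gamma> k * rho (cmon \<gamma> ks) f l"
    using Cons.prems by (intro rho_pow_c) simp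
  finally show ?case using Cons by (simp add: mult.assoc)
qed (simp add: rho_one)

lemma rho_cmon:
  assumes "keys \<gamma> \<subseteq> N"
  shows "rho (cmon \<gamma> vars) f l = single \<gamma> 1 * f l"
  using rho_cmon_list[of vars \<gamma> f l] monomial_eval_superset[OF finite_N assms, of "pvar :: nat \<Rightarrow> 'k hfrac hpoly"]
  by (simp add: monomial_eval_pvar)

text \<open>
  The part of weight \<open>w\<close> of a combination, as a polynomial in the \<open>c\<^sub>k\<close> with coefficients shifted to
  the lattice point \<open>w\<close>.
\<close>

definition weight_part :: "((nat \<Rightarrow> int) \<times> (nat \<Rightarrow>\<^sub>0 nat) \<Rightarrow>\<^sub>0 'k hfrac) \<Rightarrow> (nat \<Rightarrow> int) \<Rightarrow> 'k hfrac hpoly" where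
  "weight_part F w = (\<Sum>b\<in>keys F. if fst b = w
      then single (snd b) (fshift w (lookup F b)) else 0)"

lemma lookup_weight_part: "lookup (weight_part F w) \<gamma> = fshift w (lookup F (w, \<gamma>))"
proof -
  have "lookup (weight_part F w) \<gamma>
      = (\<Sum>b\<in>keys F. if b = (w, \<gamma>) then fshift w (lookup F b) else 0)"
    unfolding weight_part_def lookup_sum by (intro sum.cong refl) (auto simp: lookup_single when_def)
  then show ?thesis by (auto simp: in_keys_iff)
qed

lemma rho_term:
  assumes "b \<in> basis_index" "u \<in> U"
  shows "rho (kf u \<otimes> basis b) f l
    = single (snd b) (fshift l u) * rho (weight_monomial (fst b) vars) f l"
proof -
  have c: "cmon (snd b) vars \<in> carrier R" using cmon_UC[of vars "snd b"] by simp
  have "keys (snd b) \<subseteq> N" using assms(1) by (simp add: basis_index_def)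
  then have "rho (kf u \<otimes> basis b) f l
      = pconst (fshift l u) * (single (snd b) 1 * rho (weight_monomial (fst b) vars) f l)"
    unfolding basis_def using c assms(2) by (simp add: rho_mult rho_kf rho_cmon)
  then show ?thesis by (simp add: pconst_def mult_single mult.assoc[symmetric])
qed

lemma rho_combination:
  assumes F: "admissible F"
  shows "rho (combination F) f l = (\<Sum>b\<in>keys F.
    single (snd b) (fshift l (lookup F b)) * rho (weight_monomial (fst b) vars) f l)"
proof -
  have ok: "b \<in> basis_index" "lookup F b \<in> U" if "b \<in> keys F" for b
    using F that unfolding admissible_def by blast+
  have "rho (combination F) f l = (\<Sum>b\<in>keys F. rho (kf (lookup F b) \<otimes> basis b) f l)"
    unfolding combination_def using ok by (intro rho_finsum) auto
  also have "\<dots> = (\<Sum>b\<in>keys F.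
      single (snd b) (fshift l (lookup F b)) * rho (weight_monomial (fst b) vars) f l)"
    by (intro sum.cong refl rho_term ok)
  finally show ?thesis .
qed

text \<open>
  The terms of weight \<open>w\<close> are the only ones that contribute at \<open>w\<close>, so the action on the delta
  function at \<open>0\<close> determines all coefficients.
\<close>

lemma rho_combination_point:
  assumes F: "admissible F" and w: "\<And>i. i \<notin> N \<Longrightarrow> w i = 0"
  shows "\<exists>\<nu>. \<nu> \<noteq> 0 \<and> rho (combination F) (point (\<lambda>_. 0) 1) w = weight_part F w * \<nu>"
proof -
  let ?\<delta> = "point (\<lambda>_. 0) 1 :: 'k state"
  obtain \<nu> where \<nu>: "\<nu> \<noteq> 0" "rho (weight_monomial w vars) ?\<delta> = point w \<nu>"
    using rho_weight_monomial_vars[of w] w by blast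
  have "rho (weight_monomial (fst b) vars) ?\<delta> w = (if fst b = w then \<nu> else 0)" if "b \<in> keys F" for b
  proof -
    have "i \<notin> N \<Longrightarrow> fst b i = 0" for i using F that by (auto simp: admissible_def basis_index_def)
    then obtain \<nu>' where \<nu>': "rho (weight_monomial (fst b) vars) ?\<delta> = point (fst b) \<nu>'"
      using rho_weight_monomial_vars[of "fst b"] by blast
    show ?thesis
    proof (cases "fst b = w")
      case True
      then show ?thesis using \<nu>(2) by (simp add: point_def)
    next
      case False
      then show ?thesis using \<nu>' by (simp add: point_def)
    qed
  qed
  then have "rho (combination F) ?\<delta> w = weight_part F w * \<nu>"
    unfolding rho_combination[OF F] weight_part_def sum_distrib_right by (intro sum.cong refl) auto
  with \<nu>(1) show ?thesis by blast
qed

lemma carrier_span: "carrier R \<subseteq> span"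
  by (rule generated) (auto intro: one_span span_add x_span d_span UC_span UC_kf)

text \<open>
  On the delta function at \<open>0\<close> the element \<open>h\<^sub>i\<close> acts as the scalar \<open>h\<^sub>i\<close>, whereas at the point \<open>w\<close>
  it acts as \<open>h\<^sub>i + w\<^sub>i\<close>. Commutation of \<open>h\<^sub>i\<close> with a combination therefore forces the part of
  weight \<open>w\<close> to vanish unless \<open>w\<^sub>i = 0\<close>. The integer \<open>w\<^sub>i\<close> is a nonzero scalar by characteristic
  zero.
\<close>

lemma central_support:
  assumes F: "admissible F" and comm: "\<And>i. i \<in> N \<Longrightarrow> combination F \<otimes> kf (hh i) = kf (hh i) \<otimes> combination F"
    and b: "b \<in> keys F"
  shows "fst b = (\<lambda>_. 0)"
proof (rule ccontr)
  let ?\<delta> = "point (\<lambda>_. 0) 1 :: 'k state" and ?w = "fst b"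
  assume "?w \<noteq> (\<lambda>_. 0)"
  moreover have supp: "\<And>i. i \<notin> N \<Longrightarrow> ?w i = 0" using F b by (auto simp: admissible_def basis_index_def)
  ultimately obtain i where i: "i \<in> N" "?w i \<noteq> 0" by (metis ext)
  obtain \<nu> where \<nu>: "\<nu> \<noteq> 0" "rho (combination F) ?\<delta> ?w = weight_part F ?w * \<nu>"
    using rho_combination_point[OF F, of ?w] supp by blast
  have z: "combination F \<in> carrier R" using F by simp
  \<comment> \<open>Only the value at \<open>0\<close> matters, where no shift occurs.\<close>
  have "rho (kf (hh i)) ?\<delta> = (\<lambda>l. pconst (hh i) * ?\<delta> l)"
    using i(1) by (auto simp: rho_kf point_def)
  then have "rho (combination F \<otimes> kf (hh i)) ?\<delta> ?w = pconst (hh i) * rho (combination F) ?\<delta> ?w"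
    using i(1) z by (simp add: rho_mult rho_scale)
  moreover have "rho (kf (hh i) \<otimes> combination F) ?\<delta> ?w = pconst (hh i + of_int (?w i)) * rho (combination F) ?\<delta> ?w"
    using i(1) z by (simp add: rho_mult rho_kf)
  ultimately have "pconst (hh i) * rho (combination F) ?\<delta> ?w + pconst (of_int (?w i)) * rho (combination F) ?\<delta> ?w
      = pconst (hh i) * rho (combination F) ?\<delta> ?w"
    unfolding comm[OF i(1)] by (simp only: pc.hom_add distrib_right)
  then have "pconst (of_int (?w i)) * rho (combination F) ?\<delta> ?w = (0 :: 'k hfrac hpoly)"
    by (simp only: add_cancel_left_right)
  moreover have "pconst (of_int (?w i)) \<noteq> (0 :: 'k hfrac hpoly)"
    using i(2) by (simp only: pconst_eq_0_iff of_int_hfrac_eq_0 not_False_eq_True)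
  ultimately have "weight_part F ?w * \<nu> = 0" using \<nu>(2) by (metis mult_eq_0_iff)
  then have "weight_part F ?w = 0" using \<nu>(1) by simp
  then have "lookup (weight_part F ?w) (snd b) = 0" by simp
  then have "lookup F b = 0" by (simp add: lookup_weight_part)
  then show False using b by (simp add: in_keys_iff)
qed

text \<open>
  A central element has weight \<open>0\<close>, so it acts at each point \<open>l\<close> as a multiplication by some \<open>Q l\<close>.
  Since \<open>m\<^sub>w\<close> connects the points \<open>0\<close> and \<open>w\<close>, \<open>Q\<close> is constant on the lattice; on coefficients
  this is shift invariance.
\<close>

lemma central_coefficients:
  assumes F: "admissible F" and comm: "\<And>a. a \<in> carrier R \<Longrightarrow> combination F \<otimes> a = a \<otimes> combination F"
    and b: "b \<in> keys F"
  shows "\<exists>a. lookup F b = const a"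
proof (rule shift_invariant_const[of _ n])
  have "lookup F b \<in> U" using F unfolding admissible_def by blast
  then show "lookup F b \<in> Ubar_h n" by (simp only: U_eq)
next
  fix w :: "nat \<Rightarrow> int" assume "\<And>i. i \<notin> {1..n} \<Longrightarrow> w i = 0"
  then have w: "\<And>i. i \<notin> N \<Longrightarrow> w i = 0" by (simp add: N_eq)
  let ?\<delta> = "point (\<lambda>_. 0) 1 :: 'k state"
  define Q where "Q l = (\<Sum>b\<in>keys F. single (snd b) (fshift l (lookup F b)))" for l
  have z: "combination F \<in> carrier R" using F by simp
  have fst0: "fst b' = (\<lambda>_. 0)" if "b' \<in> keys F" for b'
    by (rule central_support[OF F _ that]) (simp add: comm)
  have M0: "weight_monomial (\<lambda>_. 0) js = \<one>" for js by (induction js) (simp_all add: signed_power_def)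
  have rho_z: "rho (combination F) f l = Q l * f l" for f l
    unfolding rho_combination[OF F] Q_def sum_distrib_right
    by (intro sum.cong refl) (simp add: fst0 M0 rho_one)
  obtain \<nu> where \<nu>: "\<nu> \<noteq> 0" "rho (weight_monomial w vars) ?\<delta> = point w \<nu>"
    using rho_weight_monomial_vars[of w] w by blast
  have "rho (combination F) ?\<delta> = (\<lambda>l. Q (\<lambda>_. 0) * ?\<delta> l)" by (auto simp: rho_z point_def)
  then have "rho (weight_monomial w vars \<otimes> combination F) ?\<delta> w = Q (\<lambda>_. 0) * \<nu>"
    using z \<nu>(2) by (simp add: rho_mult rho_scale) (simp add: point_def)
  moreover have "rho (combination F \<otimes> weight_monomial w vars) ?\<delta> w = Q w * \<nu>"
    using z \<nu>(2) by (simp add: rho_mult rho_z) (simp add: point_def)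
  ultimately have Q: "Q w = Q (\<lambda>_. 0)" using comm[of "weight_monomial w vars"] \<nu>(1) by simp
  have lookup_Q: "lookup (Q l) (snd b) = fshift l (lookup F b)" for l
  proof -
    have "lookup (Q l) (snd b)
        = (\<Sum>b'\<in>keys F. if b' = b then fshift l (lookup F b') else 0)"
      unfolding Q_def lookup_sum
      by (intro sum.cong refl) (use fst0 b in \<open>auto simp: lookup_single when_def prod_eq_iff\<close>)
    then show ?thesis using b by simp
  qed
  show "fshift w (lookup F b) = lookup F b"
    using lookup_Q[of w] lookup_Q[of "\<lambda>_. 0"] unfolding Q by (simp add: fshift_0)
qed

lemma central_if_commutes_with_generators:
  assumes h: "h \<in> carrier R" and kf: "\<And>u. u \<in> U \<Longrightarrow> h \<otimes> kf u = kf u \<otimes> h"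
    and x: "\<And>j. j \<in> N \<Longrightarrow> h \<otimes> x j = x j \<otimes> h" and d: "\<And>j. j \<in> N \<Longrightarrow> h \<otimes> d j = d j \<otimes> h"
  shows "h \<in> ring_center R"
proof -
  let ?S = "{a \<in> carrier R. h \<otimes> a = a \<otimes> h}"
  have left: "g \<otimes> a \<in> ?S" if g: "g \<in> carrier R" "h \<otimes> g = g \<otimes> h" and a: "a \<in> ?S" for g a
  proof -
    have ac: "a \<in> carrier R" "h \<otimes> a = a \<otimes> h" using a by simp_all
    have "h \<otimes> (g \<otimes> a) = (h \<otimes> g) \<otimes> a" using g(1) ac(1) h by (simp add: m_assoc)
    also have "\<dots> = g \<otimes> (h \<otimes> a)" unfolding g(2) using g(1) ac(1) h by (simp add: m_assoc)
    also have "\<dots> = (g \<otimes> a) \<otimes> h" unfolding ac(2) using g(1) ac(1) h by (simp add: m_assoc)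
    finally show ?thesis using g(1) ac(1) by simp
  qed
  have "carrier R \<subseteq> ?S"
  proof (rule generated)
    show "?S \<subseteq> carrier R" "\<one> \<in> ?S" using h by auto
    show "a \<oplus> b \<in> ?S" if "a \<in> ?S" "b \<in> ?S" for a b
      using that h by (simp add: r_distr l_distr)
    show "kf u \<otimes> a \<in> ?S" if "u \<in> U" "a \<in> ?S" for u a
      by (rule left[OF kf_closed[OF that(1)] kf[OF that(1)] that(2)])
    show "x j \<otimes> a \<in> ?S" if "j \<in> N" "a \<in> ?S" for j a
      by (rule left[OF x_closed[OF that(1)] x[OF that(1)] that(2)])
    show "d j \<otimes> a \<in> ?S" if "j \<in> N" "a \<in> ?S" for j a
      by (rule left[OF d_closed[OF that(1)] d[OF that(1)] that(2)])
  qed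
  then show ?thesis using h by (auto simp: ring_center_def)
qed

text \<open>
  The expansion of a central element has only terms \<open>a c^\<gamma>\<close> with \<open>a\<close> in the ground ring; conversely,
  the \<open>c k\<close> and the constants commute with all generators.
\<close>

theorem center_eq:
  "ring_center R = generate_ring R (range (\<lambda>a. kf (const a)) \<union> c ` N)"
proof (rule antisym)
  let ?H = "range (\<lambda>a. kf (const a)) \<union> c ` N"
  have H: "?H \<subseteq> carrier R" by auto
  have subring: "subring (generate_ring R ?H) R" by (rule generate_ring_is_subring[OF H])
  show "ring_center R \<subseteq> generate_ring R ?H"
  proof
    fix z assume "z \<in> ring_center R"
    then have z: "z \<in> carrier R" and comm: "\<And>a. a \<in> carrier R \<Longrightarrow> z \<otimes> a = a \<otimes> z"
      by (auto simp: ring_center_def)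
    obtain F where F: "admissible F" "z = combination F"
      using z carrier_span by (auto simp: span_def)
    have cmon_gen: "cmon \<gamma> ks \<in> generate_ring R ?H" if "set ks \<subseteq> N" for \<gamma> ks
      using that
    proof (induction ks)
      case Nil
      then show ?case using subringE(3)[OF subring] by simp
    next
      case (Cons k ks)
      have "c k [^] (m::nat) \<in> generate_ring R ?H" for m
      proof (induction m)
        case 0
        then show ?case using subringE(3)[OF subring] by simp
      next
        case (Suc m)
        have "c k \<in> generate_ring R ?H" using Cons.prems by (auto intro: generate_ring.incl)
        then show ?case using Suc by (simp add: generate_ring.eng_mult)
      qed
      then show ?case using Cons by (simp add: generate_ring.eng_mult)
    qed
    have tm: "kf (lookup F b) \<otimes> basis b \<in> generate_ring R ?H" if b: "b \<in> keys F" for b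
    proof -
      have "fst b = (\<lambda>_. 0)"
        by (rule central_support[OF F(1) _ b]) (use comm F(2) in auto)
      then have "basis b = cmon (snd b) vars" using basis_0[of "snd b"] by (metis prod.collapse)
      moreover obtain a where "lookup F b = const a"
        using central_coefficients[OF F(1) _ b] comm F(2) by blast
      moreover have "kf (const a) \<in> generate_ring R ?H" for a by (rule generate_ring.incl) blast
      ultimately show ?thesis
        using cmon_gen[of vars "snd b"] by (simp add: generate_ring.eng_mult)
    qed
    define t where "t b = kf (lookup F b) \<otimes> basis b" for b
    have tm: "t b \<in> generate_ring R ?H" "t b \<in> carrier R" if "b \<in> keys F" for b
      unfolding t_def using tm[OF that] generate_ring_in_carrier[OF H] by blast+
    have "finsum R t K \<in> generate_ring R ?H" if "finite K" "K \<subseteq> keys F" for K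
      using that
    proof (induction K)
      case empty
      then show ?case using subringE(2)[OF subring] by simp
    next
      case (insert b K)
      have b: "b \<in> keys F" and K: "K \<subseteq> keys F" using insert.prems by auto
      have "finsum R t (insert b K) = t b \<oplus> finsum R t K"
        by (rule finsum_insert[OF insert.hyps]) (use tm(2) b K in blast)+
      then show ?case using generate_ring.eng_add[OF tm(1)[OF b] insert.IH[OF K]] by simp
    qed
    then show "z \<in> generate_ring R ?H" unfolding F(2) combination_def t_def by simp
  qed
  show "generate_ring R ?H \<subseteq> ring_center R"
  proof
    fix z assume "z \<in> generate_ring R ?H"
    then show "z \<in> ring_center R"
    proof induction
      case one
      show ?case by (rule centerI) simp_all
    next
      case (incl h)
      then show ?case
      proof
        assume "h \<in> range (\<lambda>a. kf (const a))"
        then obtain a where h: "h = kf (const a)" by blast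
        show ?case unfolding h
          by (rule central_if_commutes_with_generators) (simp_all add: kf_commute const_x const_d)
      next
        assume "h \<in> c ` N"
        then obtain k where h: "h = c k" "k \<in> N" by blast
        show ?case unfolding h(1)
          by (rule central_if_commutes_with_generators)
            (simp_all add: kf_c x_c[OF _ N_ge_1[OF h(2)]] d_c[OF _ N_ge_1[OF h(2)]])
      qed
    next
      case (a_inv h)
      show ?case
      proof (rule centerI)
        show "\<ominus> h \<otimes> a = a \<otimes> \<ominus> h" if "a \<in> carrier R" for a
          using that center_closed[OF a_inv.IH] center_commutes[OF a_inv.IH that]
          by (simp only: l_minus r_minus)
      qed (use center_closed[OF a_inv.IH] in blast)
    next
      case (eng_add h1 h2)
      note h = center_closed[OF eng_add.IH(1)] center_closed[OF eng_add.IH(2)]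
      show ?case
      proof (rule centerI)
        show "(h1 \<oplus> h2) \<otimes> a = a \<otimes> (h1 \<oplus> h2)" if "a \<in> carrier R" for a
          using that h center_commutes[OF eng_add.IH(1) that] center_commutes[OF eng_add.IH(2) that]
          by (simp only: l_distr r_distr)
      qed (use h in blast)
    next
      case (eng_mult h1 h2)
      note h = center_closed[OF eng_mult.IH(1)] center_closed[OF eng_mult.IH(2)]
      show ?case
      proof (rule centerI)
        fix a assume a: "a \<in> carrier R"
        have "h1 \<otimes> h2 \<otimes> a = h1 \<otimes> (h2 \<otimes> a)" using h a by (rule m_assoc)
        also have "\<dots> = h1 \<otimes> (a \<otimes> h2)" unfolding center_commutes[OF eng_mult.IH(2) a] ..
        also have "\<dots> = (h1 \<otimes> a) \<otimes> h2" using h a by (simp only: m_assoc)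
        also have "\<dots> = (a \<otimes> h1) \<otimes> h2" unfolding center_commutes[OF eng_mult.IH(1) a] ..
        also have "\<dots> = a \<otimes> (h1 \<otimes> h2)" using h a by (simp only: m_assoc)
        finally show "h1 \<otimes> h2 \<otimes> a = a \<otimes> (h1 \<otimes> h2)" .
      qed (use h in blast)
    qed
  qed
qed

end

section \<open>The action of the free algebra on lattice functions\<close>

text \<open>
  Words act by composition and elements of the free algebra by linear extension, so it is enough to
  fix the action of the generators.
\<close>

fun gen_act :: "nat \<Rightarrow> 'k::idom hfrac dgen \<Rightarrow> 'k state \<Rightarrow> 'k state" where
  "gen_act n (Coeff u) f = (\<lambda>l. pconst (fshift l u) * f l)"
| "gen_act n (XGen j) f = (\<lambda>l. xcoef j l * f (l(j := l j - 1)))"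
| "gen_act n (DGen j) f = (\<lambda>l. dcoef n j l * f (l(j := l j + 1)))"

definition word_act :: "nat \<Rightarrow> 'k::idom hfrac dgen list \<Rightarrow> 'k state \<Rightarrow> 'k state" where
  "word_act n gs f = foldr (gen_act n) gs f"

definition act :: "nat \<Rightarrow> 'k::idom dalg \<Rightarrow> 'k state \<Rightarrow> 'k state" where
  "act n p f l = (\<Sum>w\<in>keys p. pconst (const (lookup p w)) * word_act n (letters w) f l)"

lemma word_act_Nil [simp]: "word_act n [] f = f"
  and word_act_Cons [simp]: "word_act n (g # gs) f = gen_act n g (word_act n gs f)"
  by (simp_all add: word_act_def)

lemma word_act_append: "word_act n (gs @ hs) f = word_act n gs (word_act n hs f)"
  by (induction gs) simp_all

lemma gen_act_linear: "gen_act n g (\<lambda>l. \<kappa> * f l + e l) = (\<lambda>l. \<kappa> * gen_act n g f l + gen_act n g e l)"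
  by (cases g) (auto simp: algebra_simps)

lemma word_act_linear: "word_act n gs (\<lambda>l. \<kappa> * f l + e l) = (\<lambda>l. \<kappa> * word_act n gs f l + word_act n gs e l)"
  by (induction gs) (simp_all add: gen_act_linear)

lemma word_act_zero: "word_act n gs (\<lambda>l. 0) = (\<lambda>l. 0)"
  using word_act_linear[of n gs "-1" "\<lambda>l. 0" "\<lambda>l. 0"] by simp

lemma unital_hom_pconst_const: "unital_hom (\<lambda>a. pconst (const a) :: 'k::idom hfrac hpoly)"
  by (rule unital_hom_comp[OF unital_hom_pconst unital_hom_const])

interpretation kc: unital_hom "\<lambda>a. pconst (const a) :: 'k::idom hfrac hpoly"
  by (rule unital_hom_pconst_const)

lemma act_superset:
  "finite S \<Longrightarrow> keys p \<subseteq> S \<Longrightarrow>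
    act n p f l = (\<Sum>w\<in>S. pconst (const (lookup p w)) * word_act n (letters w) f l)"
  unfolding act_def by (rule sum.mono_neutral_left) (auto simp: in_keys_iff kc.hom_zero)

lemma act_zero [simp]: "act n 0 f l = 0"
  by (simp add: act_def)

lemma act_single: "act n (single w a) f l = pconst (const a) * word_act n (letters w) f l"
  by (subst act_superset[of "{w}"]) auto

lemma act_add [simp]: "act n (p + q) f l = act n p f l + act n q f l"
proof -
  let ?S = "keys p \<union> keys q"
  have "keys (p + q) \<subseteq> ?S" by (rule Poly_Mapping.keys_add)
  then show ?thesis
    by (simp only: act_superset[of ?S] finite_Un finite_keys lookup_add kc.hom_add distrib_right
        sum.distrib Un_upper1 Un_upper2)
qed

lemma act_minus [simp]: "act n (- p) f l = - act n p f l"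
  using act_add[of n p "- p" f l] by (simp add: eq_neg_iff_add_eq_0 add.commute)

lemma act_diff [simp]: "act n (p - q) f l = act n p f l - act n q f l"
  using act_add[of n p "- q" f l] by simp

lemma act_sum [simp]: "act n (sum P I) f l = (\<Sum>i\<in>I. act n (P i) f l)"
  by (induction I rule: infinite_finite_induct) simp_all

lemma act_mult_single: "act n (single w a * q) f l = pconst (const a) * word_act n (letters w) (act n q f) l"
proof (induction q rule: term_induct)
  case zero
  have "act n 0 f = (\<lambda>l. 0)" by auto
  then show ?case by (simp add: word_act_zero)
next
  case (add v q)
  have "act n (single v b + q') f = (\<lambda>l. pconst (const b) * word_act n (letters v) f l + act n q' f l)" for b q'
    by (auto simp: act_single)
  then show ?case
    unfolding distrib_left act_add add.IH mult_single act_single kc.hom_mult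
    by (simp only: word_act_linear plus_word_def word.sel word_act_append distrib_left mult.assoc)
qed

lemma act_mult [simp]: "act n (p * q) f = act n p (act n q f)"
proof
  show "act n (p * q) f l = act n p (act n q f) l" for l
    by (induction p rule: term_induct) (simp_all add: distrib_right act_mult_single act_single)
qed

lemma act_gen [simp]: "act n (gen g) f = gen_act n g f"
  by (auto simp: gen_def act_single kc.hom_one)

lemma act_scal: "act n (scal a) f l = pconst (const a) * f l"
  by (simp add: scal_def act_single zero_word_def)

lemma act_one [simp]: "act n 1 f = f"
  using act_scal[of n 1 f] by (auto simp: scal_def kc.hom_one)

lemma act_scale: "act n p (\<lambda>l. \<kappa> * f l) = (\<lambda>l. \<kappa> * act n p f l)"
proof
  have "word_act n gs (\<lambda>l. \<kappa> * f l) = (\<lambda>l. \<kappa> * word_act n gs f l)" for gs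
    using word_act_linear[of n gs \<kappa> f "\<lambda>l. 0"] by (simp add: word_act_zero)
  then show "act n p (\<lambda>l. \<kappa> * f l) l = \<kappa> * act n p f l" for l
    by (simp add: act_def sum_distrib_left mult_ac)
qed

lemma fshift_hdiff_shifted_h: "fshift l (hdiff i j) = shifted_h l i - shifted_h l j"
  by (simp add: shifted_h_def hdiff_def)

lemma xcoef_upd_less: "i < j \<Longrightarrow> xcoef i (l(j := k)) = xcoef i l"
  unfolding xcoef_def
  by (intro arg_cong[where f = pconst] arg_cong2[where f = "(/)"] prod.cong) (auto simp: shifted_h_upd)

lemma dcoef_upd_less: "i < j \<Longrightarrow> dcoef n j (l(i := k)) = dcoef n j l"
  unfolding dcoef_def
  by (intro arg_cong[where f = pconst] arg_cong2[where f = "(*)"] arg_cong2[where f = "(/)"]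
      arg_cong[where f = "monic_value n pvar"] arg_cong[where f = uminus] prod.cong) (auto simp: shifted_h_upd)

lemma prod_upd_factor:
  fixes F G :: "nat \<Rightarrow> 'k::field"
  assumes "finite S" "i \<in> S" "\<And>m. m \<in> S - {i} \<Longrightarrow> G m = F m" "F i \<noteq> 0" "G i \<noteq> 0"
  shows "1 / prod G S = (1 / prod F S) * (F i / G i)"
proof -
  have "prod G S = G i * prod F (S - {i})"
    using assms by (simp add: prod.remove[of S i])
  moreover have "prod F S = F i * prod F (S - {i})"
    using assms by (simp add: prod.remove[of S i])
  ultimately show ?thesis using assms(4,5) by simp
qed

text \<open>
  A shift of \<open>l\<^sub>i\<close> with \<open>i < j\<close> changes exactly one of the factors of \<open>xcoef j\<close>; similarly for
  \<open>dcoef j\<close> and \<open>i > j\<close>. These ratios are the structure constants of the exchange relations.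
\<close>

lemma xcoef_upd_greater:
  assumes "1 \<le> i" "i < j"
  shows "xcoef j (l(i := l i + t))
    = xcoef j l * (pconst ((shifted_h l i - shifted_h l j + 1) / (shifted_h l i - shifted_h l j + 1 + of_int t)) :: 'k::idom hfrac hpoly)"
proof -
  let ?l = "l(i := l i + t)"
  have v: "shifted_h ?l i = (shifted_h l i + of_int t :: 'k hfrac)" "shifted_h ?l j = (shifted_h l j :: 'k hfrac)"
    using assms by (simp_all add: shifted_h_upd) (simp add: shifted_h_def)
  have "1 / (\<Prod>m\<in>{1..<j}. shifted_h ?l m - shifted_h ?l j + 1 :: 'k hfrac) = 1 / (\<Prod>m\<in>{1..<j}. shifted_h l m - shifted_h l j + 1)
      * ((shifted_h l i - shifted_h l j + 1) / (shifted_h ?l i - shifted_h ?l j + 1))"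
    by (rule prod_upd_factor) (use assms shifted_h_nonzero(2)[of i j ?l, where ?'k = 'k] in \<open>auto simp: v(2) shifted_h_upd\<close>)
  then show ?thesis
    unfolding xcoef_def pc.hom_mult[symmetric] v by (simp add: algebra_simps)
qed

lemma dcoef_upd_greater:
  assumes "j < i" "i \<le> n"
  shows "dcoef n j (l(i := l i + t))
    = dcoef n j l * (pconst ((shifted_h l i - shifted_h l j) / (shifted_h l i - shifted_h l j + of_int t)) :: 'k::idom hfrac hpoly)"
proof -
  let ?l = "l(i := l i + t)"
  have v: "shifted_h ?l i = (shifted_h l i + of_int t :: 'k hfrac)" "shifted_h ?l j = (shifted_h l j :: 'k hfrac)"
    using assms by (simp_all add: shifted_h_upd) (simp add: shifted_h_def)
  have "1 / (\<Prod>m\<in>{j<..n}. shifted_h ?l m - shifted_h ?l j :: 'k hfrac) = 1 / (\<Prod>m\<in>{j<..n}. shifted_h l m - shifted_h l j)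
      * ((shifted_h l i - shifted_h l j) / (shifted_h ?l i - shifted_h ?l j))"
    by (rule prod_upd_factor) (use assms shifted_h_nonzero(1)[of i j ?l, where ?'k = 'k] in \<open>auto simp: v(2) shifted_h_upd\<close>)
  then show ?thesis
    unfolding dcoef_def mult.assoc pc.hom_mult[symmetric] v by (simp add: algebra_simps)
qed

text \<open>
  The Lagrange formula at \<open>s = 1 - H\<^sub>i\<close>, divided by \<open>P = (\<Prod>m. s + H\<^sub>m)\<close>: there
  \<open>s + H\<^sub>j = 1 - (H\<^sub>i - H\<^sub>j)\<close> is the denominator in the relation for \<open>x i \<otimes> d i\<close>, and \<open>s\<close> is the
  value of \<open>- H\<^sub>i\<close> after \<open>l\<^sub>i\<close> is lowered by \<open>x i\<close>, where the factor of \<open>d i\<close> is taken.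
\<close>

lemma x_d_same_coefficient:
  assumes i: "i \<in> {1..n}"
  shows "xcoef i l * dcoef n i (l(i := l i - 1))
    = (\<Sum>j=1..n. pconst (1 / (1 - (shifted_h l i - shifted_h l j))) * gcoef n j l) - (1 :: 'k::idom hfrac hpoly)"
proof -
  define s where "s = (1 - shifted_h l i :: 'k hfrac)"
  define P where "P = (\<Prod>m\<in>{1..n}. s + shifted_h l m)"
  have nz: "s + shifted_h l m \<noteq> 0" for m
  proof (cases "m = i")
    case False
    have "s + shifted_h l m = shifted_h l m - shifted_h l i + 1" by (simp add: s_def)
    then show ?thesis using False by (metis shifted_h_nonzero(2))
  qed (simp add: s_def)
  then have P0: "P \<noteq> 0" by (simp add: P_def)
  have "(\<Sum>j=1..n. (\<Prod>m\<in>{1..n} - {j}. pconst s + pconst (shifted_h l m)) * gcoef n j l)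
      - (\<Prod>m=1..n. pconst s + pconst (shifted_h l m)) = (monic_value n pvar (pconst s) :: 'k hfrac hpoly)"
    by (rule gcoef_interpolation)
  then have sum: "(\<Sum>j=1..n. pconst (\<Prod>m\<in>{1..n} - {j}. s + shifted_h l m) * gcoef n j l) - pconst P
      = (monic_value n pvar (pconst s) :: 'k hfrac hpoly)"
    by (simp only: P_def pc.hom_prod pc.hom_add)
  \<comment> \<open>Omitting the factor \<open>j\<close> from \<open>P\<close> amounts to dividing by the denominator of the \<open>j\<close>-th term of the relation.\<close>
  have rem: "(\<Prod>m\<in>{1..n} - {j}. s + shifted_h l m) = P * (1 / (1 - (shifted_h l i - shifted_h l j)))" if "j \<in> {1..n}" for j
  proof -
    have "P = (s + shifted_h l j) * (\<Prod>m\<in>{1..n} - {j}. s + shifted_h l m)"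
      unfolding P_def using that by (intro prod.remove) auto
    moreover have d: "1 - (shifted_h l i - shifted_h l j) = s + shifted_h l j" by (simp add: s_def)
    ultimately show ?thesis unfolding d using nz[of j] by simp
  qed
  have "pconst P * ((\<Sum>j=1..n. pconst (1 / (1 - (shifted_h l i - shifted_h l j))) * gcoef n j l) - 1)
      = (\<Sum>j=1..n. pconst (P * (1 / (1 - (shifted_h l i - shifted_h l j)))) * gcoef n j l) - pconst P"
    by (simp only: right_diff_distrib sum_distrib_left pc.hom_mult mult.assoc mult_1_right)
  also have "(\<Sum>j=1..n. pconst (P * (1 / (1 - (shifted_h l i - shifted_h l j)))) * gcoef n j l)
      = (\<Sum>j=1..n. pconst (\<Prod>m\<in>{1..n} - {j}. s + shifted_h l m) * gcoef n j l)"
    by (rule sum.cong[OF refl]) (simp only: rem)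
  finally have P_sum: "pconst P * ((\<Sum>j=1..n. pconst (1 / (1 - (shifted_h l i - shifted_h l j))) * gcoef n j l) - 1)
      = (monic_value n pvar (pconst s) :: 'k hfrac hpoly)"
    unfolding sum .
  have inv: "pconst (1 / P) * pconst P = (1 :: 'k hfrac hpoly)"
    using P0 by (simp flip: pc.hom_mult)
  have sum': "(\<Sum>j=1..n. pconst (1 / (1 - (shifted_h l i - shifted_h l j))) * gcoef n j l) - 1
      = pconst (1 / P) * (monic_value n pvar (pconst s) :: 'k hfrac hpoly)"
    unfolding P_sum[symmetric] mult.assoc[symmetric] inv mult_1_left ..
  \<comment> \<open>\<open>P1\<close> is the denominator of \<open>xcoef i\<close> at \<open>l\<close>, \<open>P2\<close> that of \<open>dcoef n i\<close> at the lowered point; the remaining factor \<open>s + H\<^sub>i\<close> of \<open>P\<close> is \<open>1\<close>.\<close>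
  define P1 P2 where "P1 = (\<Prod>m\<in>{1..<i}. s + shifted_h l m)" and "P2 = (\<Prod>m\<in>{i<..n}. s + shifted_h l m)"
  have P: "P = P1 * P2"
  proof -
    have "P = (s + shifted_h l i) * (\<Prod>m\<in>{1..n} - {i}. s + shifted_h l m)"
      unfolding P_def using i by (intro prod.remove) auto
    then show ?thesis unfolding prod_remove_split[OF i] P1_def P2_def by (simp add: s_def)
  qed
  have x: "xcoef i l = (pconst (1 / P1) :: 'k hfrac hpoly)"
    by (simp add: xcoef_def P1_def s_def algebra_simps)
  have "(\<Prod>m\<in>{i<..n}. shifted_h (l(i := l i - 1)) m - shifted_h (l(i := l i - 1)) i) = P2"
    unfolding P2_def by (intro prod.cong refl) (auto simp: s_def shifted_h_def)
  moreover have "- shifted_h (l(i := l i - 1)) i = s"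
    by (simp add: s_def shifted_h_def)
  ultimately have d: "dcoef n i (l(i := l i - 1)) = monic_value n pvar (pconst s) * (pconst (1 / P2) :: 'k hfrac hpoly)"
    unfolding dcoef_def by (simp only:)
  have "pconst (1 / P) = (pconst (1 / P1) * pconst (1 / P2) :: 'k hfrac hpoly)"
    unfolding P by (simp flip: pc.hom_mult)
  then show ?thesis unfolding sum' x d by (simp only: mult_ac)
qed

lemma act_cf_mult: "act n (cf u * p * q) f l = pconst (fshift l u) * act n (p * q) f l"
  by simp

lemma act_X_X: "i \<noteq> j \<Longrightarrow> act n (X i * X j) f l
    = xcoef i l * xcoef j (l(i := l i - 1)) * f (l(i := l i - 1, j := l j - 1))"
  by (simp add: mult.assoc)

lemma act_D_D: "i \<noteq> j \<Longrightarrow> act n (D i * D j) f l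
    = dcoef n i l * dcoef n j (l(i := l i + 1)) * f (l(i := l i + 1, j := l j + 1))"
  by (simp add: mult.assoc)

lemma act_X_D: "i \<noteq> j \<Longrightarrow> act n (X i * D j) f l
    = xcoef i l * dcoef n j (l(i := l i - 1)) * f (l(i := l i - 1, j := l j + 1))"
  by (simp add: mult.assoc)

lemma act_D_X: "i \<noteq> j \<Longrightarrow> act n (D j * X i) f l
    = dcoef n j l * xcoef i (l(j := l j + 1)) * f (l(i := l i - 1, j := l j + 1))"
  by (simp add: mult.assoc fun_upd_twist)

lemma act_D_X_same: "act n (D j * X j) f l = gcoef n j l * f l"
  by (simp add: gcoef_def)

text \<open>
  The shape in which the exchange relations arise: both sides carry the factors \<open>c\<close>, \<open>d\<close> and \<open>y\<close>, and
  only the ratios \<open>e\<close> and \<open>b\<close> and the structure constant \<open>a\<close> need comparison.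
\<close>

lemma collect_coefficients:
  fixes a :: "'a::comm_ring_1"
  assumes "a * b = e"
  shows "c * (d * e) * y = a * (d * (c * b) * y)"
  unfolding assms[symmetric] by (simp only: mult_ac)

text \<open>
  A relation that exchanges two generators with distinct indices compares their translation factors
  in the two orders, which is an identity between the ratios above. The relation for equal indices is
  \<open>x_d_same_coefficient\<close>.
\<close>

lemma act_relator:
  assumes "r \<in> relators n"
  shows "act n r f l = (0 :: 'k::idom hfrac hpoly)"
  using assms
proof cases
  case (cf_add u v)
  show ?thesis unfolding cf_add(1) by (simp add: algebra_simps)
next
  case (cf_mult u v)
  show ?thesis unfolding cf_mult(1) by (simp add: algebra_simps)
next
  case (cf_const a)
  show ?thesis unfolding cf_const by (simp add: act_scal)
next
  case (h_X i j)
  have eq: "act n (cf u * X j - X j * cf v) f l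
      = (pconst (fshift l u) - pconst (fshift (l(j := l j - 1)) v)) * (xcoef j l * f (l(j := l j - 1)))" for u v
    by (simp add: algebra_simps)
  have "fshift l (hh i) = (fshift (l(j := l j - 1)) (hh i + (if i = j then 1 else 0)) :: 'k hfrac)" by simp
  then show ?thesis unfolding h_X(1) eq by (simp only: diff_self mult_zero_left)
next
  case (h_D i j)
  have eq: "act n (cf u * D j - D j * cf v) f l
      = (pconst (fshift l u) - pconst (fshift (l(j := l j + 1)) v)) * (dcoef n j l * f (l(j := l j + 1)))" for u v
    by (simp add: algebra_simps)
  have "fshift l (hh i) = (fshift (l(j := l j + 1)) (hh i - (if i = j then 1 else 0)) :: 'k hfrac)" by simp
  then show ?thesis unfolding h_D(1) eq by (simp only: diff_self mult_zero_left)
next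
  case (X_X i j)
  define h where "h = (shifted_h l i - shifted_h l j :: 'k hfrac)"
  have ij: "i \<noteq> j" "j \<noteq> i" "1 \<le> i" using X_X by auto
  have j: "xcoef j (l(i := l i - 1)) = xcoef j l * (pconst ((h + 1) / h) :: 'k hfrac hpoly)"
    using xcoef_upd_greater[of i j l "-1"] X_X ij by (simp add: h_def)
  have i: "xcoef i (l(j := l j - 1)) = (xcoef i l :: 'k hfrac hpoly)" using X_X by (intro xcoef_upd_less)
  have u: "fshift l ((hdiff i j + 1) / hdiff i j) = (h + 1) / h"
    by (simp only: fshift_divide fshift.hom_add fshift.hom_one fshift_hdiff_shifted_h h_def)
  show ?thesis
    unfolding X_X(1) act_diff act_cf_mult act_X_X[OF ij(1)] act_X_X[OF ij(2)] u i j fun_upd_twist[OF ij(1)]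
    by (simp only: mult_ac diff_self)
next
  case (D_D i j)
  define h where "h = (shifted_h l i - shifted_h l j :: 'k hfrac)"
  have ij: "i \<noteq> j" "j \<noteq> i" "i \<le> n" "j \<le> n" using D_D by auto
  have h: "h \<noteq> 0" "h - 1 \<noteq> 0" "- h + 1 \<noteq> 0"
    using shifted_h_difference_nonzero[OF ij(1), of l 0, where ?'k = 'k]
      shifted_h_difference_nonzero[OF ij(1), of l "-1", where ?'k = 'k]
      shifted_h_difference_nonzero[OF ij(2), of l 1, where ?'k = 'k] by (simp_all add: h_def)
  have j: "dcoef n j (l(i := l i + 1)) = (dcoef n j l :: 'k hfrac hpoly)"
    using D_D by (intro dcoef_upd_less)
  have i: "dcoef n i (l(j := l j + 1)) = dcoef n i l * (pconst (- h / (- h + 1)) :: 'k hfrac hpoly)"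
    using dcoef_upd_greater[of i j n l 1] D_D ij by (simp add: h_def)
  have u: "fshift l ((hdiff i j - 1) / hdiff i j) = (h - 1) / h"
    by (simp only: fshift_divide fshift.hom_diff fshift.hom_one fshift_hdiff_shifted_h h_def)
  have "((h - 1) / h) * (- h / (- h + 1)) = 1" using h by (simp add: field_simps)
  then have e: "pconst ((h - 1) / h) * pconst (- h / (- h + 1)) = (1 :: 'k hfrac hpoly)"
    by (metis pc.hom_mult pc.hom_one)
  have "dcoef n i l * dcoef n j l * y = pconst ((h - 1) / h) * (dcoef n j l * (dcoef n i l * pconst (- h / (- h + 1))) * y)"
    for y :: "'k hfrac hpoly"
    using collect_coefficients[OF e, of "dcoef n i l" "dcoef n j l" y] by (simp only: mult_1_right)
  then show ?thesis
    unfolding D_D(1) act_diff act_cf_mult act_D_D[OF ij(1)] act_D_D[OF ij(2)] u i j fun_upd_twist[OF ij(1)]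
    by (simp only: diff_self)
next
  case (X_D_less i j)
  have ij: "i \<noteq> j" using X_D_less by simp
  have i: "xcoef i (l(j := l j + 1)) = (xcoef i l :: 'k hfrac hpoly)" using X_D_less by (intro xcoef_upd_less)
  have j: "dcoef n j (l(i := l i - 1)) = (dcoef n j l :: 'k hfrac hpoly)" using X_D_less by (intro dcoef_upd_less)
  show ?thesis unfolding X_D_less(1) act_diff act_X_D[OF ij] act_D_X[OF ij] i j
    by (simp only: mult_ac diff_self)
next
  case (X_D_greater i j)
  define h where "h = (shifted_h l i - shifted_h l j :: 'k hfrac)"
  have ij: "i \<noteq> j" "i \<le> n" "1 \<le> j" using X_D_greater by auto
  have h: "h - 1 \<noteq> 0" "h - 2 \<noteq> 0"
    using shifted_h_difference_nonzero[OF ij(1), of l "-1", where ?'k = 'k]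
      shifted_h_difference_nonzero[OF ij(1), of l "-2", where ?'k = 'k] by (auto simp: h_def)
  have j: "dcoef n j (l(i := l i - 1)) = dcoef n j l * (pconst (h / (h - 1)) :: 'k hfrac hpoly)"
    using dcoef_upd_greater[of j i n l "-1"] X_D_greater ij by (simp add: h_def)
  have i: "xcoef i (l(j := l j + 1)) = xcoef i l * (pconst ((- h + 1) / (- h + 2)) :: 'k hfrac hpoly)"
  proof -
    have d: "shifted_h l j - shifted_h l i + 1 + of_int 1 = - h + 2" "shifted_h l j - shifted_h l i + 1 = - h + 1"
      by (simp_all add: h_def)
    show ?thesis
      unfolding xcoef_upd_greater[OF ij(3) X_D_greater(4)] d(1) unfolding d(2) ..
  qed
  have u: "fshift l (hdiff i j * (hdiff i j - 2) / (hdiff i j - 1)\<^sup>2) = h * (h - 2) / (h - 1)\<^sup>2"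
    by (simp only: fshift_divide fshift.hom_diff fshift.hom_mult fshift.hom_power fshift.hom_one
        fshift.hom_numeral fshift_hdiff_shifted_h h_def)
  have "(h * (h - 2) / (h - 1)\<^sup>2) * ((- h + 1) / (- h + 2)) = h / (h - 1)"
  proof -
    have "(- h + 1) / (- h + 2) = (h - 1) / (h - 2)"
      using minus_divide_divide[of "h - 1" "h - 2"] by simp
    moreover have "h * b / a\<^sup>2 * (a / b) = h / a" if "a \<noteq> 0" "b \<noteq> 0" for a b :: "'k hfrac"
      using that by (simp add: power2_eq_square)
    ultimately show ?thesis using h by (simp only: not_False_eq_True)
  qed
  then have e: "pconst (h * (h - 2) / (h - 1)\<^sup>2) * pconst ((- h + 1) / (- h + 2)) = (pconst (h / (h - 1)) :: 'k hfrac hpoly)"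
    by (metis pc.hom_mult)
  have "xcoef i l * (dcoef n j l * pconst (h / (h - 1))) * y
      = pconst (h * (h - 2) / (h - 1)\<^sup>2) * (dcoef n j l * (xcoef i l * pconst ((- h + 1) / (- h + 2))) * y)"
    for y :: "'k hfrac hpoly"
    by (rule collect_coefficients[OF e])
  then show ?thesis
    unfolding X_D_greater(1) act_diff act_cf_mult act_X_D[OF ij(1)] act_D_X[OF ij(1)] u i j
    by (simp only: diff_self)
next
  case (X_D_same i)
  have "act n (X i * D i) f l = xcoef i l * dcoef n i (l(i := l i - 1)) * f l"
    by (simp add: mult.assoc)
  moreover have "act n (\<Sum>j=1..n. cf (1 / (1 - hdiff i j)) * D j * X j) f l
      = (\<Sum>j=1..n. pconst (1 / (1 - (shifted_h l i - shifted_h l j))) * gcoef n j l) * f l"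
    unfolding act_sum sum_distrib_right act_cf_mult act_D_X_same
    by (simp only: fshift_divide fshift.hom_diff fshift.hom_one fshift_hdiff_shifted_h mult.assoc)
  ultimately show ?thesis
    unfolding X_D_same(1) act_diff act_one x_d_same_coefficient[OF X_D_same(2)]
    by (simp add: left_diff_distrib)
qed

section \<open>Passing to the quotient\<close>

lemma free_simps:
  "p \<otimes>\<^bsub>free_algebra G\<^esub> q = p * q" "\<one>\<^bsub>free_algebra G\<^esub> = 1"
  "\<zero>\<^bsub>free_algebra G\<^esub> = 0" "p \<oplus>\<^bsub>free_algebra G\<^esub> q = p + q"
  by (simp_all add: free_algebra_def)

lemma Diff_ideal_ideal: "ideal (Diff_ideal n :: 'k::idom dalg set) (free_algebra (dgens n))"
  unfolding Diff_ideal_def by (intro ring.genideal_ideal free_algebra_ring relators_carrier)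

lemma Diff_class_hom: "Diff_class n \<in> ring_hom (free_algebra (dgens n) :: 'k::idom dalg ring) (Diff_h n)"
proof -
  interpret ideal "Diff_ideal n :: 'k dalg set" "free_algebra (dgens n)" by (rule Diff_ideal_ideal)
  show ?thesis using rcos_ring_hom unfolding Diff_class_def Diff_h_def by simp
qed

lemma Diff_class_closed: "p \<in> free_carrier n \<Longrightarrow> Diff_class n p \<in> carrier (Diff_h n :: 'k::idom dalg set ring)"
  by (rule ring_hom_closed[OF Diff_class_hom])

lemma Diff_class_mult: "p \<in> free_carrier n \<Longrightarrow> q \<in> free_carrier n
    \<Longrightarrow> Diff_class n (p * q) = Diff_class n p \<otimes>\<^bsub>Diff_h n\<^esub> (Diff_class n q :: 'k::idom dalg set)"
  using ring_hom_mult[OF Diff_class_hom, of p n q] by (simp add: free_simps)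

lemma Diff_class_add: "p \<in> free_carrier n \<Longrightarrow> q \<in> free_carrier n
    \<Longrightarrow> Diff_class n (p + q) = Diff_class n p \<oplus>\<^bsub>Diff_h n\<^esub> (Diff_class n q :: 'k::idom dalg set)"
  using ring_hom_add[OF Diff_class_hom, of p n q] by (simp add: free_simps)

lemma Diff_class_one: "Diff_class n 1 = \<one>\<^bsub>Diff_h n :: 'k::idom dalg set ring\<^esub>"
  using ring_hom_one[OF Diff_class_hom] by (simp add: free_simps)

lemma Diff_class_zero: "Diff_class n 0 = \<zero>\<^bsub>Diff_h n :: 'k::idom dalg set ring\<^esub>"
  using ring_hom_zero[OF Diff_class_hom free_algebra_ring Diff_ring] by (simp add: free_simps)

lemma Diff_class_carrier: "carrier (Diff_h n) = Diff_class n ` (free_carrier n :: 'k::idom dalg set)"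
  unfolding Diff_h_def Diff_class_def FactRing_def A_RCOSETS_def' by auto

lemma Diff_class_diff:
  assumes "p \<in> free_carrier n" "q \<in> free_carrier n"
  shows "Diff_class n (p - q) = Diff_class n p \<ominus>\<^bsub>Diff_h n\<^esub> (Diff_class n q :: 'k::idom dalg set)"
proof -
  interpret ring "Diff_h n :: 'k dalg set ring" by (rule Diff_ring)
  have d: "p - q \<in> free_carrier n" by (rule free_diff[OF assms])
  have "Diff_class n p = Diff_class n ((p - q) + q)" by simp
  also have "\<dots> = Diff_class n (p - q) \<oplus>\<^bsub>Diff_h n\<^esub> Diff_class n q"
    by (rule Diff_class_add[OF d assms(2)])
  finally show ?thesis
    using Diff_class_closed[OF d] Diff_class_closed[OF assms(2)] by (simp add: a_minus_def a_assoc r_neg)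
qed

lemma Diff_class_sum:
  assumes "finite I" "\<And>i. i \<in> I \<Longrightarrow> f i \<in> free_carrier n"
  shows "Diff_class n (sum f I) = (\<Oplus>\<^bsub>Diff_h n\<^esub>i\<in>I. Diff_class n (f i) :: 'k::idom dalg set)"
  using assms
proof (induction I)
  interpret ring "Diff_h n :: 'k dalg set ring" by (rule Diff_ring)
  case empty
  show ?case by (simp add: Diff_class_zero)
next
  interpret ring "Diff_h n :: 'k dalg set ring" by (rule Diff_ring)
  case (insert i I)
  have "Diff_class n (sum f (insert i I)) = Diff_class n (f i) \<oplus>\<^bsub>Diff_h n\<^esub> Diff_class n (sum f I)"
    using insert by (simp add: Diff_class_add free_sum)
  also have "\<dots> = Diff_class n (f i) \<oplus>\<^bsub>Diff_h n\<^esub> (\<Oplus>\<^bsub>Diff_h n\<^esub>i\<in>I. Diff_class n (f i))"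
    using insert by simp
  also have "\<dots> = (\<Oplus>\<^bsub>Diff_h n\<^esub>i\<in>insert i I. Diff_class n (f i))"
    using insert by (intro finsum_insert[symmetric]) (auto intro: Diff_class_closed)
  finally show ?case .
qed

lemma Diff_class_eq_zero_iff:
  assumes p: "p \<in> free_carrier n"
  shows "Diff_class n p = \<zero>\<^bsub>Diff_h n :: 'k::idom dalg set ring\<^esub> \<longleftrightarrow> p \<in> Diff_ideal n"
proof -
  interpret ideal "Diff_ideal n :: 'k dalg set" "free_algebra (dgens n)" by (rule Diff_ideal_ideal)
  have coset: "Diff_class n r = Diff_ideal n" if "r \<in> Diff_ideal n" for r :: "'k dalg"
    unfolding Diff_class_def by (rule a_rcos_zero[OF Diff_ideal_ideal that])
  have "0 \<in> (Diff_ideal n :: 'k dalg set)"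
    using additive_subgroup.zero_closed[OF ideal.axioms(1)[OF Diff_ideal_ideal]] by (simp add: free_simps)
  then have zero: "\<zero>\<^bsub>Diff_h n :: 'k dalg set ring\<^esub> = Diff_ideal n"
    using coset Diff_class_zero by metis
  show ?thesis unfolding zero
    using coset rcos_const_imp_mem[OF p] by (auto simp: Diff_class_def)
qed

lemma Diff_class_relator:
  assumes "p - q \<in> relators n" "p \<in> free_carrier n" "q \<in> free_carrier n"
  shows "Diff_class n p = (Diff_class n q :: 'k::idom dalg set)"
proof -
  interpret ring "Diff_h n :: 'k dalg set ring" by (rule Diff_ring)
  have "relators n \<subseteq> (Diff_ideal n :: 'k dalg set)"
    unfolding Diff_ideal_def by (intro ring.genideal_self free_algebra_ring relators_carrier)
  then have mem: "p - q \<in> Diff_ideal n" using assms(1) by blast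
  then have "Diff_class n (p - q) = Diff_class n 0"
    unfolding Diff_class_zero Diff_class_eq_zero_iff[OF free_diff[OF assms(2,3)]] .
  then have "Diff_class n p \<ominus>\<^bsub>Diff_h n\<^esub> Diff_class n q = \<zero>\<^bsub>Diff_h n\<^esub>"
    unfolding Diff_class_diff[OF assms(2,3)] Diff_class_zero .
  then show ?thesis using Diff_class_closed[OF assms(2)] Diff_class_closed[OF assms(3)] by simp
qed

lemma Diff_class_relator_mult:
  assumes "p * q - r * s \<in> relators n" "p \<in> free_carrier n" "q \<in> free_carrier n"
    "r \<in> free_carrier n" "s \<in> free_carrier n"
  shows "Diff_class n p \<otimes>\<^bsub>Diff_h n\<^esub> Diff_class n q
    = Diff_class n r \<otimes>\<^bsub>Diff_h n\<^esub> (Diff_class n s :: 'k::idom dalg set)"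
  using Diff_class_relator[OF assms(1)] assms(2-) by (simp add: Diff_class_mult free_mult)

lemma Diff_class_relator_coeff:
  assumes "p * q - u * r * s \<in> relators n" "p \<in> free_carrier n" "q \<in> free_carrier n"
    "u \<in> free_carrier n" "r \<in> free_carrier n" "s \<in> free_carrier n"
  shows "Diff_class n p \<otimes>\<^bsub>Diff_h n\<^esub> Diff_class n q
    = Diff_class n u \<otimes>\<^bsub>Diff_h n\<^esub> Diff_class n r \<otimes>\<^bsub>Diff_h n\<^esub> (Diff_class n s :: 'k::idom dalg set)"
  using Diff_class_relator[OF assms(1)] assms(2-) by (simp add: Diff_class_mult free_mult)

text \<open>
  The annihilator of a representation is an ideal, so it contains the ideal generated by the
  relators.
\<close>

lemma act_Diff_ideal:
  assumes "p \<in> Diff_ideal n"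
  shows "act n p f l = (0 :: 'k::idom hfrac hpoly)"
proof -
  let ?A = "{p \<in> free_carrier n. \<forall>f l. act n p f l = (0 :: 'k hfrac hpoly)}"
  interpret F: ring "free_algebra (dgens n) :: 'k dalg ring" by (rule free_algebra_ring)
  have neg: "\<ominus>\<^bsub>free_algebra (dgens n)\<^esub> p = - p" if "p \<in> free_carrier n" for p :: "'k dalg"
  proof (rule F.minus_equality)
    show "- p \<in> free_carrier n" using free_diff[OF F.zero_closed that] by (simp add: free_simps)
  qed (use that in \<open>simp_all add: free_simps\<close>)
  have zero: "act n q (act n p f) l = 0" if "\<forall>f l. act n p f l = 0" for p q :: "'k dalg" and f l
  proof -
    have "act n p f = (\<lambda>l. 0 * f l)" using that by auto
    then show ?thesis using act_scale[of n q 0 f] by simp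
  qed
  have "ideal ?A (free_algebra (dgens n))"
  proof (rule idealI)
    show "subgroup ?A (add_monoid (free_algebra (dgens n)))"
    proof
      show "?A \<subseteq> carrier (add_monoid (free_algebra (dgens n)))" by auto
      show "\<one>\<^bsub>add_monoid (free_algebra (dgens n))\<^esub> \<in> ?A"
        using F.zero_closed by (auto simp: free_simps)
      show "p \<otimes>\<^bsub>add_monoid (free_algebra (dgens n))\<^esub> q \<in> ?A" if "p \<in> ?A" "q \<in> ?A" for p q
        using that by (auto simp: free_simps free_add)
      show "inv\<^bsub>add_monoid (free_algebra (dgens n))\<^esub> p \<in> ?A" if "p \<in> ?A" for p
        using that neg[of p] F.a_inv_closed[of p] by (auto simp: a_inv_def)
    qed
  qed (use free_algebra_ring zero in \<open>auto simp: free_simps free_mult\<close>)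
  moreover have "relators n \<subseteq> ?A" using relators_carrier act_relator by blast
  ultimately have "Diff_ideal n \<subseteq> ?A"
    unfolding Diff_ideal_def by (rule F.genideal_minimal)
  then show ?thesis using assms by blast
qed

lemma Diff_class_scal: "Diff_class n (scal a) = (Diff_class n (cf (const a)) :: 'k::idom dalg set)"
  by (rule Diff_class_relator[OF cf_const free_cf free_scal, symmetric]) (intro Ubar_poly U_h_const)

text \<open>
  The action of a coset through any of its representatives; \<open>rho_class\<close> shows that the choice is
  irrelevant.
\<close>

definition rho :: "nat \<Rightarrow> 'k::idom dalg set \<Rightarrow> 'k state \<Rightarrow> 'k state" where
  "rho n z = act n (SOME p. p \<in> free_carrier n \<and> Diff_class n p = z)"

lemma rho_class:
  assumes p: "p \<in> free_carrier n"
  shows "rho n (Diff_class n p) f = (act n p f :: 'k::idom state)"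
proof -
  interpret ring "Diff_h n :: 'k dalg set ring" by (rule Diff_ring)
  define q where "q = (SOME q. q \<in> free_carrier n \<and> Diff_class n q = Diff_class n p)"
  have q: "q \<in> free_carrier n" "Diff_class n q = Diff_class n p"
    using someI[of "\<lambda>q. q \<in> free_carrier n \<and> Diff_class n q = Diff_class n p" p] p
    unfolding q_def by blast+
  have "Diff_class n (q - p) = \<zero>\<^bsub>Diff_h n\<^esub>"
    unfolding Diff_class_diff[OF q(1) p] q(2) using Diff_class_closed[OF p] by (simp add: a_minus_def r_neg)
  then have "q - p \<in> Diff_ideal n" using Diff_class_eq_zero_iff[OF free_diff[OF q(1) p]] by blast
  from act_Diff_ideal[OF this] have "act n q f l = act n p f l" for l by simp
  then show ?thesis unfolding rho_def q_def[symmetric] by (rule ext)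
qed

text \<open>
  Scalars act through \<open>cf\<close> by the relator \<open>cf_const\<close>, so closure under left multiplication by the
  generators covers the terms of the free algebra with their coefficients.
\<close>

lemma Diff_h_generated:
  fixes n :: nat and S :: "'k::idom dalg set set"
  defines "R \<equiv> Diff_h n :: 'k dalg set ring"
  assumes "S \<subseteq> carrier R" and one: "\<one>\<^bsub>R\<^esub> \<in> S" and plus: "\<And>a b. a \<in> S \<Longrightarrow> b \<in> S \<Longrightarrow> a \<oplus>\<^bsub>R\<^esub> b \<in> S"
    and kf: "\<And>u a. u \<in> Ubar_h n \<Longrightarrow> a \<in> S \<Longrightarrow> Diff_class n (cf u) \<otimes>\<^bsub>R\<^esub> a \<in> S"
    and x: "\<And>j a. j \<in> {1..n} \<Longrightarrow> a \<in> S \<Longrightarrow> Diff_class n (X j) \<otimes>\<^bsub>R\<^esub> a \<in> S"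
    and d: "\<And>j a. j \<in> {1..n} \<Longrightarrow> a \<in> S \<Longrightarrow> Diff_class n (D j) \<otimes>\<^bsub>R\<^esub> a \<in> S"
  shows "carrier R \<subseteq> S"
proof -
  have word: "single (Word gs) 1 \<in> (free_carrier n :: 'k dalg set)
      \<and> Diff_class n (single (Word gs) 1) \<in> S" if "set gs \<subseteq> dgens n" for gs
    using that
  proof (induction gs)
    case Nil
    have "single (Word []) 1 = (1 :: 'k dalg)" by (simp add: zero_word_def[symmetric])
    then show ?case using one free_one Diff_class_one unfolding R_def by metis
  next
    case (Cons g gs)
    let ?p = "single (Word gs) 1 :: 'k dalg"
    have g: "g \<in> dgens n" and p: "?p \<in> free_carrier n" "Diff_class n ?p \<in> S" using Cons by auto
    have eq: "single (Word (g # gs)) 1 = gen g * ?p"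
      by (simp add: gen_def mult_single plus_word_def)
    have "Diff_class n (gen g * ?p) = Diff_class n (gen g) \<otimes>\<^bsub>R\<^esub> Diff_class n ?p"
      unfolding R_def by (rule Diff_class_mult[OF free_gen[OF g] p(1)])
    also have "\<dots> \<in> S" using g kf x d p(2) unfolding dgens_def by blast
    finally show ?case unfolding eq using free_mult[OF free_gen[OF g] p(1)] by blast
  qed
  interpret ring R unfolding R_def by (rule Diff_ring)
  have scal: "Diff_class n (scal a) \<otimes>\<^bsub>R\<^esub> b \<in> S" if "b \<in> S" for a b
    unfolding Diff_class_scal using that by (intro kf Ubar_poly U_h_const)
  have "Diff_class n p \<in> S" if p: "p \<in> free_carrier n" for p
  proof (induction p rule: term_induct)
    case zero
    have "scal 0 = (0 :: 'k dalg)" by (simp add: scal_def)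
    then show ?case using scal[OF one, of 0] unfolding R_def by (simp add: Diff_class_zero ring.ring_simprules[OF Diff_ring])
  next
    case (add w q)
    let ?a = "lookup p w"
    have w: "set (letters w) \<subseteq> dgens n" using p add by (simp add: free_algebra_def)
    have q: "q \<in> free_carrier n" using p add by (auto simp: free_algebra_def)
    have eq: "single w ?a = scal ?a * single (Word (letters w)) 1"
      by (simp add: scal_def mult_single)
    have s: "single w ?a \<in> free_carrier n"
      unfolding eq using word[OF w] by (blast intro: free_mult free_scal)
    have "Diff_class n (single w ?a) \<in> S"
      unfolding eq using word[OF w] scal Diff_class_mult[OF free_scal, of _ n ?a] unfolding R_def by metis
    then show ?case
      using add.IH plus Diff_class_add[OF s q] unfolding R_def by metis
  qed
  then show ?thesis unfolding R_def Diff_class_carrier by blast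
qed

context
  fixes n :: nat
begin

lemma Ubar_coefficients:
  assumes "i \<in> {1..n}" "j \<in> {1..n}" "i \<noteq> j"
  shows "(hdiff i j + 1) / hdiff i j \<in> (Ubar_h n :: 'k::idom hfrac set)"
    "(hdiff i j - 1) / hdiff i j \<in> (Ubar_h n :: 'k hfrac set)"
    "hdiff i j * (hdiff i j - 2) / (hdiff i j - 1)\<^sup>2 \<in> (Ubar_h n :: 'k hfrac set)"
    "1 / (1 - hdiff i j) \<in> (Ubar_h n :: 'k hfrac set)"
proof -
  have inv: "inverse (hdiff i j) \<in> (Ubar_h n :: 'k hfrac set)" "inverse (hdiff i j - 1) \<in> (Ubar_h n :: 'k hfrac set)"
    using Ubar_inverse_shift[OF assms, of 0] Ubar_inverse_shift[OF assms, of "-1"] by simp_all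
  have two: "2 \<in> (Ubar_h n :: 'k hfrac set)" using Ubar_of_int[of 2 n] by simp
  note intros = Ubar_mult Ubar_add Ubar_diff Ubar_hdiff Ubar_one two inv assms(1,2)
  show "(hdiff i j + 1) / hdiff i j \<in> (Ubar_h n :: 'k hfrac set)"
    "(hdiff i j - 1) / hdiff i j \<in> (Ubar_h n :: 'k hfrac set)"
    unfolding divide_inverse by (intro intros)+
  show "hdiff i j * (hdiff i j - 2) / (hdiff i j - 1)\<^sup>2 \<in> (Ubar_h n :: 'k hfrac set)"
    unfolding divide_inverse power2_eq_square inverse_mult_distrib by (intro intros)
  have "inverse (hdiff j i + of_int 1) \<in> (Ubar_h n :: 'k hfrac set)"
    by (rule Ubar_inverse_shift) (use assms in auto)
  moreover have "1 - hdiff i j = (hdiff j i + of_int 1 :: 'k hfrac)" by (simp add: hdiff_def)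
  ultimately show "1 / (1 - hdiff i j) \<in> (Ubar_h n :: 'k hfrac set)"
    by (simp only: divide_inverse mult_1_left)
qed

lemma Diff_h_relations:
  "diff_relations (Diff_h n) n {1..n} (Ubar_h n) (\<lambda>u. Diff_class n (cf u))
    (\<lambda>j. Diff_class n (X j)) (\<lambda>j. Diff_class n (D j) :: 'k::idom dalg set)"
proof -
  interpret ring "Diff_h n :: 'k dalg set ring" by (rule Diff_ring)
  note closed = free_cf free_X free_D free_mult
  have const_scal: "Diff_class n (cf (const a)) = (Diff_class n (scal a) :: 'k dalg set)" for a
    by (rule Diff_class_scal[symmetric])
  have scal_commute: "scal a * p = p * scal a" for a and p :: "'k dalg"
  proof (induction p rule: term_induct)
    case (add w q)
    then show ?case by (simp add: scal_def mult_single distrib_left distrib_right mult.commute)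
  qed simp
  have const_commute: "Diff_class n (cf (const a)) \<otimes>\<^bsub>Diff_h n\<^esub> Diff_class n p
      = Diff_class n p \<otimes>\<^bsub>Diff_h n\<^esub> (Diff_class n (cf (const a)) :: 'k dalg set)" if "p \<in> free_carrier n" for a p
    unfolding const_scal using that by (simp add: Diff_class_mult[symmetric] free_scal scal_commute)
  show ?thesis
  proof
    fix u v :: "'k hfrac" assume u: "u \<in> Ubar_h n" and v: "v \<in> Ubar_h n"
    show "Diff_class n (cf (u + v)) = Diff_class n (cf u) \<oplus>\<^bsub>Diff_h n\<^esub> Diff_class n (cf v)"
      unfolding Diff_class_add[OF free_cf[OF u] free_cf[OF v], symmetric]
      by (rule Diff_class_relator[OF cf_add[OF u v]]) (intro free_add free_cf Ubar_add u v)+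
    show "Diff_class n (cf (u * v)) = Diff_class n (cf u) \<otimes>\<^bsub>Diff_h n\<^esub> Diff_class n (cf v)"
      unfolding Diff_class_mult[OF free_cf[OF u] free_cf[OF v], symmetric]
      by (rule Diff_class_relator[OF cf_mult[OF u v]]) (intro free_mult free_cf Ubar_mult u v)+
  next
    have "Diff_class n (cf (const 1)) = (Diff_class n (scal 1) :: 'k dalg set)" by (rule const_scal)
    moreover have "const 1 = (1 :: 'k hfrac)" by (rule unital_hom.hom_one[OF unital_hom_const])
    moreover have "scal 1 = (1 :: 'k dalg)" by (simp add: scal_def)
    ultimately show "Diff_class n (cf 1) = \<one>\<^bsub>Diff_h n :: 'k dalg set ring\<^esub>"
      using Diff_class_one by metis
  next
    fix i j assume i: "i \<in> {1..n}" and j: "j \<in> {1..n}"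
    have \<delta>: "(if i = j then 1 else 0) \<in> (Ubar_h n :: 'k hfrac set)" by (simp add: Ubar_zero Ubar_one)
    have u: "hh i + (if i = j then 1 else 0) \<in> (Ubar_h n :: 'k hfrac set)"
      "hh i - (if i = j then 1 else 0) \<in> (Ubar_h n :: 'k hfrac set)"
      by (intro Ubar_add Ubar_diff Ubar_hh i \<delta>)+
    show "Diff_class n (cf (hh i)) \<otimes>\<^bsub>Diff_h n\<^esub> Diff_class n (X j)
        = Diff_class n (X j) \<otimes>\<^bsub>Diff_h n\<^esub> Diff_class n (cf (hh i + (if i = j then 1 else 0)) :: 'k dalg)"
      unfolding Diff_class_mult[OF free_cf[OF Ubar_hh[OF i]] free_X[OF j], symmetric]
        Diff_class_mult[OF free_X[OF j] free_cf[OF u(1)], symmetric]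
      by (rule Diff_class_relator[OF h_X[OF i j]]) (intro closed Ubar_hh i j u)+
    show "Diff_class n (cf (hh i)) \<otimes>\<^bsub>Diff_h n\<^esub> Diff_class n (D j)
        = Diff_class n (D j) \<otimes>\<^bsub>Diff_h n\<^esub> Diff_class n (cf (hh i - (if i = j then 1 else 0)) :: 'k dalg)"
      unfolding Diff_class_mult[OF free_cf[OF Ubar_hh[OF i]] free_D[OF j], symmetric]
        Diff_class_mult[OF free_D[OF j] free_cf[OF u(2)], symmetric]
      by (rule Diff_class_relator[OF h_D[OF i j]]) (intro closed Ubar_hh i j u)+
  next
    fix i j assume i: "i \<in> {1..n}" and j: "j \<in> {1..n}" and ij: "i < j"
    then have "i \<noteq> j" by simp
    note U = Ubar_coefficients[OF i j this, where ?'k = 'k]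
    note c = U free_X[OF i] free_X[OF j] free_D[OF i] free_D[OF j]
    show "Diff_class n (X i) \<otimes>\<^bsub>Diff_h n\<^esub> Diff_class n (X j)
        = Diff_class n (cf ((hdiff i j + 1) / hdiff i j)) \<otimes>\<^bsub>Diff_h n\<^esub> Diff_class n (X j) \<otimes>\<^bsub>Diff_h n\<^esub> Diff_class n (X i :: 'k dalg)"
      by (rule Diff_class_relator_coeff[OF X_X[OF i j ij]]) (use c in \<open>simp_all only: free_cf\<close>)
    show "Diff_class n (D i) \<otimes>\<^bsub>Diff_h n\<^esub> Diff_class n (D j)
        = Diff_class n (cf ((hdiff i j - 1) / hdiff i j)) \<otimes>\<^bsub>Diff_h n\<^esub> Diff_class n (D j) \<otimes>\<^bsub>Diff_h n\<^esub> Diff_class n (D i :: 'k dalg)"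
      by (rule Diff_class_relator_coeff[OF D_D[OF i j ij]]) (use c in \<open>simp_all only: free_cf\<close>)
    show "Diff_class n (X i) \<otimes>\<^bsub>Diff_h n\<^esub> Diff_class n (D j) = Diff_class n (D j) \<otimes>\<^bsub>Diff_h n\<^esub> Diff_class n (X i :: 'k dalg)"
      by (rule Diff_class_relator_mult[OF X_D_less[OF i j ij]]) (use c in \<open>simp_all only: free_cf\<close>)
  next
    fix i j assume i: "i \<in> {1..n}" and j: "j \<in> {1..n}" and ij: "i > j"
    then have "i \<noteq> j" by simp
    note U = Ubar_coefficients[OF i j this, where ?'k = 'k]
    note c = U free_X[OF i] free_D[OF j]
    show "Diff_class n (X i) \<otimes>\<^bsub>Diff_h n\<^esub> Diff_class n (D j)
        = Diff_class n (cf (hdiff i j * (hdiff i j - 2) / (hdiff i j - 1)\<^sup>2)) \<otimes>\<^bsub>Diff_h n\<^esub> Diff_class n (D j)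
          \<otimes>\<^bsub>Diff_h n\<^esub> Diff_class n (X i :: 'k dalg)"
      by (rule Diff_class_relator_coeff[OF X_D_greater[OF i j ij]]) (use c in \<open>simp_all only: free_cf\<close>)
  next
    fix i assume i: "i \<in> {1..n}"
    have U: "1 / (1 - hdiff i j) \<in> (Ubar_h n :: 'k hfrac set)" if "j \<in> {1..n}" for j
      using Ubar_coefficients(4)[OF i that, where ?'k = 'k] Ubar_one by (cases "i = j") (auto simp: hdiff_def)
    have tm: "cf (1 / (1 - hdiff i j)) * D j * X j \<in> (free_carrier n :: 'k dalg set)" if "j \<in> {1..n}" for j
      by (intro closed U that)
    have sum: "(\<Sum>j=1..n. cf (1 / (1 - hdiff i j)) * D j * X j) \<in> (free_carrier n :: 'k dalg set)"
      by (intro free_sum tm)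
    have "Diff_class n (X i) \<otimes>\<^bsub>Diff_h n\<^esub> Diff_class n (D i) = (Diff_class n (X i * D i) :: 'k dalg set)"
      by (rule Diff_class_mult[symmetric]) (intro closed i)+
    also have "\<dots> = Diff_class n ((\<Sum>j=1..n. cf (1 / (1 - hdiff i j)) * D j * X j) - 1)"
      by (rule Diff_class_relator[OF X_D_same[OF i]]) (intro closed i free_diff free_one sum)+
    also have "\<dots> = (\<Oplus>\<^bsub>Diff_h n\<^esub>j\<in>{1..n}. Diff_class n (cf (1 / (1 - hdiff i j)) * D j * X j)) \<ominus>\<^bsub>Diff_h n\<^esub> \<one>\<^bsub>Diff_h n\<^esub>"
      unfolding Diff_class_diff[OF sum free_one] Diff_class_one by (subst Diff_class_sum) (use tm in auto)
    also have "(\<Oplus>\<^bsub>Diff_h n\<^esub>j\<in>{1..n}. Diff_class n (cf (1 / (1 - hdiff i j)) * D j * X j))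
        = (\<Oplus>\<^bsub>Diff_h n\<^esub>j\<in>{1..n}. Diff_class n (cf (1 / (1 - hdiff i j))) \<otimes>\<^bsub>Diff_h n\<^esub> Diff_class n (D j)
          \<otimes>\<^bsub>Diff_h n\<^esub> (Diff_class n (X j) :: 'k dalg set))"
      by (rule finsum_cong') (use U in \<open>auto simp: Diff_class_mult free_mult free_cf free_X free_D Diff_class_closed simp del: One_nat_def\<close>)
    finally show "Diff_class n (X i) \<otimes>\<^bsub>Diff_h n\<^esub> Diff_class n (D i)
        = (\<Oplus>\<^bsub>Diff_h n\<^esub>j\<in>{1..n}. Diff_class n (cf (1 / (1 - hdiff i j))) \<otimes>\<^bsub>Diff_h n\<^esub> Diff_class n (D j)
          \<otimes>\<^bsub>Diff_h n\<^esub> (Diff_class n (X j) :: 'k dalg set)) \<ominus>\<^bsub>Diff_h n\<^esub> \<one>\<^bsub>Diff_h n\<^esub>" .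
  qed (use const_commute in \<open>simp_all add: Diff_class_closed free_cf free_X free_D del: One_nat_def\<close>)
qed

lemma Diff_h_model:
  "diff_model (Diff_h n) n {1..n} (Ubar_h n) (\<lambda>u. Diff_class n (cf u))
    (\<lambda>j. Diff_class n (X j)) (\<lambda>j. Diff_class n (D j) :: 'k::{idom, ring_char_0} dalg set) (rho n)"
proof -
  interpret diff_relations "Diff_h n :: 'k dalg set ring" n "{1..n}" "Ubar_h n" "\<lambda>u. Diff_class n (cf u)"
    "\<lambda>j. Diff_class n (X j)" "\<lambda>j. Diff_class n (D j)"
    by (rule Diff_h_relations)
  have cases: "\<exists>p. p \<in> free_carrier n \<and> z = Diff_class n p" if "z \<in> carrier (Diff_h n)" for z :: "'k dalg set"
    using that unfolding Diff_class_carrier by blast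
  show ?thesis
  proof
    fix a b :: "'k dalg set" and f :: "'k state" and l
    assume a: "a \<in> carrier (Diff_h n)" and b: "b \<in> carrier (Diff_h n)"
    obtain p q where pq: "p \<in> free_carrier n" "a = Diff_class n p" "q \<in> free_carrier n" "b = Diff_class n q"
      using cases[OF a] cases[OF b] by blast
    show "rho n (a \<oplus>\<^bsub>Diff_h n\<^esub> b) f l = rho n a f l + rho n b f l"
      using pq by (simp add: Diff_class_add[symmetric] rho_class free_add)
    show "rho n (a \<otimes>\<^bsub>Diff_h n\<^esub> b) f = rho n a (rho n b f)"
      using pq by (simp add: Diff_class_mult[symmetric] rho_class free_mult)
  next
    fix a :: "'k dalg set" and \<kappa> and f :: "'k state" assume "a \<in> carrier (Diff_h n)"
    from cases[OF this] show "rho n a (\<lambda>l. \<kappa> * f l) = (\<lambda>l. \<kappa> * rho n a f l)"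
      by (auto simp: rho_class act_scale)
  next
    show "carrier (Diff_h n) \<subseteq> S" if "S \<subseteq> carrier (Diff_h n)" "\<one>\<^bsub>Diff_h n\<^esub> \<in> S"
      "\<And>a b. a \<in> S \<Longrightarrow> b \<in> S \<Longrightarrow> a \<oplus>\<^bsub>Diff_h n\<^esub> b \<in> S"
      "\<And>u a. u \<in> Ubar_h n \<Longrightarrow> a \<in> S \<Longrightarrow> Diff_class n (cf u) \<otimes>\<^bsub>Diff_h n\<^esub> a \<in> S"
      "\<And>j a. j \<in> {1..n} \<Longrightarrow> a \<in> S \<Longrightarrow> Diff_class n (X j) \<otimes>\<^bsub>Diff_h n\<^esub> a \<in> S"
      "\<And>j a. j \<in> {1..n} \<Longrightarrow> a \<in> S \<Longrightarrow> Diff_class n (D j) \<otimes>\<^bsub>Diff_h n\<^esub> a \<in> S"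
      for S :: "'k dalg set set"
      by (rule Diff_h_generated) (use that in blast)+
  qed (simp_all add: rho_class free_cf free_X free_D del: One_nat_def)
qed

end

text \<open>
  The partial derivatives of \<open>e\<^sub>k\<close> are elementary symmetric functions in the remaining variables.
\<close>

lemma c_elem_eq:
  assumes k: "k \<in> {1..n}"
  shows "c_elem n k = diff_relations.c (Diff_h n) {1..n} (\<lambda>u. Diff_class n (cf u))
    (\<lambda>j. Diff_class n (X j)) (\<lambda>j. Diff_class n (D j) :: 'k::idom dalg set) k"
proof -
  interpret diff_relations "Diff_h n :: 'k dalg set ring" n "{1..n}" "Ubar_h n" "\<lambda>u. Diff_class n (cf u)"
    "\<lambda>j. Diff_class n (X j)" "\<lambda>j. Diff_class n (D j)"
    by (rule Diff_h_relations)
  let ?e = "\<lambda>j. esymf hh ({1..n} - {j}) (k - 1) :: 'k hfrac"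
  have e: "Fraction_Field.Fract (pderivative j (esym n k)) 1 = ?e j" if "j \<in> {1..n}" for j
    unfolding pderivative_esym[OF k that] hom_esymf[OF unital_hom_Fract] hh_def ..
  have f: "Fraction_Field.Fract (esym n k) 1 = (esymf hh {1..n} k :: 'k hfrac)"
    unfolding esym_esymf hom_esymf[OF unital_hom_Fract] hh_def ..
  have eU: "?e j \<in> Ubar_h n" for j by (rule U_esymf) auto
  have fU: "esymf hh {1..n} k \<in> (Ubar_h n :: 'k hfrac set)" by (rule U_esymf) auto
  have tm: "cf (?e j) * (D j * X j) \<in> (free_carrier n :: 'k dalg set)" if "j \<in> {1..n}" for j
    by (intro free_mult free_cf free_D free_X eU that)
  have "c_elem n k = (Diff_class n ((\<Sum>j=1..n. cf (?e j) * (D j * X j)) - cf (esymf hh {1..n} k)) :: 'k dalg set)"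
    unfolding c_elem_def f by (rule arg_cong[where f = "\<lambda>p. Diff_class n (p - _)"]) (intro sum.cong refl, simp only: e)
  also have "\<dots> = (\<Oplus>\<^bsub>Diff_h n\<^esub>j\<in>{1..n}. Diff_class n (cf (?e j) * (D j * X j))) \<ominus>\<^bsub>Diff_h n\<^esub> Diff_class n (cf (esymf hh {1..n} k))"
  proof -
    have s: "(\<Sum>j=1..n. cf (?e j) * (D j * X j)) \<in> (free_carrier n :: 'k dalg set)" by (intro free_sum tm)
    show ?thesis
      unfolding Diff_class_diff[OF s free_cf[OF fU]] by (subst Diff_class_sum) (use tm in auto)
  qed
  also have "(\<Oplus>\<^bsub>Diff_h n\<^esub>j\<in>{1..n}. Diff_class n (cf (?e j) * (D j * X j)))
      = (\<Oplus>\<^bsub>Diff_h n\<^esub>j\<in>{1..n}. Diff_class n (cf (?e j)) \<otimes>\<^bsub>Diff_h n\<^esub> gam j)"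
    by (rule finsum_cong')
      (use eU in \<open>auto simp: gam_def Diff_class_mult free_mult free_cf free_X free_D Diff_class_closed simp del: One_nat_def\<close>)
  finally show ?thesis unfolding c_def gamma_form_def kf_uminus[OF fU] a_minus_def .
qed

theorem lemma8:
  fixes n :: nat
  assumes "n \<ge> 1"
  shows "ring_center (Diff_h n :: ('k::{idom, ring_char_0} dalg set) ring)
       = Diff_subalgebra n (c_elem n ` {1..n})"
proof -
  interpret diff_model "Diff_h n :: 'k dalg set ring" n "{1..n}" "Ubar_h n" "\<lambda>u. Diff_class n (cf u)"
    "\<lambda>j. Diff_class n (X j)" "\<lambda>j. Diff_class n (D j)" "rho n"
    by (rule Diff_h_model)
  have "c_elem n ` {1..n} = c ` {1..n}" by (rule image_cong[OF refl c_elem_eq])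
  then show ?thesis unfolding center_eq Diff_subalgebra_def Diff_class_scal by simp
qed

end
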